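(* Let $L\supset\mathbb F_q$ be a field and let $\underline M$ and $\underline M'$ be pure Anderson motives over $L$ (of the same characteristic $c^*:A\to L$). If $\underline M$ and $\underline M'$ have different weights, then $\operatorname{Hom}(\underline M,\underline M')=\{0\}$.
   Context: Notation: $\mathbb F_q$ is a finite field with $q$ elements, $C$ a smooth projective geometrically irreducible curve over $\mathbb F_q$, $\infty\in C(\mathbb F_q)$ a fixed rational point, $A=\Gamma(C\setminus\{\infty\},\mathcal O_C)$. For a field $L\supset\mathbb F_q$ put $C_L=C\times_{\mathbb F_q}\operatorname{Spec}L$, $A_L=A\otimes_{\mathbb F_q}L$; $\sigma$ is the endomorphism of $C_L$ which is the identity on $C$ and the $q$-Frobenius on $L$, and $\sigma^*$ is pullback along $\sigma$; on $A_L$, $\sigma^*(a\otimes b)=a\otimes b^q$, and $\sigma^*M=M\otimes_{A_L,\sigma^*}A_L$. $\mathcal G(k\cdot\infty)=\mathcal G\otimes\mathcal O_{C_L}(k\cdot\infty)$. Pure Anderson motives: fix an $\mathbb F_q$-homomorphism $c^*:A\to L$ and let $J\subset A_L$ be the ideal generated by all $a\otimes1-1\otimes c^*(a)$, $a\in A$. A pure Anderson motive $\underline M=(M,\tau)$ of rank $r$, dimension $d$ (non-negative integers) and characteristic $c^*$ over $L$ is a locally free $A_L$-module $M$ of rank $r$ with an injective $A_L$-homomorphism $\tau:\sigma^*M\to M$ such that (1) $\operatorname{coker}\tau$ is an $L$-vector space of dimension $d$ annihilated by $J^d$; (2) $M$ extends to a locally free sheaf $\mathcal M$ of rank $r$ on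 $C_L$ such that for some positive integers $k,l$ the map $\tau^l:=\tau\circ\sigma^*\tau\circ\dots\circ(\sigma^* )^{l-1}\tau:(\sigma^* )^lM\to M$ induces an isomorphism $(\sigma^* )^l\mathcal M_\infty\to\mathcal M(k\cdot\infty)_\infty$ of stalks at $\infty$. For $r>0$ the weight of $\underline M$ is $k/l$ (which equals $d/r$). A morphism $(M,\tau)\to(M',\tau')$ is an $A_L$-homomorphism $f:M\to M'$ with $f\circ\tau=\tau'\circ\sigma^*f$; $\operatorname{Hom}(\underline M,\underline M')$ is the $A$-module of morphisms. *)

theory Defs
  imports
    "HOL-Analysis.Abstract_Topology"
    "HOL-Algebra.Algebra"
    "HOL-Algebra.Free_Abelian_Groups"
    "HOL-Algebra.Algebraic_Closure_Type"
    "Jordan_Normal_Form.Matrix"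
begin

text \<open>
  Everything takes place inside one ambient field \<open>'a\<close>, the function field \<open>K\<close> of \<open>C\<^sub>L\<close>,
  i.e. the fraction field of \<open>F \<otimes> L\<close> over \<open>\<F>\<^sub>q\<close>, where \<open>F\<close> is the function field of \<open>C\<close>.
  The curves \<open>C\<close> and \<open>C\<^sub>L\<close> are integral and separated, hence determined by the local rings of
  their points, regarded as subrings of the function field (the generic point has the function
  field itself as its local ring). Points are therefore identified with their local rings.
\<close>

abbreviation ring_on :: "'a::field set \<Rightarrow> 'a ring" where
  "ring_on S \<equiv> ring_of_type_algebra\<lparr>carrier := S\<rparr>"

abbreviation ambient :: "'a::field ring" where
  "ambient \<equiv> ring_of_type_algebra"

definition fractions :: "'a::field set \<Rightarrow> 'a set \<Rightarrow> 'a set" where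
  "fractions R T = {a / t | a t. a \<in> R \<and> t \<in> T}"

definition max_ideal :: "'a::field set \<Rightarrow> 'a set" where
  "max_ideal P = {x \<in> P. x = 0 \<or> inverse x \<notin> P}"

text \<open>The image of \<open>S \<otimes> L \<rightarrow> K\<close>; by the linear disjointness required below, for
  \<open>S \<subseteq> F\<close> this map is injective over the field of constants.\<close>

definition compositum :: "'a::field set \<Rightarrow> 'a set \<Rightarrow> 'a set" where
  "compositum S L = {\<Sum>i<n. s i * b i | (n::nat) s b. (\<forall>i<n. s i \<in> S \<and> b i \<in> L)}"


section \<open>The curve, its base change, and the Frobenius\<close>

definition discrete_valuation_rings :: "'a::field set \<Rightarrow> 'a set \<Rightarrow> 'a set set" where
  "discrete_valuation_rings k F = {P. k \<subseteq> P \<and> (\<exists>v :: 'a \<Rightarrow> int.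
     v ` (F - {0}) = UNIV \<and>
     (\<forall>x\<in>F - {0}. \<forall>y\<in>F - {0}. v (x * y) = v x + v y \<and>
        (x + y \<noteq> 0 \<longrightarrow> min (v x) (v y) \<le> v (x + y))) \<and>
     P = {x \<in> F. x = 0 \<or> 0 \<le> v x})}"

text \<open>The complete regular curve with function field \<open>F\<close> over \<open>k\<close>: the generic point together
  with the closed points.\<close>

definition curve_points :: "'a::field set \<Rightarrow> 'a set \<Rightarrow> 'a set set" where
  "curve_points k F = insert F (discrete_valuation_rings k F)"

record 'a curve_data =
  Fq :: "'a set"
  FunField :: "'a set"
  Oinf :: "'a set"  \<comment> \<open>the local ring of \<open>C\<close> at \<open>\<infinity>\<close>, standing for the point \<open>\<infinity>\<close>\<close>
  Lfield :: "'a set"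
  frob :: "'a \<Rightarrow> 'a"  \<comment> \<open>the action of \<open>\<sigma>\<^sup>*\<close> on \<open>K\<close>\<close>

text \<open>
  Since a finite field is perfect, smooth projective geometrically irreducible curves over it
  correspond to function fields of one variable in which it is algebraically closed.
  The last three clauses before the one on \<open>frob\<close> say that \<open>\<infinity>\<close> is rational, that
  \<open>F \<otimes> L \<rightarrow> K\<close> is injective, and that \<open>K\<close> is the fraction field of the image. The clause on
  \<open>frob\<close> determines it uniquely.
\<close>

definition curve_setting :: "'a::field curve_data \<Rightarrow> bool" where
  "curve_setting D \<longleftrightarrow>
     subfield (Fq D) ambient \<and> subfield (FunField D) ambient \<and> subfield (Lfield D) ambient \<and>
     Fq D \<subseteq> FunField D \<and> Fq D \<subseteq> Lfield D \<and> finite (Fq D) \<and>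
     (\<exists>x\<in>FunField D. ring.transcendental ambient (Fq D) x \<and>
        ring.finite_dimension ambient (generate_field ambient (insert x (Fq D))) (FunField D)) \<and>
     (\<forall>x\<in>FunField D. \<not> ring.transcendental ambient (Fq D) x \<longrightarrow> x \<in> Fq D) \<and>
     Oinf D \<in> discrete_valuation_rings (Fq D) (FunField D) \<and>
     (\<forall>x\<in>Oinf D. \<exists>a\<in>Fq D. x - a \<in> max_ideal (Oinf D)) \<and>
     (\<forall>us. set us \<subseteq> FunField D \<and> ring.independent ambient (Fq D) us \<longrightarrow>
        ring.independent ambient (Lfield D) us) \<and>
     fractions (compositum (FunField D) (Lfield D))
       (compositum (FunField D) (Lfield D) - {0}) = UNIV \<and>
     frob D \<in> Ring.ring_hom ambient ambient \<and>
     (\<forall>x\<in>FunField D. frob D x = x) \<and>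
     (\<forall>b\<in>Lfield D. frob D b = b ^ card (Fq D))"

definition coord_ring :: "'a::field curve_data \<Rightarrow> 'a set" where
  "coord_ring D = \<Inter> (curve_points (Fq D) (FunField D) - {Oinf D})"

definition coord_ring_L :: "'a::field curve_data \<Rightarrow> 'a set" where
  "coord_ring_L D = compositum (coord_ring D) (Lfield D)"

text \<open>The points of \<open>C\<^sub>L = C \<times> Spec L\<close> lying over a generization of \<open>P \<in> C\<close> are the
  primes of \<open>\<O>\<^sub>P \<otimes> L\<close>.\<close>

definition curve_L :: "'a::field curve_data \<Rightarrow> 'a set set" where
  "curve_L D = {fractions R (R - p) | R p P.
     P \<in> curve_points (Fq D) (FunField D) \<and> R = compositum P (Lfield D) \<and>
     primeideal p (ring_on R)}"

text \<open>The local ring at the unique point of \<open>C\<^sub>L\<close> over the rational point \<open>\<infinity>\<close>; it again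
  stands for that point.\<close>

definition infL :: "'a::field curve_data \<Rightarrow> 'a set" where
  "infL D = (let R = compositum (Oinf D) (Lfield D)
     in fractions R (R - genideal (ring_on R) (max_ideal (Oinf D))))"

text \<open>The Zariski topology: the domains of definition of rational functions form a subbasis.
  The structure sheaf on a nonempty open set \<open>W\<close> is \<open>\<Inter> W\<close>.\<close>

definition zariski :: "'a set set \<Rightarrow> 'a set topology" where
  "zariski Y = topology_generated_by (range (\<lambda>f. {P \<in> Y. f \<in> P}))"


section \<open>Modules, quotients and base change\<close>

definition module_homs ::
  "'r set \<Rightarrow> ('r, 'm) module \<Rightarrow> ('r, 'n) module \<Rightarrow> ('m \<Rightarrow> 'n) set" where
  "module_homs R M N = {h \<in> carrier M \<rightarrow> carrier N.
     (\<forall>x\<in>carrier M. \<forall>y\<in>carrier M. h (x \<oplus>\<^bsub>M\<^esub> y) = h x \<oplus>\<^bsub>N\<^esub> h y) \<and>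
     (\<forall>a\<in>R. \<forall>x\<in>carrier M. h (a \<odot>\<^bsub>M\<^esub> x) = a \<odot>\<^bsub>N\<^esub> h x)}"

definition has_basis :: "'r set \<Rightarrow> ('r, 'm) module \<Rightarrow> nat \<Rightarrow> (nat \<Rightarrow> 'm) \<Rightarrow> bool" where
  "has_basis R M n e \<longleftrightarrow> (\<forall>i<n. e i \<in> carrier M) \<and>
     (\<forall>x\<in>carrier M. \<exists>!a. a \<in> {..<n} \<rightarrow>\<^sub>E R \<and> x = (\<Oplus>\<^bsub>M\<^esub>i\<in>{..<n}. a i \<odot>\<^bsub>M\<^esub> e i))"

definition quot_module :: "('r, 'm) module \<Rightarrow> 'm set \<Rightarrow> ('r, 'm set) module" where
  "quot_module M N = \<lparr>carrier = a_rcosets\<^bsub>M\<^esub> N, monoid.mult = undefined, one = undefined,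
     ring.zero = N, add = set_add M, module.smult = (\<lambda>a Y. \<Union>x\<in>Y. N +>\<^bsub>M\<^esub> (a \<odot>\<^bsub>M\<^esub> x))\<rparr>"

type_synonym ('a, 'm) tensor = "(('m \<times> 'a) \<Rightarrow>\<^sub>0 int) set"

text \<open>\<open>base_change R S \<phi> M\<close> is \<open>M \<otimes> S\<close> over \<open>R\<close>, where \<open>S\<close> is an \<open>R\<close>-algebra via \<open>\<phi>\<close>:
  the free abelian group on \<open>M \<times> S\<close> modulo the usual relations, with \<open>S\<close> acting on the second
  factor.\<close>

definition free_pairs :: "'a::field set \<Rightarrow> ('a, 'm) module \<Rightarrow> ('a, ('m \<times> 'a) \<Rightarrow>\<^sub>0 int) module"
  where
  "free_pairs S M = \<lparr>carrier = {c. Poly_Mapping.keys c \<subseteq> carrier M \<times> S},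
     monoid.mult = undefined, one = undefined, ring.zero = 0, add = (+),
     module.smult = (\<lambda>s. frag_extend (\<lambda>(m, b). frag_of (m, s * b)))\<rparr>"

definition tensor_relations ::
  "'a::field set \<Rightarrow> 'a set \<Rightarrow> ('a \<Rightarrow> 'a) \<Rightarrow> ('a, 'm) module \<Rightarrow> (('m \<times> 'a) \<Rightarrow>\<^sub>0 int) set" where
  "tensor_relations R S \<phi> M = generate (add_monoid (free_pairs S M))
     ({frag_of (m \<oplus>\<^bsub>M\<^esub> n, b) - frag_of (m, b) - frag_of (n, b) | m n b.
         m \<in> carrier M \<and> n \<in> carrier M \<and> b \<in> S} \<union>
      {frag_of (m, b + c) - frag_of (m, b) - frag_of (m, c) | m b c.
         m \<in> carrier M \<and> b \<in> S \<and> c \<in> S} \<union>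
      {frag_of (a \<odot>\<^bsub>M\<^esub> m, b) - frag_of (m, \<phi> a * b) | a m b.
         a \<in> R \<and> m \<in> carrier M \<and> b \<in> S})"

definition base_change ::
  "'a::field set \<Rightarrow> 'a set \<Rightarrow> ('a \<Rightarrow> 'a) \<Rightarrow> ('a, 'm) module \<Rightarrow> ('a, ('a, 'm) tensor) module"
  where
  "base_change R S \<phi> M = quot_module (free_pairs S M) (tensor_relations R S \<phi> M)"

definition pure_tensor ::
  "'a::field set \<Rightarrow> 'a set \<Rightarrow> ('a \<Rightarrow> 'a) \<Rightarrow> ('a, 'm) module \<Rightarrow> 'm \<Rightarrow> 'a \<Rightarrow> ('a, 'm) tensor"
  where
  "pure_tensor R S \<phi> M m b = tensor_relations R S \<phi> M +>\<^bsub>free_pairs S M\<^esub> frag_of (m, b)"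

text \<open>The map \<open>f \<otimes> id\<close>.\<close>

definition base_change_map ::
  "'a::field set \<Rightarrow> 'a set \<Rightarrow> ('a \<Rightarrow> 'a) \<Rightarrow> ('a, 'm) module \<Rightarrow> ('a, 'n) module \<Rightarrow>
   ('m \<Rightarrow> 'n) \<Rightarrow> ('a, 'm) tensor \<Rightarrow> ('a, 'n) tensor" where
  "base_change_map R S \<phi> M N f Y = (\<Union>x\<in>Y. tensor_relations R S \<phi> N
     +>\<^bsub>free_pairs S N\<^esub> frag_extend (\<lambda>(m, b). frag_of (f m, b)) x)"

definition locally_free :: "'a::field set \<Rightarrow> nat \<Rightarrow> ('a, 'm) module \<Rightarrow> bool" where
  "locally_free R r M \<longleftrightarrow> module (ring_on R) M \<and>
     (\<exists>T \<subseteq> R - {0}. genideal (ring_on R) T = R \<and>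
        (\<forall>f\<in>T. let Rf = fractions R (range (\<lambda>n. f ^ n))
           in \<exists>e. has_basis Rf (base_change R Rf id M) r e))"


section \<open>Locally free sheaves\<close>

text \<open>
  After trivialising the generic stalk, a locally free sheaf of rank \<open>r\<close> on an integral curve
  with function field \<open>K\<close> is a subsheaf \<open>E\<close> of the constant sheaf \<open>K\<^sup>r\<close> which near each point is
  the image of \<open>\<O>\<^sup>r\<close> under some \<open>g \<in> GL\<^sub>r(K)\<close>. Only the values of \<open>E\<close> on nonempty open sets
  matter; as these always meet, the gluing axiom takes the form below.
\<close>

definition submod_vec :: "nat \<Rightarrow> 'a::field vec set \<Rightarrow> ('a, 'a vec) module" where
  "submod_vec r V = (module_vec TYPE('a) r)\<lparr>carrier := V\<rparr>"

definition locally_free_sheaf ::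
  "'a::field set set \<Rightarrow> nat \<Rightarrow> ('a set set \<Rightarrow> 'a vec set) \<Rightarrow> bool" where
  "locally_free_sheaf Y r E \<longleftrightarrow>
     (\<forall>W. openin (zariski Y) W \<and> W \<noteq> {} \<longrightarrow>
        E W \<subseteq> carrier_vec r \<and> module (ring_on (\<Inter>W)) (submod_vec r (E W))) \<and>
     (\<forall>\<W>. \<W> \<noteq> {} \<and> (\<forall>W\<in>\<W>. openin (zariski Y) W \<and> W \<noteq> {}) \<longrightarrow>
        E (\<Union>\<W>) = (\<Inter>W\<in>\<W>. E W)) \<and>
     (\<forall>P\<in>Y. \<exists>W g. openin (zariski Y) W \<and> P \<in> W \<and> g \<in> carrier_mat r r \<and> invertible_mat g \<and>
        (\<forall>W'. openin (zariski Y) W' \<and> W' \<noteq> {} \<and> W' \<subseteq> W \<longrightarrow>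
           E W' = {g *\<^sub>v a | a. a \<in> carrier_vec r \<and> (\<forall>i<r. a $ i \<in> \<Inter>W')}))"

definition stalk :: "'a set set \<Rightarrow> ('a set set \<Rightarrow> 'a vec set) \<Rightarrow> 'a set \<Rightarrow> 'a vec set" where
  "stalk Y E P = \<Union> {E W | W. openin (zariski Y) W \<and> P \<in> W}"

text \<open>The stalk at \<open>P\<close> of \<open>E \<otimes> \<O>(k\<cdot>P)\<close>: the stalk of \<open>\<O>(k\<cdot>P)\<close> consists of the \<open>x\<close> that are
  multiplied into the local ring by the \<open>k\<close>-th power of the maximal ideal. It is free of rank
  one, so every element of the tensor product is a pure tensor.\<close>

definition twisted_stalk ::
  "'a::field set set \<Rightarrow> ('a set set \<Rightarrow> 'a vec set) \<Rightarrow> 'a set \<Rightarrow> nat \<Rightarrow> 'a vec set" where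
  "twisted_stalk Y E P k = {x \<cdot>\<^sub>v v | x v. v \<in> stalk Y E P \<and>
     (\<forall>a \<in> max_ideal P [^]\<^bsub>ideals_set (ring_on P)\<^esub> k. a * x \<in> P)}"


section \<open>Pure Anderson motives\<close>

abbreviation sigma_star ::
  "'a::field curve_data \<Rightarrow> ('a, 'm) module \<Rightarrow> ('a, ('a, 'm) tensor) module" where
  "sigma_star D M \<equiv> base_change (coord_ring_L D) (coord_ring_L D) (frob D) M"

abbreviation sigma_star_map ::
  "'a::field curve_data \<Rightarrow> ('a, 'm) module \<Rightarrow> ('a, 'n) module \<Rightarrow> ('m \<Rightarrow> 'n) \<Rightarrow>
   ('a, 'm) tensor \<Rightarrow> ('a, 'n) tensor" where
  "sigma_star_map D M N \<equiv> base_change_map (coord_ring_L D) (coord_ring_L D) (frob D) M N"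

abbreviation sigma_tensor ::
  "'a::field curve_data \<Rightarrow> ('a, 'm) module \<Rightarrow> 'm \<Rightarrow> 'a \<Rightarrow> ('a, 'm) tensor" where
  "sigma_tensor D M \<equiv> pure_tensor (coord_ring_L D) (coord_ring_L D) (frob D) M"

text \<open>The ideal \<open>J\<close> generated by all \<open>a \<otimes> 1 - 1 \<otimes> c\<^sup>*(a)\<close>.\<close>

definition char_ideal :: "'a::field curve_data \<Rightarrow> ('a \<Rightarrow> 'a) \<Rightarrow> 'a set" where
  "char_ideal D c = genideal (ring_on (coord_ring_L D)) {a - c a | a. a \<in> coord_ring D}"

definition characteristic :: "'a::field curve_data \<Rightarrow> ('a \<Rightarrow> 'a) \<Rightarrow> bool" where
  "characteristic D c \<longleftrightarrow>
     c \<in> Ring.ring_hom (ring_on (coord_ring D)) (ring_on (Lfield D)) \<and> (\<forall>x\<in>Fq D. c x = x)"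

text \<open>If \<open>\<Phi>\<close> is the matrix of \<open>\<tau>\<close> on the generic fibre, where \<open>\<sigma>\<^sup>*K\<^sup>r = K\<^sup>r\<close>, then
  \<open>\<Phi> \<sigma>(\<Phi>) \<dots> \<sigma>\<^sup>l\<^sup>-\<^sup>1(\<Phi>)\<close> is the matrix of \<open>\<tau>\<^sup>l\<close>.\<close>

fun frob_power :: "nat \<Rightarrow> ('a::field \<Rightarrow> 'a) \<Rightarrow> 'a mat \<Rightarrow> nat \<Rightarrow> 'a mat" where
  "frob_power r \<sigma> \<Phi> 0 = 1\<^sub>m r"
| "frob_power r \<sigma> \<Phi> (Suc l) = frob_power r \<sigma> \<Phi> l * map_mat (\<sigma> ^^ l) \<Phi>"

text \<open>
  The purity condition for given \<open>k\<close> and \<open>l\<close>. The isomorphism \<open>\<iota>\<close> exhibits \<open>E\<close> as an extension of \<open>M\<close>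
  (quasi-coherent sheaves on the affine scheme \<open>C\<^sub>L - \<infinity>\<close> are determined by their global
  sections), and \<open>\<Phi>\<close> is \<open>\<tau>\<close> on generic fibres. The stalk at \<open>\<infinity>\<close> of \<open>(\<sigma>\<^sup>*)\<^sup>l E = (\<sigma>\<^sup>l)\<^sup>* E\<close> is the
  base change of that of \<open>E\<close> along \<open>\<sigma>\<^sup>l\<close> on the local ring, as \<open>\<sigma>\<close> fixes \<open>\<infinity>\<close>; \<open>h\<close> is the map that
  \<open>\<tau>\<^sup>l\<close> induces from it to the generic stalk.
\<close>

definition pure_with ::
  "'a::field curve_data \<Rightarrow> nat \<Rightarrow> ('a, 'm) module \<Rightarrow> (('a, 'm) tensor \<Rightarrow> 'm) \<Rightarrow>
   nat \<Rightarrow> nat \<Rightarrow> bool" where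
  "pure_with D r M \<tau> k l \<longleftrightarrow> 0 < k \<and> 0 < l \<and>
     (\<exists>E \<iota> \<Phi>.
        locally_free_sheaf (curve_L D) r E \<and>
        \<iota> \<in> module_homs (coord_ring_L D) M (submod_vec r (E (curve_L D - {infL D}))) \<and>
        bij_betw \<iota> (carrier M) (E (curve_L D - {infL D})) \<and>
        \<Phi> \<in> carrier_mat r r \<and>
        (\<forall>m\<in>carrier M. \<forall>b\<in>coord_ring_L D.
           \<iota> (\<tau> (sigma_tensor D M m b)) = b \<cdot>\<^sub>v (\<Phi> *\<^sub>v map_vec (frob D) (\<iota> m))) \<and>
        (let Einf = stalk (curve_L D) E (infL D);
             N = submod_vec r Einf;
             Etw = twisted_stalk (curve_L D) E (infL D) k;
             \<sigma>l = frob D ^^ l;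
             N' = base_change (infL D) (infL D) \<sigma>l N
         in \<exists>h. h \<in> module_homs (infL D) N' (submod_vec r Etw) \<and>
               bij_betw h (carrier N') Etw \<and>
               (\<forall>v\<in>Einf. \<forall>b\<in>infL D. h (pure_tensor (infL D) (infL D) \<sigma>l N v b) =
                  b \<cdot>\<^sub>v (frob_power r (frob D) \<Phi> l *\<^sub>v map_vec \<sigma>l v))))"

definition pure_anderson_motive ::
  "'a::field curve_data \<Rightarrow> ('a \<Rightarrow> 'a) \<Rightarrow> nat \<Rightarrow> nat \<Rightarrow>
   ('a, 'm) module \<Rightarrow> (('a, 'm) tensor \<Rightarrow> 'm) \<Rightarrow> bool" where
  "pure_anderson_motive D c r d M \<tau> \<longleftrightarrow>
     locally_free (coord_ring_L D) r M \<and>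
     \<tau> \<in> module_homs (coord_ring_L D) (sigma_star D M) M \<and>
     inj_on \<tau> (carrier (sigma_star D M)) \<and>
     (let coker = quot_module M (\<tau> ` carrier (sigma_star D M));
          Jd = char_ideal D c [^]\<^bsub>ideals_set (ring_on (coord_ring_L D))\<^esub> d
      in (\<exists>e. has_basis (Lfield D) coker d e) \<and>
         (\<forall>j\<in>Jd. \<forall>x\<in>carrier coker. j \<odot>\<^bsub>coker\<^esub> x = \<zero>\<^bsub>coker\<^esub>)) \<and>
     (\<exists>k l. pure_with D r M \<tau> k l)"

text \<open>For \<open>r > 0\<close> the quotient \<open>k / l\<close> is unique; for \<open>r = 0\<close> the value is unspecified.\<close>

definition weight ::
  "'a::field curve_data \<Rightarrow> nat \<Rightarrow> ('a, 'm) module \<Rightarrow> (('a, 'm) tensor \<Rightarrow> 'm) \<Rightarrow> rat" where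
  "weight D r M \<tau> = (THE w. \<exists>k l. pure_with D r M \<tau> k l \<and> w = of_nat k / of_nat l)"

definition motive_Hom ::
  "'a::field curve_data \<Rightarrow> ('a, 'm) module \<Rightarrow> (('a, 'm) tensor \<Rightarrow> 'm) \<Rightarrow>
   ('a, 'n) module \<Rightarrow> (('a, 'n) tensor \<Rightarrow> 'n) \<Rightarrow> ('m \<Rightarrow> 'n) set" where
  "motive_Hom D M \<tau> M' \<tau>' =
     {f \<in> module_homs (coord_ring_L D) M M' \<inter> extensional (carrier M).
        \<forall>x\<in>carrier (sigma_star D M). f (\<tau> x) = \<tau>' (sigma_star_map D M M' f x)}"

end

(*
  Let f be a nonzero morphism. At infinity the local ring of C_L is a discrete valuation ring with
  a uniformizer fixed by sigma, so on a lattice g O^r spanning the stalk, purity says that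
  tau^l (sigma^l)^* g = pi^(-k) g U with U invertible over O. Iterating to a common power n of the
  two Frobenius maps, the matrix H of f in the two lattices satisfies H U = pi^e U' sigma^n(H), where
  e is proportional to the difference of the weights. Since sigma^n preserves the valuation, comparing the
  minimal valuation of the entries of both sides forces e = 0 or H = 0.

  To speak of matrices one needs Frac(A_L) = K. Either A contains an element transcendental over the
  constants, and then A is large enough by integrality; or A = F_q, so A_L = L is a field, M is a
  finite-dimensional L-space whose elements have bounded pole order at infinity, and since tau raises
  pole orders, M = 0.
*)

theory Submission
  imports Defs "Jordan_Normal_Form.Determinant"
begin

section \<open>Subrings of a field\<close>

text \<open>Two obstacles shape the proof. First, \<open>infL D\<close> must be recognised as a
  discrete valuation ring by hand: linear disjointness keeps 1 out of the ideal of the uniformizer,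
  and a nonzero sum of tensors has finite order by induction on its number of terms. The uniformizer
  lies in \<open>F\<close>, so \<sigma> preserves orders exactly. Second, \<open>M\<close> is an
  abstract module. Purity embeds it in a vector space over the function field, and a single
  localization in which \<open>M\<close> is free supplies \<open>r\<close> independent elements of
  \<open>M\<close>. Once every function has a denominator in \<open>A\<^sub>L\<close>, their images
  form an invertible matrix, through which a morphism becomes a matrix. Whether \<open>A\<close> has
  nonconstant elements is left undecided, hence the two cases.

  Finally, \<open>weight\<close> is a definite description. The uniqueness of the quotient behind it
  is drawn from the morphism: a nonzero value makes every admissible pair of \<open>M\<close>
  proportional to every admissible pair of \<open>M'\<close>, which gives uniqueness and equality of
  the weights at once. Rank zero falls under the same argument.\<close>

lemma ambient_simps [simp]:
  "carrier ambient = UNIV" "x \<otimes>\<^bsub>ambient\<^esub> y = x * y" "x \<oplus>\<^bsub>ambient\<^esub> y = x + y"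
  "\<one>\<^bsub>ambient\<^esub> = 1" "\<zero>\<^bsub>ambient\<^esub> = 0"
  "x \<otimes>\<^bsub>ring_on S\<^esub> y = x * y" "x \<oplus>\<^bsub>ring_on S\<^esub> y = x + y"
  "\<one>\<^bsub>ring_on S\<^esub> = 1" "\<zero>\<^bsub>ring_on S\<^esub> = 0"
  by (simp_all add: ring_of_type_algebra_def)

interpretation ambient: domain "ambient :: 'a::field ring"
  by (rule field.axioms(1)[OF field_from_type_algebra])

lemma ambient_minus [simp]: "\<ominus>\<^bsub>ambient\<^esub> x = - x"
  by (metis ambient.minus_equality ambient_simps(1,3,5) UNIV_I add.left_inverse)

lemma ambient_inverse: "x \<noteq> 0 \<Longrightarrow> inv\<^bsub>ambient\<^esub> x = inverse x"
  by (metis ambient.comm_inv_char ambient_simps(1,2,4) UNIV_I right_inverse)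

lemma subring_ambient_iff:
  "subring S ambient \<longleftrightarrow> 1 \<in> S \<and> (\<forall>x\<in>S. - x \<in> S) \<and> (\<forall>x\<in>S. \<forall>y\<in>S. x * y \<in> S \<and> x + y \<in> S)"
  (is "?l \<longleftrightarrow> ?r")
proof
  assume ?l
  from subringE[OF this] show ?r by simp
next
  assume ?r
  then show ?l by (intro ambient.subringI) auto
qed

context
  fixes S :: "'a::field set"
  assumes S: "subring S ambient"
begin

lemma subring_one: "1 \<in> S" and subring_uminus: "x \<in> S \<Longrightarrow> - x \<in> S"
  and subring_times: "x \<in> S \<Longrightarrow> y \<in> S \<Longrightarrow> x * y \<in> S"
  and subring_plus: "x \<in> S \<Longrightarrow> y \<in> S \<Longrightarrow> x + y \<in> S"
  using S by (auto simp: subring_ambient_iff)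

lemma subring_zero: "0 \<in> S"
  using subring_plus[OF subring_one subring_uminus[OF subring_one]] by simp

lemma subring_minus: "x \<in> S \<Longrightarrow> y \<in> S \<Longrightarrow> x - y \<in> S"
  using subring_plus[OF _ subring_uminus] by fastforce

lemma subring_power: "x \<in> S \<Longrightarrow> x ^ n \<in> S"
  by (induction n) (auto intro: subring_times subring_one)

lemma subring_sum: "(\<And>i. i \<in> I \<Longrightarrow> f i \<in> S) \<Longrightarrow> sum f I \<in> S"
  by (induction I rule: infinite_finite_induct) (auto intro: subring_plus subring_zero)

lemma subring_prod: "(\<And>i. i \<in> I \<Longrightarrow> f i \<in> S) \<Longrightarrow> prod f I \<in> S"
  by (induction I rule: infinite_finite_induct) (auto intro: subring_times subring_one)

lemma ring_on_cring: "cring (ring_on S)"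
  using ambient.subring_is_domain[OF S] by (simp add: domain_def)

end

lemmas subring_closed = subring_zero subring_one subring_uminus subring_times subring_plus
  subring_minus subring_power subring_sum subring_prod

lemma subfield_ambient_iff:
  "subfield S ambient \<longleftrightarrow> subring S ambient \<and> (\<forall>x\<in>S. inverse x \<in> S)" (is "?l \<longleftrightarrow> ?r")
proof
  assume l: ?l
  have "inverse x \<in> S" if "x \<in> S" for x
    using ambient.subfield_m_inv(1)[OF l, of x] that by (cases "x = 0") (auto simp: ambient_inverse)
  then show ?r using subfieldE(1)[OF l] by blast
next
  assume ?r
  then show ?l by (intro field.subfieldI'[OF field_from_type_algebra]) (auto simp: ambient_inverse)
qed

lemma subfield_divide:
  "subfield S ambient \<Longrightarrow> x \<in> S \<Longrightarrow> y \<in> S \<Longrightarrow> x / y \<in> S" for x :: "'a::field"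
  unfolding subfield_ambient_iff divide_inverse by (auto intro: subring_times)

section \<open>Sums of products from two subrings\<close>

lemma compositum_0: "0 \<in> compositum S L"
  unfolding compositum_def by (rule CollectI, rule exI[of _ 0]) auto

lemma compositum_add_tensor:
  assumes "x \<in> compositum S L" "s \<in> S" "b \<in> L"
  shows "x + s * b \<in> compositum S L"
proof -
  obtain n :: nat and f g where x: "x = (\<Sum>i<n. f i * g i)" and *: "\<forall>i<n. f i \<in> S \<and> g i \<in> L"
    using assms(1) unfolding compositum_def by auto
  have "x + s * b = (\<Sum>i<Suc n. (f(n := s)) i * (g(n := b)) i)"
    by (simp add: x)
  moreover have "\<forall>i<Suc n. (f(n := s)) i \<in> S \<and> (g(n := b)) i \<in> L"
    using * assms by (auto simp: less_Suc_eq)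
  ultimately show ?thesis unfolding compositum_def by blast
qed

text \<open>Adding one tensor at a time replaces most reasoning about indexed sums, both for base
  change to \<open>L\<close> and for polynomial rings.\<close>

lemma compositum_induct [consumes 1, case_names zero tensor]:
  assumes "x \<in> compositum S L" and "P 0"
    and "\<And>x s b. x \<in> compositum S L \<Longrightarrow> P x \<Longrightarrow> s \<in> S \<Longrightarrow> b \<in> L \<Longrightarrow> P (x + s * b)"
  shows "P x"
proof -
  obtain n :: nat and f g where x: "x = (\<Sum>i<n. f i * g i)" and *: "\<forall>i<n. f i \<in> S \<and> g i \<in> L"
    using assms(1) unfolding compositum_def by auto
  have "(\<Sum>i<m. f i * g i) \<in> compositum S L \<and> P (\<Sum>i<m. f i * g i)" if "m \<le> n" for m
    using that
  proof (induction m)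
    case (Suc m)
    then show ?case using assms(3)[of "\<Sum>i<m. f i * g i" "f m" "g m"] *
      by (auto intro: compositum_add_tensor)
  qed (use assms(2) compositum_0 in auto)
  then show ?thesis unfolding x by blast
qed

lemma compositum_add:
  assumes "x \<in> compositum S L" "y \<in> compositum S L"
  shows "x + y \<in> compositum S L"
  using assms(2,1)
  by (induction rule: compositum_induct) (auto simp: add.assoc[symmetric] intro: compositum_add_tensor)

lemma compositum_subset:
  assumes "subring T ambient" "S \<subseteq> T" "L \<subseteq> T"
  shows "compositum S L \<subseteq> T"
proof
  fix x assume "x \<in> compositum S L"
  then show "x \<in> T"
    by (induction rule: compositum_induct) (use assms in \<open>auto intro!: subring_closed\<close>)
qed

context
  fixes S L :: "'a::field set"
  assumes S: "subring S ambient" and L: "subring L ambient"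
begin

lemma compositum_tensor: "s \<in> S \<Longrightarrow> b \<in> L \<Longrightarrow> s * b \<in> compositum S L"
  using compositum_add_tensor[OF compositum_0] by fastforce

lemma compositum_left: "S \<subseteq> compositum S L"
  using compositum_tensor[OF _ subring_one[OF L]] by auto

lemma compositum_right: "L \<subseteq> compositum S L"
  using compositum_tensor[OF subring_one[OF S]] by auto

text \<open>Closure under products takes two inductions: over one factor against a single tensor,
  then over the other factor.\<close>

lemma compositum_subring: "subring (compositum S L) ambient"
proof -
  have tens: "x * (s * b) \<in> compositum S L" if "x \<in> compositum S L" "s \<in> S" "b \<in> L" for x s b
    using that
  proof (induction rule: compositum_induct)
    case (tensor x t c)
    have "(x + t * c) * (s * b) = x * (s * b) + (t * s) * (c * b)" by (simp add: algebra_simps)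
    also have "\<dots> \<in> compositum S L"
      by (intro compositum_add_tensor tensor.IH tensor.prems subring_times[OF S] subring_times[OF L] tensor.hyps)
    finally show ?case .
  qed (auto simp: compositum_0)
  have "x * y \<in> compositum S L" if "y \<in> compositum S L" "x \<in> compositum S L" for x y
    using that
    by (induction rule: compositum_induct)
      (auto simp: compositum_0 distrib_left intro!: compositum_add tens)
  moreover have "- x \<in> compositum S L" if "x \<in> compositum S L" for x
    using tens[OF that subring_uminus[OF S subring_one[OF S]] subring_one[OF L]] by simp
  ultimately show ?thesis
    unfolding subring_ambient_iff using compositum_left subring_one[OF S]
    by (auto intro: compositum_add)
qed

end

lemma fractionsI: "x \<in> R \<Longrightarrow> y \<in> T \<Longrightarrow> x / y \<in> fractions R T"
  unfolding fractions_def by blast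

section \<open>Discrete valuations\<close>

definition valuation_on :: "'a::field set \<Rightarrow> ('a \<Rightarrow> int) \<Rightarrow> bool" where
  "valuation_on F v \<longleftrightarrow> v ` (F - {0}) = UNIV \<and>
     (\<forall>x\<in>F - {0}. \<forall>y\<in>F - {0}. v (x * y) = v x + v y \<and>
        (x + y \<noteq> 0 \<longrightarrow> min (v x) (v y) \<le> v (x + y)))"

text \<open>The valuation axioms leave the value at \<open>0\<close> open, so \<open>0\<close>
  enters by a separate disjunct.\<close>

definition valuation_ring :: "'a::field set \<Rightarrow> ('a \<Rightarrow> int) \<Rightarrow> 'a set" where
  "valuation_ring F v = {x \<in> F. x = 0 \<or> 0 \<le> v x}"

lemma discrete_valuation_rings_iff:
  "P \<in> discrete_valuation_rings k F \<longleftrightarrow> k \<subseteq> P \<and> (\<exists>v. valuation_on F v \<and> P = valuation_ring F v)"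
  unfolding discrete_valuation_rings_def valuation_on_def valuation_ring_def by blast

locale discrete_valuation =
  fixes F :: "'a::field set" and v :: "'a \<Rightarrow> int"
  assumes subfield_F: "subfield F ambient" and val: "valuation_on F v"
begin

lemma subring_F: "subring F ambient"
  and inverse_F: "x \<in> F \<Longrightarrow> inverse x \<in> F"
  using subfield_F by (auto simp: subfield_ambient_iff)

lemmas F_closed = subring_closed[OF subring_F] inverse_F subfield_divide[OF subfield_F]

lemma v_mult: "x \<in> F \<Longrightarrow> y \<in> F \<Longrightarrow> x \<noteq> 0 \<Longrightarrow> y \<noteq> 0 \<Longrightarrow> v (x * y) = v x + v y"
  and v_add: "x \<in> F \<Longrightarrow> y \<in> F \<Longrightarrow> x \<noteq> 0 \<Longrightarrow> y \<noteq> 0 \<Longrightarrow> x + y \<noteq> 0 \<Longrightarrow> min (v x) (v y) \<le> v (x + y)"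
  using val by (auto simp: valuation_on_def)

lemma v_1 [simp]: "v 1 = 0"
  using v_mult[of 1 1] F_closed by simp

lemma v_uminus1: "v (- 1) = 0"
  using v_mult[of "-1" "-1"] F_closed by simp

lemma v_uminus: "x \<in> F \<Longrightarrow> v (- x) = v x"
  using v_mult[of "-1" x] F_closed v_uminus1 by (cases "x = 0") auto

lemma v_inverse: "x \<in> F \<Longrightarrow> x \<noteq> 0 \<Longrightarrow> v (inverse x) = - v x"
  using v_mult[of x "inverse x"] F_closed by simp

lemma v_divide: "x \<in> F \<Longrightarrow> y \<in> F \<Longrightarrow> x \<noteq> 0 \<Longrightarrow> y \<noteq> 0 \<Longrightarrow> v (x / y) = v x - v y"
  using v_mult[of x "inverse y"] F_closed v_inverse by (simp add: divide_inverse)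

lemma v_power: "x \<in> F \<Longrightarrow> x \<noteq> 0 \<Longrightarrow> v (x ^ n) = int n * v x"
  by (induction n) (auto simp: v_mult F_closed algebra_simps)

abbreviation "V \<equiv> valuation_ring F v"

lemma V_iff: "x \<in> V \<longleftrightarrow> x \<in> F \<and> (x = 0 \<or> 0 \<le> v x)"
  by (simp add: valuation_ring_def)

lemma subring_V: "subring V ambient"
  unfolding subring_ambient_iff
proof (intro conjI ballI)
  fix x y assume xy: "x \<in> V" "y \<in> V"
  show "x * y \<in> V" using xy v_mult[of x y] F_closed by (cases "x = 0 \<or> y = 0") (auto simp: V_iff)
  show "x + y \<in> V"
  proof (cases "x = 0 \<or> y = 0 \<or> x + y = 0")
    case False
    then show ?thesis using xy v_add[of x y] F_closed by (auto simp: V_iff)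
  qed (use xy F_closed in \<open>auto simp: V_iff\<close>)
qed (use F_closed in \<open>auto simp: V_iff v_uminus\<close>)

lemma max_ideal_V: "max_ideal V = {x \<in> F. x = 0 \<or> 0 < v x}"
  unfolding max_ideal_def by (auto simp: V_iff v_inverse F_closed)

lemma V_neq_F: "V \<noteq> F"
proof -
  obtain x where "x \<in> F - {0}" "v x = -1" using val unfolding valuation_on_def by (metis UNIV_I imageE)
  then have "x \<in> F" "x \<notin> V" by (auto simp: V_iff)
  then show ?thesis by blast
qed

lemma inverse_in_V: "x \<in> F \<Longrightarrow> x \<notin> V \<Longrightarrow> inverse x \<in> V"
  using F_closed v_inverse by (auto simp: V_iff)

text \<open>A strictly larger ring contains an element of negative value, and its powers absorb the
  poles of any given \<open>y\<close>. This later identifies the point of the curve below a point of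
  the base change.\<close>

lemma V_maximal:
  assumes "subring S ambient" "V \<subseteq> S" "S \<subseteq> F" "S \<noteq> V"
  shows "S = F"
proof -
  obtain x where x: "x \<in> S" "x \<notin> V" using assms by blast
  have xF: "x \<in> F" using x assms by blast
  have x0: "x \<noteq> 0" "v x < 0" using x xF by (auto simp: V_iff)
  have "y \<in> S" if y: "y \<in> F" "y \<noteq> 0" for y
  proof -
    \<comment> \<open>Since \<open>v x\<close> is at most -1, dividing by \<open>x ^ n\<close>
      raises the value of \<open>y\<close> by at least the absolute value of
      \<open>v y\<close>.\<close>
    define n where "n = nat \<bar>v y\<bar>"
    have "v (y / x ^ n) = v y - int n * v x"
      using y xF x0 by (simp add: v_divide v_power F_closed)
    moreover have "int n * v x \<le> int n * (-1)" using x0 by (intro mult_left_mono) auto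
    moreover have "int n = \<bar>v y\<bar>" by (simp add: n_def)
    ultimately have "0 \<le> v (y / x ^ n)" by linarith
    then have "y / x ^ n \<in> V" using y xF F_closed by (auto simp: V_iff)
    then have "(y / x ^ n) * x ^ n \<in> S"
      using assms x by (intro subring_times[OF assms(1)] subring_power[OF assms(1)]) auto
    then show ?thesis using x0 by simp
  qed
  then show ?thesis using assms subring_zero[OF assms(1)] by blast
qed

end

lemma Span_mono_field: "K \<subseteq> K' \<Longrightarrow> ambient.Span K us \<subseteq> ambient.Span K' us"
proof (induction us)
  case (Cons u us)
  then have "\<exists>k\<in>K'. \<exists>w\<in>ambient.Span K' us. x = k * u + w" if "x \<in> ambient.Span K (u # us)" for x
    using that by (auto simp: ambient.line_extension_mem_iff)
  then show ?case by (auto simp: ambient.line_extension_mem_iff)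
qed auto

section \<open>The curve, its Frobenius and its coordinate ring\<close>

locale curve =
  fixes D :: "'a::field curve_data"
  assumes setting: "curve_setting D"
begin

abbreviation "k \<equiv> Fq D"
abbreviation "F \<equiv> FunField D"
abbreviation "L \<equiv> Lfield D"
abbreviation "\<sigma> \<equiv> frob D"
abbreviation "A \<equiv> coord_ring D"
abbreviation "A\<^sub>L \<equiv> coord_ring_L D"
abbreviation "Y \<equiv> curve_L D"

lemma subfields: "subfield k ambient" "subfield F ambient" "subfield L ambient"
  and subrings: "subring k ambient" "subring F ambient" "subring L ambient"
  and k_subset: "k \<subseteq> F" "k \<subseteq> L"
  using setting by (auto simp: curve_setting_def subfield_ambient_iff)

lemmas F_closed = subring_closed[OF subrings(2)]
lemmas L_closed = subring_closed[OF subrings(3)]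

lemma inverse_closed: "x \<in> k \<Longrightarrow> inverse x \<in> k" "x \<in> F \<Longrightarrow> inverse x \<in> F" "x \<in> L \<Longrightarrow> inverse x \<in> L"
  using subfields by (auto simp: subfield_ambient_iff)

lemma Oinf_dvr: "Oinf D \<in> discrete_valuation_rings k F"
  using setting by (auto simp: curve_setting_def)

lemma residue_rational: "x \<in> Oinf D \<Longrightarrow> \<exists>a\<in>k. x - a \<in> max_ideal (Oinf D)"
  using setting by (auto simp: curve_setting_def)

lemma linearly_disjoint:
  "set us \<subseteq> F \<Longrightarrow> ring.independent ambient k us \<Longrightarrow> ring.independent ambient L us"
  using setting by (auto simp: curve_setting_def)

lemma fractions_compositum: "fractions (compositum F L) (compositum F L - {0}) = UNIV"
  using setting by (simp only: curve_setting_def)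

lemma \<sigma>_hom: "\<sigma> \<in> Ring.ring_hom ambient ambient"
  and \<sigma>_F: "x \<in> F \<Longrightarrow> \<sigma> x = x" and \<sigma>_L: "b \<in> L \<Longrightarrow> \<sigma> b = b ^ card k"
  using setting by (auto simp: curve_setting_def)

lemma \<sigma>_simps [simp]: "\<sigma> (x + y) = \<sigma> x + \<sigma> y" "\<sigma> (x * y) = \<sigma> x * \<sigma> y" "\<sigma> 1 = 1"
  using ring_hom_add[OF \<sigma>_hom, of x y] ring_hom_mult[OF \<sigma>_hom, of x y] ring_hom_one[OF \<sigma>_hom] by simp_all

lemma \<sigma>_0 [simp]: "\<sigma> 0 = 0"
  using \<sigma>_simps(1)[of 0 0] by (metis add_cancel_right_right)

lemma \<sigma>_eq_0_iff [simp]: "\<sigma> x = 0 \<longleftrightarrow> x = 0"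
  using \<sigma>_simps(2)[of x "inverse x"] by (cases "x = 0") auto

lemma \<sigma>_inverse: "\<sigma> (inverse x) = inverse (\<sigma> x)"
  by (cases "x = 0") (use \<sigma>_simps(2)[of x "inverse x"] in \<open>auto intro!: inverse_unique[symmetric]\<close>)

lemma \<sigma>_divide: "\<sigma> (x / y) = \<sigma> x / \<sigma> y"
  by (simp add: divide_inverse \<sigma>_inverse)

lemma \<sigma>_mem_L: "b \<in> L \<Longrightarrow> \<sigma> b \<in> L"
  by (simp add: \<sigma>_L L_closed)

text \<open>The left factor of each tensor is fixed and the right one is raised to a power inside
  \<open>L\<close>, so tensors go to tensors.\<close>

lemma \<sigma>_compositum:
  assumes "S \<subseteq> F" "x \<in> compositum S L"
  shows "\<sigma> x \<in> compositum S L"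
  using assms(2)
  by (induction rule: compositum_induct)
    (use assms(1) in \<open>auto simp: compositum_0 \<sigma>_F subset_iff intro!: compositum_add_tensor \<sigma>_mem_L\<close>)

lemma Oinf_subset_F: "Oinf D \<subseteq> F"
  using Oinf_dvr by (auto simp: discrete_valuation_rings_def)

lemma curve_points_cases:
  assumes "P \<in> curve_points k F"
  obtains "P = F" | v where "discrete_valuation F v" "P = valuation_ring F v" "k \<subseteq> P"
proof -
  from assms have "P = F \<or> k \<subseteq> P \<and> (\<exists>v. valuation_on F v \<and> P = valuation_ring F v)"
    unfolding curve_points_def insert_iff discrete_valuation_rings_iff .
  then show ?thesis using that discrete_valuation.intro[OF subfields(2)] by blast
qed

lemma curve_points_subring:
  assumes "P \<in> curve_points k F"
  shows "subring P ambient" and "P \<subseteq> F" and "k \<subseteq> P"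
proof -
  have "subring P ambient \<and> P \<subseteq> F \<and> k \<subseteq> P"
    using assms
  proof (cases rule: curve_points_cases)
    case 1
    then show ?thesis using subrings k_subset by simp
  next
    case (2 v)
    then show ?thesis using discrete_valuation.subring_V[OF 2(1)] by (auto simp: valuation_ring_def)
  qed
  then show "subring P ambient" "P \<subseteq> F" "k \<subseteq> P" by auto
qed

lemma F_curve_point: "F \<in> curve_points k F"
  by (simp add: curve_points_def)

lemma F_neq_Oinf: "F \<noteq> Oinf D"
proof -
  obtain w where "valuation_on F w" "Oinf D = valuation_ring F w"
    using Oinf_dvr discrete_valuation_rings_iff by blast
  then show ?thesis using discrete_valuation.V_neq_F[of F w] subfields by (auto simp: discrete_valuation.intro)
qed

lemma subring_A: "subring A ambient"
  unfolding coord_ring_def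
  by (rule ambient.subring_Inter) (use curve_points_subring F_curve_point F_neq_Oinf in auto)

lemma A_subset_F: "A \<subseteq> F"
  unfolding coord_ring_def using F_curve_point F_neq_Oinf by blast

lemma k_subset_A: "k \<subseteq> A"
  unfolding coord_ring_def using curve_points_subring(3) by blast

lemma subring_A\<^sub>L: "subring A\<^sub>L ambient"
  unfolding coord_ring_L_def by (rule compositum_subring[OF subring_A subrings(3)])

lemma L_subset_A\<^sub>L: "L \<subseteq> A\<^sub>L"
  unfolding coord_ring_L_def by (rule compositum_right[OF subring_A subrings(3)])

lemma \<sigma>_mem_A\<^sub>L: "x \<in> A\<^sub>L \<Longrightarrow> \<sigma> x \<in> A\<^sub>L"
  unfolding coord_ring_L_def by (rule \<sigma>_compositum[OF A_subset_F])

end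

section \<open>The local ring at infinity after base change\<close>

text \<open>The uniformizer is taken from \<open>F\<close>, where \<sigma> is the identity. This is
  what lets \<sigma> preserve orders at infinity, whereas the plain power map would multiply
  them.\<close>

locale curve_uniformizer = curve +
  fixes v :: "'a \<Rightarrow> int" and \<pi> :: 'a
  assumes v: "valuation_on F v" and Oinf: "Oinf D = valuation_ring F v"
    and \<pi>: "\<pi> \<in> F" "\<pi> \<noteq> 0" "v \<pi> = 1"
begin

sublocale dv: discrete_valuation F v
  using subfields v by (intro discrete_valuation.intro)

abbreviation "\<O> \<equiv> Oinf D"

lemmas subring_O = dv.subring_V[folded Oinf]
lemmas O_closed = subring_closed[OF subring_O]
lemmas O_iff = dv.V_iff[folded Oinf]

lemma k_subset_O: "k \<subseteq> \<O>"
  using Oinf_dvr by (auto simp: discrete_valuation_rings_iff)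

lemma \<pi>_mem_O: "\<pi> \<in> \<O>"
  using \<pi> by (simp add: O_iff)

lemma \<sigma>_\<pi> [simp]: "\<sigma> \<pi> = \<pi>"
  by (rule \<sigma>_F[OF \<pi>(1)])

lemma max_ideal_O: "max_ideal \<O> = (\<lambda>x. \<pi> * x) ` \<O>"
proof (intro equalityI subsetI)
  fix x assume "x \<in> max_ideal \<O>"
  then have x: "x \<in> F" "x = 0 \<or> 0 < v x" unfolding Oinf dv.max_ideal_V by auto
  have "x / \<pi> \<in> \<O>"
  proof (cases "x = 0")
    case False
    then have "0 \<le> v (x / \<pi>)" using x \<pi> dv.v_divide[of x \<pi>] by simp
    then show ?thesis using x \<pi> subfield_divide[OF subfields(2)] by (simp add: O_iff)
  qed (simp add: O_closed(1))
  then have "\<pi> * (x / \<pi>) \<in> (\<lambda>x. \<pi> * x) ` \<O>" by (rule imageI)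
  then show "x \<in> (\<lambda>x. \<pi> * x) ` \<O>" using \<pi> by simp
next
  fix x assume "x \<in> (\<lambda>x. \<pi> * x) ` \<O>"
  then obtain y where yx: "y \<in> \<O>" "x = \<pi> * y" by (rule imageE)
  then have y: "y \<in> F" "y = 0 \<or> 0 \<le> v y" "x = \<pi> * y" by (simp_all add: O_iff)
  have "x = 0 \<or> 0 < v x" using y \<pi> dv.v_mult[of \<pi> y] by (cases "y = 0") auto
  then show "x \<in> max_ideal \<O>"
    using y \<pi> dv.F_closed(4)[of \<pi> y] unfolding Oinf dv.max_ideal_V by simp
qed

text \<open>Rationality of the point at infinity enters here: every residue is represented by a
  constant of \<open>k\<close>.\<close>

lemma O_decompose:
  assumes "x \<in> \<O>"
  obtains a y where "a \<in> k" "y \<in> \<O>" "x = a + \<pi> * y"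
  using residue_rational[OF assms] unfolding max_ideal_O using that by (auto simp: algebra_simps)

text \<open>The base change of the local ring at infinity to \<open>L\<close>, before localization;
  \<open>infL D\<close> is its localization at the ideal generated by \<pi>.\<close>

definition R :: "'a set" where "R = compositum \<O> L"

lemma subring_R: "subring R ambient"
  unfolding R_def by (rule compositum_subring[OF subring_O subrings(3)])

lemmas R_closed = subring_closed[OF subring_R]

lemma O_subset_R: "\<O> \<subseteq> R" and L_subset_R: "L \<subseteq> R"
  unfolding R_def
  using compositum_left[OF subring_O subrings(3)] compositum_right[OF subring_O subrings(3)] by auto

lemma \<pi>_mem_R: "\<pi> \<in> R"
  using \<pi>_mem_O O_subset_R by blast

text \<open>Splitting the left factor of each tensor into a constant and a multiple of \<pi> shows
  that \<open>L\<close> exhausts the residues of \<open>R\<close> modulo \<pi>.\<close>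

lemma R_decompose:
  assumes "x \<in> R"
  obtains b y where "b \<in> L" "y \<in> R" "x = b + \<pi> * y"
proof -
  have "\<exists>b\<in>L. \<exists>y\<in>R. x = b + \<pi> * y"
    using assms unfolding R_def
  proof (induction rule: compositum_induct)
    case zero
    show ?case using L_closed compositum_0 by (intro bexI[of _ 0]) auto
  next
    case (tensor x s c)
    obtain b y where y: "b \<in> L" "y \<in> compositum \<O> L" "x = b + \<pi> * y" using tensor by blast
    obtain a z where az: "a \<in> k" "z \<in> \<O>" "s = a + \<pi> * z" using O_decompose[OF tensor(2)] .
    have "x + s * c = (b + a * c) + \<pi> * (y + z * c)" by (simp add: y az algebra_simps)
    moreover have "b + a * c \<in> L" using y az k_subset tensor by (auto intro!: L_closed)
    moreover have "y + z * c \<in> compositum \<O> L" by (intro compositum_add_tensor y(2) az(2) tensor)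
    ultimately show ?case by blast
  qed
  then show ?thesis using that by blast
qed

text \<open>This is where linear disjointness of \<open>F\<close> and \<open>L\<close> enters: an \<open>\<F>\<^sub>q\<close>-basis of
  the span of finitely many elements of \<open>\<pi> \<O>\<close> together with \<open>1\<close> is independent over \<open>L\<close>.\<close>

lemma one_notin_\<pi>_R: "1 \<notin> (\<lambda>x. \<pi> * x) ` R"
proof
  assume "1 \<in> (\<lambda>x. \<pi> * x) ` R"
  then obtain r where r: "r \<in> R" "1 = \<pi> * r" by blast
  have "\<exists>us. set us \<subseteq> (\<lambda>x. \<pi> * x) ` \<O> \<and> ring.independent ambient k us \<and> \<pi> * r \<in> ring.Span ambient L us"
    using r(1) unfolding R_def
  proof (induction rule: compositum_induct)
    case zero
    show ?case by (rule exI[of _ "[]"]) (auto intro: ambient.li_Nil)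
  next
    case (tensor x s b)
    obtain us where us: "set us \<subseteq> (\<lambda>x. \<pi> * x) ` \<O>" "ambient.independent k us"
      "\<pi> * x \<in> ambient.Span L us" using tensor by blast
    show ?case
    \<comment> \<open>If the new left factor depends on \<open>us\<close> over \<open>k\<close>,
      only the coefficients in \<open>L\<close> change; otherwise it is appended, and independence
      over \<open>k\<close> survives.\<close>
    proof (cases "\<pi> * s \<in> ambient.Span k us")
      case True
      have "ambient.Span k us \<subseteq> ambient.Span L us"
        by (rule Span_mono_field) (rule k_subset)
      then have "\<pi> * s \<in> ambient.Span L us" using True by blast
      then have "b * (\<pi> * s) \<in> ambient.Span L us"
        using ambient.Span_smult_closed[OF subfields(3), of us b "\<pi> * s"] tensor us \<pi>_mem_O by auto
      then have "\<pi> * x + b * (\<pi> * s) \<in> ambient.Span L us"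
        using ambient.Span_subgroup_props(3)[OF subfields(3), of us] us by simp
      then show ?thesis using us by (auto simp: algebra_simps)
    next
      case False
      have "ambient.independent k (\<pi> * s # us)"
        using ambient.li_Cons[OF _ False us(2)] by simp
      moreover have "b * (\<pi> * s) + \<pi> * x \<in> ambient.Span L (\<pi> * s # us)"
        using us tensor by (auto simp: ambient.line_extension_mem_iff)
      ultimately show ?thesis using us tensor
        by (intro exI[of _ "\<pi> * s # us"]) (auto simp: algebra_simps)
    qed
  qed
  then obtain us where us: "set us \<subseteq> (\<lambda>x. \<pi> * x) ` \<O>" "ambient.independent k us"
      "1 \<in> ambient.Span L us" using r by auto
  have "ambient.Span k us \<subseteq> (\<lambda>x. \<pi> * x) ` \<O>"
    using us(1)
  proof (induction us)
    case Nil
    have "\<pi> * 0 \<in> (\<lambda>x. \<pi> * x) ` \<O>" by (rule imageI) (rule O_closed)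
    then show ?case by auto
  next
    case (Cons u us)
    show ?case
    proof
      fix y assume "y \<in> ambient.Span k (u # us)"
      then obtain a w where aw: "a \<in> k" "w \<in> ambient.Span k us" "y = a * u + w"
        by (auto simp: ambient.line_extension_mem_iff)
      then obtain w' u' where "w' \<in> \<O>" "w = \<pi> * w'" "u' \<in> \<O>" "u = \<pi> * u'" using Cons by auto
      then show "y \<in> (\<lambda>x. \<pi> * x) ` \<O>"
        using aw k_subset_O by (intro image_eqI[of _ _ "a * u' + w'"]) (auto intro!: O_closed simp: algebra_simps)
    qed
  qed
  moreover have "1 \<notin> (\<lambda>x. \<pi> * x) ` \<O>"
    unfolding max_ideal_O[symmetric] by (simp add: max_ideal_def O_closed)
  ultimately have "1 \<notin> ambient.Span k us" by blast
  \<comment> \<open>The \<open>k\<close>-span of \<open>us\<close> stays in the maximal ideal of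
    \<open>\<O>\<close>, which omits 1, so 1 extends the independent list. Over \<open>L\<close>
    this contradicts the membership of 1 in the \<open>L\<close>-span.\<close>
  then have "ambient.independent k (1 # us)"
    using ambient.li_Cons[OF _ _ us(2)] by simp
  moreover have "set (1 # us) \<subseteq> F" using us(1) \<pi> Oinf_subset_F by (auto intro: F_closed)
  ultimately have "ambient.independent L (1 # us)" using linearly_disjoint by blast
  then show False using us(3) ambient.independent_backwards(1) by metis
qed

lemma L_notin_\<pi>_R:
  assumes "b \<in> L" "b \<noteq> 0"
  shows "b \<notin> (\<lambda>x. \<pi> * x) ` R"
proof
  assume "b \<in> (\<lambda>x. \<pi> * x) ` R"
  then obtain r where "r \<in> R" "b = \<pi> * r" by blast
  moreover from this have "1 = \<pi> * (r * inverse b)" using assms(2) by (metis mult.assoc right_inverse)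
  moreover have "inverse b \<in> R" using inverse_closed(3)[OF assms(1)] L_subset_R by blast
  ultimately have "1 = \<pi> * (r * inverse b)" "r * inverse b \<in> R" by (auto intro!: R_closed)
  then show False using one_notin_\<pi>_R by blast
qed

text \<open>The elements of nonzero residue, hence the denominators of \<open>infL D\<close> once
  the ideal of \<pi> is known to be their complement. In this form closure under products and under
  \<sigma> can be read off from the residues.\<close>

definition R\<^sub>1 :: "'a set" where "R\<^sub>1 = {b + \<pi> * r | b r. b \<in> L \<and> b \<noteq> 0 \<and> r \<in> R}"

lemma R\<^sub>1_eq: "R\<^sub>1 = R - (\<lambda>x. \<pi> * x) ` R"
proof (intro equalityI subsetI)
  fix x assume "x \<in> R\<^sub>1"
  then obtain b r where x: "b \<in> L" "b \<noteq> 0" "r \<in> R" "x = b + \<pi> * r" by (auto simp: R\<^sub>1_def)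
  have "x \<notin> (\<lambda>x. \<pi> * x) ` R"
  proof
    assume "x \<in> (\<lambda>x. \<pi> * x) ` R"
    then obtain s where "s \<in> R" "x = \<pi> * s" by blast
    then have "b = \<pi> * (s - r)" "s - r \<in> R" using x by (auto intro!: R_closed simp: algebra_simps)
    then show False using L_notin_\<pi>_R x by blast
  qed
  then show "x \<in> R - (\<lambda>x. \<pi> * x) ` R" using x L_subset_R \<pi>_mem_R by (auto intro!: R_closed)
next
  fix x assume x: "x \<in> R - (\<lambda>x. \<pi> * x) ` R"
  then obtain b y where "b \<in> L" "y \<in> R" "x = b + \<pi> * y" using R_decompose by blast
  moreover from this have "b \<noteq> 0" using x by auto
  ultimately show "x \<in> R\<^sub>1" unfolding R\<^sub>1_def by blast
qed

lemma R\<^sub>1_subset: "R\<^sub>1 \<subseteq> R" and zero_notin_R\<^sub>1: "0 \<notin> R\<^sub>1"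
  unfolding R\<^sub>1_eq using imageI[OF R_closed(1), of "\<lambda>x. \<pi> * x"] by auto

lemma one_mem_R\<^sub>1: "1 \<in> R\<^sub>1"
  unfolding R\<^sub>1_eq using one_notin_\<pi>_R R_closed(2) by blast

lemma R\<^sub>1_mult: "x \<in> R\<^sub>1 \<Longrightarrow> y \<in> R\<^sub>1 \<Longrightarrow> x * y \<in> R\<^sub>1"
proof -
  assume "x \<in> R\<^sub>1" "y \<in> R\<^sub>1"
  then obtain b r c s where x: "b \<in> L" "b \<noteq> 0" "r \<in> R" "x = b + \<pi> * r"
    and y: "c \<in> L" "c \<noteq> 0" "s \<in> R" "y = c + \<pi> * s" unfolding R\<^sub>1_def by blast
  then have "x * y = b * c + \<pi> * (b * s + c * r + \<pi> * r * s)" by (simp add: algebra_simps)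
  moreover have "b * s + c * r + \<pi> * r * s \<in> R"
    using x y L_subset_R \<pi>_mem_R by (intro R_closed) auto
  moreover have "b * c \<in> L" "b * c \<noteq> 0" using x y by (auto intro: L_closed(4))
  ultimately show ?thesis unfolding R\<^sub>1_def by blast
qed

lemma \<sigma>_mem_R: "x \<in> R \<Longrightarrow> \<sigma> x \<in> R"
  unfolding R_def using \<sigma>_compositum Oinf_subset_F by blast

lemma \<sigma>_mem_R\<^sub>1: "x \<in> R\<^sub>1 \<Longrightarrow> \<sigma> x \<in> R\<^sub>1"
proof -
  assume "x \<in> R\<^sub>1"
  then obtain b r where "b \<in> L" "b \<noteq> 0" "r \<in> R" "x = b + \<pi> * r" by (auto simp: R\<^sub>1_def)
  then have "\<sigma> x = \<sigma> b + \<pi> * \<sigma> r" "\<sigma> b \<in> L" "\<sigma> b \<noteq> 0" "\<sigma> r \<in> R" using \<sigma>_mem_L \<sigma>_mem_R by auto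
  then show ?thesis unfolding R\<^sub>1_def by blast
qed

text \<open>Induction on the number of tensors: subtracting multiples of a term of least valuation
  from the others either exhibits the \<open>\<pi>\<close>-order of the sum or removes that term.\<close>

lemma O_factor:
  assumes "x \<in> \<O>" "x \<noteq> 0"
  obtains t where "t \<in> \<O>" "v t = 0" "t \<noteq> 0" "x = \<pi> ^ nat (v x) * t"
proof
  define m where "m = nat (v x)"
  have x: "x \<in> F" "int m = v x" using assms by (auto simp: O_iff m_def)
  have pm: "\<pi> ^ m \<in> F" "\<pi> ^ m \<noteq> 0" "v (\<pi> ^ m) = int m"
    using \<pi> dv.v_power[of \<pi> m] F_closed(7)[of \<pi> m] by auto
  show "v (x / \<pi> ^ m) = 0" using dv.v_divide[OF x(1) pm(1) assms(2) pm(2)] pm(3) x(2) by simp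
  then show "x / \<pi> ^ m \<in> \<O>"
    using subfield_divide[OF subfields(2) x(1) pm(1)] by (simp add: O_iff)
  show "x / \<pi> ^ m \<noteq> 0" "x = \<pi> ^ nat (v x) * (x / \<pi> ^ m)"
    using assms(2) pm(2) by (simp_all add: m_def)
qed

lemma O_divide: "x \<in> \<O> \<Longrightarrow> y \<in> F \<Longrightarrow> y \<noteq> 0 \<Longrightarrow> x = 0 \<or> v y \<le> v x \<Longrightarrow> x / y \<in> \<O>"
  using subfield_divide[OF subfields(2), of x y] dv.v_divide[of x y] O_closed(1)
  by (cases "x = 0") (simp_all add: O_iff)

text \<open>Excludes nonzero elements divisible by every power of \<pi>, which is the step from a
  local ring with principal maximal ideal to a discrete valuation ring.\<close>

lemma R_factorize:
  assumes "x \<in> R" "x \<noteq> 0"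
  obtains m y where "y \<in> R\<^sub>1" "x = \<pi> ^ m * y"
proof -
  have main: "(\<Sum>i\<in>I. s i * b i) = 0 \<or> (\<exists>m. \<exists>y\<in>R\<^sub>1. (\<Sum>i\<in>I. s i * b i) = \<pi> ^ m * y)"
    if "finite I" "\<forall>i\<in>I. s i \<in> \<O> \<and> b i \<in> L" for I :: "nat set" and s b
    using that
  proof (induction "card I" arbitrary: I s b rule: less_induct)
    case less
    show ?case
    proof (cases "\<forall>i\<in>I. s i = 0")
      case False
      then obtain i0 where "i0 \<in> I \<and> s i0 \<noteq> 0" by blast
      \<comment> \<open>A term of least valuation serves as pivot: every quotient
        \<open>s i / s j\<close> is then integral and splits into a constant and a multiple of
        \<pi>.\<close>
      from ex_has_least_nat[of "\<lambda>i. i \<in> I \<and> s i \<noteq> 0" i0 "\<lambda>i. nat (v (s i))"] this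
      obtain j where jj: "j \<in> I" "s j \<noteq> 0" "\<And>i. i \<in> I \<Longrightarrow> s i \<noteq> 0 \<Longrightarrow> nat (v (s j)) \<le> nat (v (s i))"
        by blast
      have sO: "s i \<in> \<O>" if "i \<in> I" for i using less.prems(2) that by simp
      have v_le: "v (s j) \<le> v (s i)" if "i \<in> I" "s i \<noteq> 0" for i
        using jj(3)[OF that] sO[OF that(1)] sO[OF jj(1)] jj(2) that(2) by (simp add: O_iff nat_le_iff)
      note j = jj(1,2)
      have sF: "s i \<in> F" if "i \<in> I" for i using sO[OF that] by (simp add: O_iff)
      have "\<forall>i\<in>I. \<exists>p. fst p \<in> k \<and> snd p \<in> \<O> \<and> s i / s j = fst p + \<pi> * snd p"
      proof
        fix i assume i: "i \<in> I"
        have "s i / s j \<in> \<O>"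
          by (rule O_divide) (use sO[OF i] sF[OF j(1)] j(2) v_le[OF i] in blast)+
        then obtain a z where "a \<in> k" "z \<in> \<O>" "s i / s j = a + \<pi> * z" by (rule O_decompose)
        then show "\<exists>p. fst p \<in> k \<and> snd p \<in> \<O> \<and> s i / s j = fst p + \<pi> * snd p"
          by (intro exI[of _ "(a, z)"]) simp
      qed
      from bchoice[OF this] obtain p
        where p: "\<forall>i\<in>I. fst (p i) \<in> k \<and> snd (p i) \<in> \<O> \<and> s i / s j = fst (p i) + \<pi> * snd (p i)"
        by blast
      define a z where "a i = fst (p i)" and "z i = snd (p i)" for i
      have az: "a i \<in> k \<and> z i \<in> \<O> \<and> s i / s j = a i + \<pi> * z i" if "i \<in> I" for i
        using p that by (simp add: a_def z_def)
      define m where "m = nat (v (s j))"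
      obtain t where t: "t \<in> \<O>" "v t = 0" "t \<noteq> 0" "s j = \<pi> ^ m * t"
        using O_factor[OF sO[OF j(1)] j(2)] unfolding m_def by blast
      note tO = t(1)
      \<comment> \<open>Up to the factor \<open>\<pi> ^ m * t\<close>, with \<open>t\<close> a unit,
        \<open>c\<close> is the residue of the sum: the order is exactly \<open>m\<close> unless
        \<open>c\<close> vanishes.\<close>
      define c where "c = (\<Sum>i\<in>I. a i * b i)"
      have cL: "c \<in> L" unfolding c_def
        using az less.prems(2) k_subset by (intro L_closed(8) L_closed(4)) auto
      have "(\<Sum>i\<in>I. s i * b i) = (\<Sum>i\<in>I. s j * (a i + \<pi> * z i) * b i)"
      proof (rule sum.cong)
        fix i assume "i \<in> I"
        then have "s i / s j = a i + \<pi> * z i" using az by blast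
        then have "s i = s j * (a i + \<pi> * z i)" using j by (simp add: field_simps)
        then show "s i * b i = s j * (a i + \<pi> * z i) * b i" by simp
      qed simp
      also have "\<dots> = \<pi> ^ m * (t * c + \<pi> * (\<Sum>i\<in>I. t * z i * b i))"
        by (simp add: t(4) c_def algebra_simps sum.distrib sum_distrib_left)
      finally have eq: "(\<Sum>i\<in>I. s i * b i) = \<pi> ^ m * (t * c + \<pi> * (\<Sum>i\<in>I. t * z i * b i))" .
      have sumR: "(\<Sum>i\<in>I. t * z i * b i) \<in> R"
        using tO az less.prems(2) O_subset_R L_subset_R by (intro R_closed(8) R_closed(4)) auto
      show ?thesis
      proof (cases "c = 0")
        case False
        obtain a0 w where a0: "a0 \<in> k" "w \<in> \<O>" "t = a0 + \<pi> * w" using O_decompose[OF tO] .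
        have "a0 \<noteq> 0"
        proof
          assume "a0 = 0"
          then have "t \<in> max_ideal \<O>" using a0 by (auto simp: max_ideal_O)
          then show False using t unfolding Oinf dv.max_ideal_V by auto
        qed
        have "t * c + \<pi> * (\<Sum>i\<in>I. t * z i * b i) = a0 * c + \<pi> * (w * c + (\<Sum>i\<in>I. t * z i * b i))"
          by (simp add: a0 algebra_simps)
        moreover have "w * c + (\<Sum>i\<in>I. t * z i * b i) \<in> R"
          using a0 cL O_subset_R L_subset_R sumR by (intro R_closed(4,5)) auto
        moreover have "a0 * c \<in> L" using a0 cL k_subset by (intro L_closed(4)) auto
        moreover have "a0 * c \<noteq> 0" using \<open>a0 \<noteq> 0\<close> False by simp
        ultimately have "t * c + \<pi> * (\<Sum>i\<in>I. t * z i * b i) \<in> R\<^sub>1"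
          unfolding R\<^sub>1_def by blast
        then show ?thesis using eq by blast
      next
        case True
        \<comment> \<open>The pivot drops out: \<open>1 = a j + \<pi> * z j\<close> puts
          \<open>\<pi> * z j\<close> into both \<open>L\<close> and the ideal of \<pi>, which meet
          only in 0.\<close>
        have "z j = 0"
        proof (rule ccontr)
          assume "z j \<noteq> 0"
          have aj: "a j \<in> k" "z j \<in> \<O>" "1 = a j + \<pi> * z j" using az[OF j(1)] j by auto
          have "L \<inter> (\<lambda>x. \<pi> * x) ` R = {0}"
            using L_notin_\<pi>_R L_closed(1) imageI[OF R_closed(1), of "\<lambda>x. \<pi> * x"] by auto
          moreover have "\<pi> * z j = 1 - a j" using aj by (simp add: algebra_simps)
          then have "\<pi> * z j \<in> L" using aj k_subset by (auto intro!: L_closed)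
          ultimately have "\<pi> * z j = 0" using aj O_subset_R by blast
          then show False using \<open>z j \<noteq> 0\<close> \<pi> by simp
        qed
        then have "(\<Sum>i\<in>I. t * z i * b i) = (\<Sum>i\<in>I - {j}. t * z i * b i)"
          using j(1) less.prems by (simp add: sum.remove)
        moreover have "card (I - {j}) < card I" using j less.prems by (intro psubset_card_mono) auto
        then have "(\<Sum>i\<in>I - {j}. t * z i * b i) = 0 \<or>
            (\<exists>m. \<exists>y\<in>R\<^sub>1. (\<Sum>i\<in>I - {j}. t * z i * b i) = \<pi> ^ m * y)"
          using less.prems az O_closed(4)[OF tO] by (intro less.hyps) auto
        moreover have "(\<Sum>i\<in>I. s i * b i) = \<pi> ^ Suc m * (\<Sum>i\<in>I. t * z i * b i)"
          using eq True by (simp add: algebra_simps)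
        moreover have "\<pi> ^ Suc m * (\<pi> ^ n * y) = \<pi> ^ (Suc m + n) * y" for n y
          by (simp only: power_add mult.assoc)
        ultimately show ?thesis by (elim disjE exE bexE) (metis mult_zero_right, metis)
      qed
    qed auto
  qed
  obtain n :: nat and s b where "x = (\<Sum>i<n. s i * b i)" "\<forall>i<n. s i \<in> \<O> \<and> b i \<in> L"
    using assms(1) unfolding R_def compositum_def by auto
  then show ?thesis using main[of "{..<n}" s b] assms(2) that by auto
qed

end

section \<open>Frobenius-semilinear matrices over a valuation ring\<close>

text \<open>An abstract copy of \<open>infL D\<close> with its Frobenius. No valuation function is
  carried along: \<open>factor\<close> provides a power of \<pi> times a unit, and order at least
  \<open>m\<close> means that \<open>\<pi> powi (- m) * x\<close> lies in \<open>V\<close>.\<close>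

locale dvr_frobenius =
  fixes V :: "'a::field set" and \<pi> :: 'a and \<sigma> :: "'a \<Rightarrow> 'a"
  assumes V: "subring V ambient" and \<pi>: "\<pi> \<in> V" "\<pi> \<noteq> 0" "inverse \<pi> \<notin> V"
    and factor: "x \<noteq> 0 \<Longrightarrow> \<exists>n u. x = \<pi> powi n * u \<and> u \<noteq> 0 \<and> u \<in> V \<and> inverse u \<in> V"
    and \<sigma>: "\<sigma> (x + y) = \<sigma> x + \<sigma> y" "\<sigma> (x * y) = \<sigma> x * \<sigma> y" "\<sigma> 1 = 1"
    and \<sigma>_V: "x \<in> V \<Longrightarrow> \<sigma> x \<in> V" and \<sigma>_\<pi>: "\<sigma> \<pi> = \<pi>"
begin

lemma \<sigma>_0: "\<sigma> 0 = 0"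
  using \<sigma>(1)[of 0 0] by (metis add_cancel_right_right)

lemma field_hom_funpow: "field_hom (\<sigma> ^^ n)"
proof -
  have "(\<sigma> ^^ n) (x + y) = (\<sigma> ^^ n) x + (\<sigma> ^^ n) y \<and> (\<sigma> ^^ n) (x * y) = (\<sigma> ^^ n) x * (\<sigma> ^^ n) y
    \<and> (\<sigma> ^^ n) 1 = 1 \<and> (\<sigma> ^^ n) 0 = 0" for x y
    by (induction n) (simp_all add: \<sigma> \<sigma>_0)
  then show ?thesis by unfold_locales auto
qed

lemma funpow_V: "x \<in> V \<Longrightarrow> (\<sigma> ^^ n) x \<in> V"
  by (induction n) (auto intro: \<sigma>_V)

lemma funpow_\<pi>: "(\<sigma> ^^ n) (\<pi> powi e) = \<pi> powi e"
proof -
  interpret field_hom "\<sigma> ^^ n" by (rule field_hom_funpow)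
  have p: "(\<sigma> ^^ n) \<pi> = \<pi>" by (induction n) (simp_all add: \<sigma>_\<pi>)
  have "(\<sigma> ^^ n) (\<pi> ^ m) = \<pi> ^ m" for m by (simp add: hom_power p)
  then show ?thesis by (cases e rule: int_cases2) (simp_all add: power_int_minus hom_inverse)
qed

lemma \<pi>_powi_mult: "\<pi> powi m * (\<pi> powi n * x) = \<pi> powi (m + n) * x"
  using \<pi>(2) by (simp add: power_int_add mult.assoc)

lemma \<pi>_powi_V: "\<pi> powi n \<in> V \<longleftrightarrow> 0 \<le> n"
proof
  assume "0 \<le> n"
  then show "\<pi> powi n \<in> V" by (auto simp: power_int_def intro: subring_power[OF V] \<pi>)
next
  assume n: "\<pi> powi n \<in> V"
  show "0 \<le> n"
  proof (rule ccontr)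
    assume "\<not> 0 \<le> n"
    then have "inverse \<pi> = \<pi> ^ nat (- n - 1) * \<pi> powi n"
      using \<pi>(2) by (simp add: power_int_def field_simps flip: power_Suc) (simp add: nat_diff_distrib' Suc_nat_eq_nat_zadd1)
    also have "\<dots> \<in> V" by (intro subring_times[OF V] subring_power[OF V] n \<pi>)
    finally show False using \<pi> by blast
  qed
qed

lemma mem_V_iff: "u \<noteq> 0 \<Longrightarrow> u \<in> V \<Longrightarrow> inverse u \<in> V \<Longrightarrow> \<pi> powi n * u \<in> V \<longleftrightarrow> 0 \<le> n"
  using subring_times[OF V, of "\<pi> powi n * u" "inverse u"] subring_times[OF V, of "\<pi> powi n" u]
  by (auto simp: \<pi>_powi_V mult.assoc)

text \<open>A ring homomorphism that preserves \<open>V\<close> sends units of \<open>V\<close> to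
  units. As it also fixes \<pi>, it leaves orders unchanged, so integrality is reflected as well as
  preserved.\<close>

lemma funpow_V_iff: "(\<sigma> ^^ n) x \<in> V \<longleftrightarrow> x \<in> V"
proof (cases "x = 0")
  case False
  interpret field_hom "\<sigma> ^^ n" by (rule field_hom_funpow)
  obtain m u where u: "x = \<pi> powi m * u" "u \<noteq> 0" "u \<in> V" "inverse u \<in> V" using factor[OF False] by blast
  have "(\<sigma> ^^ n) x = \<pi> powi m * (\<sigma> ^^ n) u" by (simp add: u hom_mult funpow_\<pi>)
  moreover have "(\<sigma> ^^ n) u \<noteq> 0" using u(2) by simp
  moreover have "inverse ((\<sigma> ^^ n) u) \<in> V" using funpow_V[OF u(4), of n] by (simp add: hom_inverse)
  ultimately show ?thesis using u mem_V_iff[of u m] mem_V_iff[of "(\<sigma> ^^ n) u" m] funpow_V[OF u(3)] by simp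
next
  case True
  interpret field_hom "\<sigma> ^^ n" by (rule field_hom_funpow)
  show ?thesis using True by simp
qed

text \<open>A predicate instead of a minimum of orders: the zero matrix satisfies every bound, so no
  infinite order has to be introduced.\<close>

definition ord_ge :: "int \<Rightarrow> 'a mat \<Rightarrow> bool" where
  "ord_ge m B \<longleftrightarrow> (\<forall>i<dim_row B. \<forall>j<dim_col B. \<pi> powi (- m) * B $$ (i, j) \<in> V)"

lemma ord_ge_mult:
  assumes "ord_ge m B" "ord_ge n C" "dim_col B = dim_row C"
  shows "ord_ge (m + n) (B * C)"
  unfolding ord_ge_def
proof (intro allI impI)
  fix i j assume "i < dim_row (B * C)" "j < dim_col (B * C)"
  then have ij: "i < dim_row B" "j < dim_col C" by auto
  have "\<pi> powi (- (m + n)) * (B * C) $$ (i, j)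
    = (\<Sum>t<dim_row C. (\<pi> powi (- m) * B $$ (i, t)) * (\<pi> powi (- n) * C $$ (t, j)))"
    using ij assms(3) \<pi>(2) power_int_add[of \<pi> "- m" "- n"]
    by (simp add: scalar_prod_def sum_distrib_left atLeast0LessThan algebra_simps)
  also have "\<dots> \<in> V"
    using assms ij unfolding ord_ge_def by (intro subring_sum[OF V], intro subring_times[OF V, of "\<pi> powi _ * _" "\<pi> powi _ * _"]) auto
  finally show "\<pi> powi (- (m + n)) * (B * C) $$ (i, j) \<in> V" .
qed

lemma ord_ge_smult: "ord_ge m (\<pi> powi e \<cdot>\<^sub>m B) \<longleftrightarrow> ord_ge (m - e) B"
  by (simp add: ord_ge_def \<pi>_powi_mult)

lemma ord_ge_map: "ord_ge m (map_mat (\<sigma> ^^ n) B) \<longleftrightarrow> ord_ge m B"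
proof -
  interpret field_hom "\<sigma> ^^ n" by (rule field_hom_funpow)
  have "\<pi> powi (- m) * (\<sigma> ^^ n) x \<in> V \<longleftrightarrow> \<pi> powi (- m) * x \<in> V" for x
    using funpow_V_iff[of n "\<pi> powi (- m) * x"] by (simp add: hom_mult funpow_\<pi>)
  then show ?thesis by (simp add: ord_ge_def)
qed

lemma ex_ord_ge: "\<exists>m. ord_ge m B"
proof -
  have ex: "\<exists>m. \<pi> powi m * x \<in> V" for x
  proof (cases "x = 0")
    case False
    then obtain n u where "x = \<pi> powi n * u" "u \<in> V" using factor by blast
    moreover have "\<pi> powi (- n) * (\<pi> powi n * u) = u" by (simp add: \<pi>_powi_mult)
    ultimately show ?thesis by metis
  qed (use subring_zero[OF V] in auto)
  define f where "f x = (SOME m. \<pi> powi m * x \<in> V)" for x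
  have f: "\<pi> powi f x * x \<in> V" for x unfolding f_def by (rule someI_ex) (rule ex)
  \<comment> \<open>The sum of all absolute exponents dominates each single one.\<close>
  define N where "N = (\<Sum>i<dim_row B. \<Sum>j<dim_col B. \<bar>f (B $$ (i, j))\<bar>)"
  have "ord_ge (- N) B" unfolding ord_ge_def
  proof (intro allI impI)
    fix i j assume ij: "i < dim_row B" "j < dim_col B"
    have le1: "\<bar>f (B $$ (i, j))\<bar> \<le> (\<Sum>j<dim_col B. \<bar>f (B $$ (i, j))\<bar>)"
      using ij by (intro member_le_sum[of j "{..<dim_col B}" "\<lambda>j. \<bar>f (B $$ (i, j))\<bar>"]) auto
    have le2: "(\<Sum>j<dim_col B. \<bar>f (B $$ (i, j))\<bar>) \<le> N" unfolding N_def
      using ij by (intro member_le_sum[of i "{..<dim_row B}" "\<lambda>i. \<Sum>j<dim_col B. \<bar>f (B $$ (i, j))\<bar>"]) (auto intro: sum_nonneg)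
    from le1 le2 have "0 \<le> N - f (B $$ (i, j))" by linarith
    then have "\<pi> powi (N - f (B $$ (i, j))) * (\<pi> powi f (B $$ (i, j)) * B $$ (i, j)) \<in> V"
      by (intro subring_times[OF V _ f]) (simp add: \<pi>_powi_V)
    then show "\<pi> powi (- (- N)) * B $$ (i, j) \<in> V" by (simp add: \<pi>_powi_mult)
  qed
  then show ?thesis by blast
qed

text \<open>Any nonzero entry caps the bounds \<open>m\<close> by its own order, whereas the shift
  can be repeated indefinitely from any initial bound.\<close>

lemma ord_ge_shift_imp_zero:
  assumes B: "B \<in> carrier_mat r s" and shift: "\<And>m. ord_ge m B \<Longrightarrow> ord_ge (m + e) B" and "0 < e"
  shows "B = 0\<^sub>m r s"
proof (rule ccontr)
  assume "B \<noteq> 0\<^sub>m r s"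
  then obtain i j where ij: "i < r" "j < s" "B $$ (i, j) \<noteq> 0"
    using B by (auto simp: mat_eq_iff)
  obtain n u where u: "B $$ (i, j) = \<pi> powi n * u" "u \<noteq> 0" "u \<in> V" "inverse u \<in> V" using factor[OF ij(3)] by blast
  have bound: "m \<le> n" if "ord_ge m B" for m
  proof -
    have "\<pi> powi (- m) * B $$ (i, j) \<in> V" using that ij(1,2) B unfolding ord_ge_def by auto
    then have "\<pi> powi (n - m) * u \<in> V" unfolding u(1) by (simp add: \<pi>_powi_mult)
    then show ?thesis using mem_V_iff[OF u(2,3,4)] by simp
  qed
  obtain m where m: "ord_ge m B" using ex_ord_ge by blast
  have it: "ord_ge (m + int t * e) B" for t
  proof (induction t)
    case (Suc t)
    have eq: "m + int (Suc t) * e = m + int t * e + e" by (simp add: algebra_simps)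
    show ?case unfolding eq by (rule shift[OF Suc])
  qed (simp add: m)
  \<comment> \<open>After \<open>n - m + 1\<close> shifts by at least 1 the bound exceeds the order
    \<open>n\<close> of the chosen entry.\<close>
  have "int (nat (n - m + 1)) * 1 \<le> int (nat (n - m + 1)) * e" using \<open>0 < e\<close> by (intro mult_left_mono) auto
  then show False using bound[OF it[of "nat (n - m + 1)"]] by linarith
qed

lemma frob_power_carrier: "\<Phi> \<in> carrier_mat r r \<Longrightarrow> frob_power r \<sigma> \<Phi> l \<in> carrier_mat r r"
  by (induction l) auto

lemma map_funpow_mult:
  "A \<in> carrier_mat r s \<Longrightarrow> B \<in> carrier_mat s t \<Longrightarrow>
    map_mat (\<sigma> ^^ n) (A * B) = map_mat (\<sigma> ^^ n) A * map_mat (\<sigma> ^^ n) B"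
  by (rule semiring_hom.mat_hom_mult) (use field_hom_funpow[of n] in \<open>simp_all add: field_hom_def idom_hom_def comm_ring_hom_def ring_hom_def\<close>)

lemma map_funpow_one: "map_mat (\<sigma> ^^ n) (1\<^sub>m r) = 1\<^sub>m r"
  by (rule semiring_hom.mat_hom_one) (use field_hom_funpow[of n] in \<open>simp_all add: field_hom_def idom_hom_def comm_ring_hom_def ring_hom_def\<close>)

lemma map_funpow_map: "map_mat (\<sigma> ^^ m) (map_mat (\<sigma> ^^ n) A) = map_mat (\<sigma> ^^ (m + n)) A"
  by (rule eq_matI) (auto simp: funpow_add)

lemma map_funpow_smult: "map_mat (\<sigma> ^^ n) (\<pi> powi e \<cdot>\<^sub>m A) = \<pi> powi e \<cdot>\<^sub>m map_mat (\<sigma> ^^ n) A"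
proof -
  interpret field_hom "\<sigma> ^^ n" by (rule field_hom_funpow)
  show ?thesis by (rule eq_matI) (auto simp: hom_mult funpow_\<pi>)
qed

text \<open>The cocycle rule: \<tau> iterated \<open>m + n\<close> times is the
  \<open>m\<close>-fold iterate composed with the \<open>m\<close>-fold Frobenius pullback of the
  \<open>n\<close>-fold one.\<close>

lemma frob_power_add:
  assumes \<Phi>: "\<Phi> \<in> carrier_mat r r"
  shows "frob_power r \<sigma> \<Phi> (m + n) = frob_power r \<sigma> \<Phi> m * map_mat (\<sigma> ^^ m) (frob_power r \<sigma> \<Phi> n)"
proof (induction n)
  case 0
  show ?case using frob_power_carrier[OF \<Phi>, of m] by (simp add: map_funpow_one)
next
  case (Suc n)
  note c = frob_power_carrier[OF \<Phi>]
  show ?case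
    using Suc \<Phi> c[of m] c[of n]
    by (simp add: map_funpow_mult[of _ r r _ r] map_funpow_map assoc_mult_mat[of _ r r _ r _ r])
qed

text \<open>Kept rectangular because it serves twice: \<open>B\<close> is once the matrix of a
  morphism, once the matrix of generators of a \<tau>-stable subspace.\<close>

lemma frob_power_intertwine:
  assumes "\<Phi> \<in> carrier_mat r r" "\<Phi>' \<in> carrier_mat s s" "B \<in> carrier_mat r s"
    and "\<Phi> * map_mat \<sigma> B = B * \<Phi>'"
  shows "frob_power r \<sigma> \<Phi> l * map_mat (\<sigma> ^^ l) B = B * frob_power s \<sigma> \<Phi>' l"
proof (induction l)
  case 0
  have "map_mat (\<lambda>a. a) B = B" by (rule eq_matI) auto
  then show ?case using assms by simp
next
  case (Suc l)
  have map_Suc: "map_mat (\<sigma> ^^ Suc l) B = map_mat (\<sigma> ^^ l) (map_mat \<sigma> B)"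
    by (rule eq_matI) (simp_all add: funpow_swap1)
  note c = frob_power_carrier[OF assms(1), of l] frob_power_carrier[OF assms(2), of l]
  have "frob_power r \<sigma> \<Phi> (Suc l) * map_mat (\<sigma> ^^ Suc l) B
      = frob_power r \<sigma> \<Phi> l * map_mat (\<sigma> ^^ l) (\<Phi> * map_mat \<sigma> B)"
    unfolding map_Suc using assms(1-3) c
    by (simp add: map_funpow_mult[of _ r r _ s] assoc_mult_mat[of _ r r _ r _ s])
  also have "\<dots> = (frob_power r \<sigma> \<Phi> l * map_mat (\<sigma> ^^ l) B) * map_mat (\<sigma> ^^ l) \<Phi>'"
    unfolding assms(4) using assms c
    by (simp add: map_funpow_mult[of _ r s _ s] assoc_mult_mat[of _ r r _ s _ s])
  also have "\<dots> = B * frob_power s \<sigma> \<Phi>' (Suc l)"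
    unfolding Suc using assms c by (simp add: assoc_mult_mat[of _ r s _ s _ s])
  finally show ?case .
qed

text \<open>The lattice is spanned over \<open>V\<close> by the columns of \<open>g\<close>. The
  matrix \<open>U\<close> belongs to the general linear group over \<open>V\<close>; both inverses
  \<open>h\<close> and \<open>C\<close> are named so that they can be multiplied directly.\<close>

definition pure_lattice :: "nat \<Rightarrow> 'a mat \<Rightarrow> nat \<Rightarrow> nat \<Rightarrow> 'a mat \<Rightarrow> 'a mat \<Rightarrow> bool" where
  "pure_lattice r \<Phi> k l g h \<longleftrightarrow> \<Phi> \<in> carrier_mat r r \<and> g \<in> carrier_mat r r \<and> h \<in> carrier_mat r r \<and>
     h * g = 1\<^sub>m r \<and> g * h = 1\<^sub>m r \<and>
     (\<exists>U C. U \<in> carrier_mat r r \<and> C \<in> carrier_mat r r \<and> ord_ge 0 U \<and> ord_ge 0 C \<and>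
        U * C = 1\<^sub>m r \<and> C * U = 1\<^sub>m r \<and>
        frob_power r \<sigma> \<Phi> l * map_mat (\<sigma> ^^ l) g = \<pi> powi (- int k) \<cdot>\<^sub>m (g * U))"

text \<open>Each further iteration multiplies the unit factor by a Frobenius twist of
  \<open>U\<close>, which stays invertible over \<open>V\<close> because \<sigma> preserves
  integrality. It makes the Frobenius powers of two motives comparable.\<close>

lemma pure_lattice_multiple:
  assumes "pure_lattice r \<Phi> k l g h"
  shows "pure_lattice r \<Phi> (n * k) (n * l) g h"
proof -
  from assms obtain U C where c: "\<Phi> \<in> carrier_mat r r" "g \<in> carrier_mat r r" "h \<in> carrier_mat r r"
    "U \<in> carrier_mat r r" "C \<in> carrier_mat r r"
    and U: "h * g = 1\<^sub>m r" "g * h = 1\<^sub>m r" "ord_ge 0 U" "ord_ge 0 C" "U * C = 1\<^sub>m r" "C * U = 1\<^sub>m r"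
    and eq: "frob_power r \<sigma> \<Phi> l * map_mat (\<sigma> ^^ l) g = \<pi> powi (- int k) \<cdot>\<^sub>m (g * U)"
    unfolding pure_lattice_def by blast
  have ord_1: "ord_ge 0 (1\<^sub>m r)" using subring_zero[OF V] subring_one[OF V] by (auto simp: ord_ge_def)
  show ?thesis
  proof (induction n)
    case 0
    show ?case unfolding pure_lattice_def using c U(1,2) ord_1
      by (intro conjI exI[of _ "1\<^sub>m r"]) (auto intro!: eq_matI)
  next
    case (Suc n)
    then obtain U' C' where c': "U' \<in> carrier_mat r r" "C' \<in> carrier_mat r r"
      and U': "ord_ge 0 U'" "ord_ge 0 C'" "U' * C' = 1\<^sub>m r" "C' * U' = 1\<^sub>m r"
      and eq': "frob_power r \<sigma> \<Phi> (n * l) * map_mat (\<sigma> ^^ (n * l)) g = \<pi> powi (- int (n * k)) \<cdot>\<^sub>m (g * U')"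
      unfolding pure_lattice_def by blast
    define s where "s = map_mat (\<sigma> ^^ (n * l))"
    have s: "s A * s B = s (A * B)" if "A \<in> carrier_mat r r" "B \<in> carrier_mat r r" for A B
      using map_funpow_mult[OF that] by (simp add: s_def)
    have sc: "s A \<in> carrier_mat r r" if "A \<in> carrier_mat r r" for A using that by (simp add: s_def)
    note f = frob_power_carrier[OF c(1)]
    have sU: "s U \<in> carrier_mat r r" "s C \<in> carrier_mat r r" "s g \<in> carrier_mat r r" using sc c by auto
    have Suc_eq: "frob_power r \<sigma> \<Phi> (Suc n * l) = frob_power r \<sigma> \<Phi> (n * l) * s (frob_power r \<sigma> \<Phi> l)"
      "map_mat (\<sigma> ^^ (Suc n * l)) g = s (map_mat (\<sigma> ^^ l) g)"
      using frob_power_add[OF c(1), of "n * l" l] map_funpow_map[of "n * l" l g] by (simp_all add: s_def add.commute)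
    have "frob_power r \<sigma> \<Phi> (Suc n * l) * map_mat (\<sigma> ^^ (Suc n * l)) g
        = frob_power r \<sigma> \<Phi> (n * l) * (s (frob_power r \<sigma> \<Phi> l) * s (map_mat (\<sigma> ^^ l) g))"
      unfolding Suc_eq using c f sc[OF f[of l]] sc[of "map_mat (\<sigma> ^^ l) g"]
      by (intro assoc_mult_mat[of _ r r _ r _ r]) auto
    also have "s (frob_power r \<sigma> \<Phi> l) * s (map_mat (\<sigma> ^^ l) g) = s (frob_power r \<sigma> \<Phi> l * map_mat (\<sigma> ^^ l) g)"
      using c f by (intro s) auto
    also have "frob_power r \<sigma> \<Phi> (n * l) * \<dots> = \<pi> powi (- int k) \<cdot>\<^sub>m (frob_power r \<sigma> \<Phi> (n * l) * (s g * s U))"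
      unfolding eq using c f[of "n * l"] by (simp add: s_def map_funpow_smult s[unfolded s_def] mult_smult_distrib[of _ r r _ r])
    also have "frob_power r \<sigma> \<Phi> (n * l) * (s g * s U) = (frob_power r \<sigma> \<Phi> (n * l) * s g) * s U"
      using f[of "n * l"] sU by (simp add: assoc_mult_mat[of _ r r _ r _ r])
    also have "\<dots> = \<pi> powi (- int (n * k)) \<cdot>\<^sub>m (g * (U' * s U))"
      unfolding s_def eq' using c c' by (simp add: mult_smult_assoc_mat[of _ r r _ r] assoc_mult_mat[of _ r r _ r _ r])
    also have "\<pi> powi (- int k) \<cdot>\<^sub>m (\<pi> powi (- int (n * k)) \<cdot>\<^sub>m (g * (U' * s U)))
        = \<pi> powi (- int (Suc n * k)) \<cdot>\<^sub>m (g * (U' * s U))"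
      using \<pi>(2) power_int_add[of \<pi> "- int k" "- int (n * k)"] by (auto intro!: eq_matI)
    finally have "frob_power r \<sigma> \<Phi> (Suc n * l) * map_mat (\<sigma> ^^ (Suc n * l)) g
      = \<pi> powi (- int (Suc n * k)) \<cdot>\<^sub>m (g * (U' * s U))" .
    moreover have "ord_ge 0 (U' * s U)" "ord_ge 0 (s C * C')"
      using ord_ge_mult[of 0 U' 0 "s U"] ord_ge_mult[of 0 "s C" 0 C'] c c' U U' by (simp_all add: s_def ord_ge_map)
    moreover have "(U' * s U) * (s C * C') = U' * (s U * s C) * C'" "(s C * C') * (U' * s U) = s C * (C' * U') * s U"
      using c' sU by (simp_all add: assoc_mult_mat[of _ r r _ r _ r])
    moreover have "s U * s C = 1\<^sub>m r" "s C * s U = 1\<^sub>m r"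
      using s[of U C] s[of C U] U(5,6) c by (simp_all add: s_def map_funpow_one)
    ultimately show ?case unfolding pure_lattice_def using c c' U U'(3,4) sU
      by (intro conjI exI[of _ "U' * s U"] exI[of _ "s C * C'"]) simp_all
  qed
qed

lemma pure_lattice_hom_zero:
  assumes p: "pure_lattice r \<Phi> k l g h" and p': "pure_lattice r' \<Phi>' k' l' g' h'"
    and G: "G \<in> carrier_mat r' r" "\<Phi>' * map_mat \<sigma> G = G * \<Phi>"
    and ne: "k * l' \<noteq> k' * l"
  shows "G = 0\<^sub>m r' r"
proof -
  \<comment> \<open>A common number of Frobenius steps; the exponents of \<pi> become
    \<open>l' * k\<close> and \<open>l * k'\<close>.\<close>
  define n where "n = l * l'"
  have "pure_lattice r \<Phi> (l' * k) n g h" "pure_lattice r' \<Phi>' (l * k') n g' h'"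
    using pure_lattice_multiple[OF p, of l'] pure_lattice_multiple[OF p', of l] by (simp_all add: n_def mult.commute)
  then obtain U C U' C' where c: "\<Phi> \<in> carrier_mat r r" "g \<in> carrier_mat r r" "h \<in> carrier_mat r r"
      "U \<in> carrier_mat r r" "C \<in> carrier_mat r r" "\<Phi>' \<in> carrier_mat r' r'" "g' \<in> carrier_mat r' r'"
      "h' \<in> carrier_mat r' r'" "U' \<in> carrier_mat r' r'" "C' \<in> carrier_mat r' r'"
    and g: "h * g = 1\<^sub>m r" "g * h = 1\<^sub>m r" "h' * g' = 1\<^sub>m r'" "g' * h' = 1\<^sub>m r'"
    and U: "ord_ge 0 U" "ord_ge 0 C" "U * C = 1\<^sub>m r" "C * U = 1\<^sub>m r"
    and U': "ord_ge 0 U'" "ord_ge 0 C'" "U' * C' = 1\<^sub>m r'" "C' * U' = 1\<^sub>m r'"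
    and eq: "frob_power r \<sigma> \<Phi> n * map_mat (\<sigma> ^^ n) g = \<pi> powi (- int (l' * k)) \<cdot>\<^sub>m (g * U)"
    and eq': "frob_power r' \<sigma> \<Phi>' n * map_mat (\<sigma> ^^ n) g' = \<pi> powi (- int (l * k')) \<cdot>\<^sub>m (g' * U')"
    unfolding pure_lattice_def by blast
  define e where "e = int (l' * k) - int (l * k')"
  have "int (l' * k) \<noteq> int (l * k')" using ne by (simp only: of_nat_eq_iff mult.commute not_False_eq_True)
  then have "e \<noteq> 0" unfolding e_def by simp
  define H where "H = h' * G * g"
  define s where "s = map_mat (\<sigma> ^^ n)"
  have sc: "s A \<in> carrier_mat i j" if "A \<in> carrier_mat i j" for A i j using that by (simp add: s_def)
  have H: "H \<in> carrier_mat r' r" using c G by (simp add: H_def)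
  note f = frob_power_carrier[OF c(1), of n] frob_power_carrier[OF c(6), of n]
  have Gg: "G * g = g' * H"
  proof -
    have "g' * H = (g' * h') * (G * g)"
      unfolding H_def using c G by (simp add: assoc_mult_mat[of _ r' r' _ r _ r] assoc_mult_mat[of _ r' r' _ r' _ r])
    then show ?thesis using g c G by simp
  qed
  have "\<pi> powi (- int (l' * k)) \<cdot>\<^sub>m (H * U) = h' * G * (\<pi> powi (- int (l' * k)) \<cdot>\<^sub>m (g * U))"
    unfolding H_def using c G
    by (simp add: mult_smult_distrib[of _ r' r _ r] assoc_mult_mat[of _ r' r _ r _ r] assoc_mult_mat[of _ r' r' _ r _ r])
  also have "\<dots> = h' * (G * frob_power r \<sigma> \<Phi> n) * s g"
    unfolding eq[symmetric] s_def[symmetric] using c G f sc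
    by (simp add: assoc_mult_mat[of _ r' r _ r _ r] assoc_mult_mat[of _ r' r' _ r _ r])
  also have "G * frob_power r \<sigma> \<Phi> n = frob_power r' \<sigma> \<Phi>' n * s G"
    unfolding s_def by (rule frob_power_intertwine[OF c(6,1) G, symmetric])
  also have "h' * (frob_power r' \<sigma> \<Phi>' n * s G) * s g = h' * (frob_power r' \<sigma> \<Phi>' n * s (G * g))"
    using c G f sc by (simp add: assoc_mult_mat[of _ r' r' _ r _ r] s_def map_funpow_mult[of _ r' r _ r])
  also have "\<dots> = h' * ((frob_power r' \<sigma> \<Phi>' n * s g') * s H)"
    unfolding Gg using c H f sc by (simp add: assoc_mult_mat[of _ r' r' _ r' _ r] s_def map_funpow_mult[of _ r' r' _ r])
  also have "\<dots> = \<pi> powi (- int (l * k')) \<cdot>\<^sub>m ((h' * g') * (U' * s H))"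
    unfolding s_def eq' using c H
    by (simp add: assoc_mult_mat[of _ r' r' _ r' _ r] mult_smult_distrib[of _ r' r' _ r] mult_smult_assoc_mat[of _ r' r' _ r])
  also have "\<dots> = \<pi> powi (- int (l * k')) \<cdot>\<^sub>m (U' * s H)"
    using g c sc[OF H] by simp
  finally have main: "\<pi> powi (- int (l' * k)) \<cdot>\<^sub>m (H * U) = \<pi> powi (- int (l * k')) \<cdot>\<^sub>m (U' * s H)" .
  \<comment> \<open>Multiplying by a matrix with integral inverse changes no bound; the same is used
    for \<open>U'\<close> below.\<close>
  have HU: "ord_ge m (H * U) \<longleftrightarrow> ord_ge m H" for m
  proof
    assume "ord_ge m (H * U)"
    then have "ord_ge m (H * U * C)" using ord_ge_mult[of m "H * U" 0 C] U c by simp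
    moreover have "H * U * C = H" using U(3) c H by (simp add: assoc_mult_mat[of _ r' r _ r _ r])
    ultimately show "ord_ge m H" by simp
  qed (use ord_ge_mult[of m H 0 U] U c H in auto)
  have UH: "ord_ge m (U' * s H) \<longleftrightarrow> ord_ge m H" for m
  proof
    assume "ord_ge m (U' * s H)"
    then have "ord_ge m (C' * (U' * s H))" using ord_ge_mult[of 0 C' m "U' * s H"] U' c by simp
    moreover have "C' * (U' * s H) = s H"
      using U'(4) c sc[OF H] by (simp add: assoc_mult_mat[of C' r' r' U' r' "s H" r, symmetric])
    ultimately show "ord_ge m H" by (simp add: s_def ord_ge_map)
  next
    assume "ord_ge m H"
    then show "ord_ge m (U' * s H)" using ord_ge_mult[of 0 U' m "s H"] U' c H by (simp add: s_def ord_ge_map)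
  qed
  \<comment> \<open>Both sides of \<open>main\<close> have the same bounds, and \<sigma> does not
    alter those of \<open>H\<close>. Only the two powers of \<pi> differ, so the sign of
    \<open>e\<close> decides in which direction the bounds can be pushed up.\<close>
  have iff: "ord_ge (m + int (l' * k)) H \<longleftrightarrow> ord_ge (m + int (l * k')) H" for m
    using arg_cong[OF main, of "ord_ge m"] by (simp add: ord_ge_smult HU UH)
  have "H = 0\<^sub>m r' r"
  proof (cases "0 < e")
    case True
    have "ord_ge (m + e) H" if "ord_ge m H" for m
      using iff[of "m - int (l * k')"] that by (simp add: e_def algebra_simps)
    then show ?thesis using ord_ge_shift_imp_zero[OF H _ True] by blast
  next
    case False
    have "ord_ge (m + (- e)) H" if "ord_ge m H" for m
      using iff[of "m - int (l' * k)"] that by (simp add: e_def algebra_simps)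
    then show ?thesis using ord_ge_shift_imp_zero[OF H, of "- e"] False \<open>e \<noteq> 0\<close> by simp
  qed
  then have "G * g = 0\<^sub>m r' r" using Gg c by simp
  then have "G * g * h = 0\<^sub>m r' r" using c by simp
  moreover have "G * g * h = G" using g c G by (simp add: assoc_mult_mat[of _ r' r _ r _ r])
  ultimately show ?thesis by simp
qed

text \<open>The columns of \<open>B\<close> span a space on which \<tau> acts with integral
  coefficients. Iterating keeps the coefficients integral, so a bound for \<open>H\<close> persists
  for \<open>H * Cl\<close>; purity rewrites that product with \<open>k\<close> extra poles, so the
  bound for \<open>H\<close> itself rises by \<open>k\<close>.\<close>

lemma pure_lattice_no_finite_submodule:
  assumes p: "pure_lattice r \<Phi> k l g h" and "0 < k"
    and B: "B \<in> carrier_mat r s" "C0 \<in> carrier_mat s s" "\<Phi> * map_mat \<sigma> B = B * C0"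
    and C0: "\<And>i j. i < s \<Longrightarrow> j < s \<Longrightarrow> C0 $$ (i, j) \<in> V"
  shows "B = 0\<^sub>m r s"
proof -
  from p obtain U C where c: "\<Phi> \<in> carrier_mat r r" "g \<in> carrier_mat r r" "h \<in> carrier_mat r r"
      "U \<in> carrier_mat r r" "C \<in> carrier_mat r r"
    and U: "h * g = 1\<^sub>m r" "g * h = 1\<^sub>m r" "ord_ge 0 U" "ord_ge 0 C" "U * C = 1\<^sub>m r" "C * U = 1\<^sub>m r"
    and eq: "frob_power r \<sigma> \<Phi> l * map_mat (\<sigma> ^^ l) g = \<pi> powi (- int k) \<cdot>\<^sub>m (g * U)"
    unfolding pure_lattice_def by blast
  define Cl where "Cl = frob_power s \<sigma> C0 l"
  have Cl: "Cl \<in> carrier_mat s s" unfolding Cl_def by (rule frob_power_carrier[OF B(2)])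
  have "ord_ge 0 (frob_power s \<sigma> C0 t)" for t
  proof (induction t)
    case 0
    show ?case using subring_zero[OF V] subring_one[OF V] by (auto simp: ord_ge_def)
  next
    case (Suc t)
    have "ord_ge 0 C0" using B C0 by (auto simp: ord_ge_def)
    then show ?case using ord_ge_mult[OF Suc, of 0 "map_mat (\<sigma> ^^ t) C0"] B frob_power_carrier[OF B(2), of t]
      by (simp add: ord_ge_map)
  qed
  then have ordCl: "ord_ge 0 Cl" by (simp add: Cl_def)
  define H where "H = h * B"
  have H: "H \<in> carrier_mat r s" using c B by (simp add: H_def)
  define \<sigma>H where "\<sigma>H = map_mat (\<sigma> ^^ l) H"
  have \<sigma>H: "\<sigma>H \<in> carrier_mat r s" using H by (simp add: \<sigma>H_def)
  have gH: "g * H = B" unfolding H_def using U c B by (simp add: assoc_mult_mat[of g r r h r B s, symmetric])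
  note f = frob_power_carrier[OF c(1), of l]
  have "H * Cl = h * (frob_power r \<sigma> \<Phi> l * map_mat (\<sigma> ^^ l) B)"
    unfolding frob_power_intertwine[OF c(1) B(2,1,3)] H_def Cl_def[symmetric]
    using c B Cl by (simp add: assoc_mult_mat[of _ r r _ s _ s])
  also have "frob_power r \<sigma> \<Phi> l * map_mat (\<sigma> ^^ l) B = (frob_power r \<sigma> \<Phi> l * map_mat (\<sigma> ^^ l) g) * \<sigma>H"
    unfolding gH[symmetric] \<sigma>H_def using c H f
    by (simp add: map_funpow_mult[of _ r r _ s] assoc_mult_mat[of _ r r _ r _ s])
  also have "\<dots> = \<pi> powi (- int k) \<cdot>\<^sub>m (g * (U * \<sigma>H))"
    unfolding eq using c \<sigma>H by (simp add: mult_smult_assoc_mat[of _ r r _ s] assoc_mult_mat[of _ r r _ r _ s])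
  also have "h * \<dots> = \<pi> powi (- int k) \<cdot>\<^sub>m (U * \<sigma>H)"
    using c \<sigma>H U(1) by (simp add: mult_smult_distrib[of _ r r _ s] assoc_mult_mat[of h r r g r "U * \<sigma>H" s, symmetric])
  finally have main: "H * Cl = \<pi> powi (- int k) \<cdot>\<^sub>m (U * \<sigma>H)" .
  have "ord_ge (m + int k) H" if "ord_ge m H" for m
  proof -
    have "ord_ge m (H * Cl)" using ord_ge_mult[OF that ordCl] H Cl by simp
    then have "ord_ge (m + int k) (U * \<sigma>H)" by (simp add: main ord_ge_smult)
    then have "ord_ge (m + int k) (C * (U * \<sigma>H))" using ord_ge_mult[of 0 C "m + int k" "U * \<sigma>H"] U c by simp
    moreover have "C * (U * \<sigma>H) = \<sigma>H" using c \<sigma>H U by (simp add: assoc_mult_mat[of C r r U r \<sigma>H s, symmetric])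
    ultimately show ?thesis by (simp add: \<sigma>H_def ord_ge_map)
  qed
  then have "H = 0\<^sub>m r s" using ord_ge_shift_imp_zero[OF H, of "int k"] \<open>0 < k\<close> by simp
  then show ?thesis using gH c by simp
qed

end

section \<open>Powers of the maximal ideal and integral vectors\<close>

context dvr_frobenius
begin

lemma max_ideal_V: "max_ideal V = (\<lambda>x. \<pi> * x) ` V"
proof (intro equalityI subsetI)
  fix x assume x: "x \<in> max_ideal V"
  show "x \<in> (\<lambda>x. \<pi> * x) ` V"
  proof (cases "x = 0")
    case True
    then show ?thesis using subring_zero[OF V] by (intro image_eqI[of _ _ 0]) auto
  next
    case False
    then obtain n u where u: "x = \<pi> powi n * u" "u \<noteq> 0" "u \<in> V" "inverse u \<in> V" using factor by blast
    have "0 \<le> n" using x mem_V_iff[OF u(2,3,4), of n] u(1) by (simp add: max_ideal_def)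
    moreover have "n \<noteq> 0" using x False u by (auto simp: max_ideal_def)
    ultimately have "\<pi> powi (n - 1) * u \<in> V" using mem_V_iff[OF u(2,3,4), of "n - 1"] by simp
    moreover have "\<pi> * (\<pi> powi (n - 1) * u) = x" using \<pi>_powi_mult[of 1 "n - 1" u] u(1) by simp
    ultimately show ?thesis by (metis imageI)
  qed
next
  fix x assume "x \<in> (\<lambda>x. \<pi> * x) ` V"
  then obtain y where y: "y \<in> V" "x = \<pi> * y" by blast
  have "inverse x \<notin> V" if "x \<noteq> 0"
  proof
    assume "inverse x \<in> V"
    then have "y * inverse x \<in> V" using y subring_times[OF V] by blast
    moreover have "y * inverse x = inverse \<pi>" using y that by (simp add: field_simps)
    ultimately show False using \<pi> by simp
  qed
  then show "x \<in> max_ideal V" using y \<pi> subring_times[OF V] by (auto simp: max_ideal_def)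
qed

text \<open>Records a generator inside the power and an upper bound for it. The upper bound is an
  induction over ideal products, which are closed under sums by definition.\<close>

lemma max_ideal_power:
  "\<pi> ^ k \<in> max_ideal V [^]\<^bsub>ideals_set (ring_on V)\<^esub> k \<and>
    max_ideal V [^]\<^bsub>ideals_set (ring_on V)\<^esub> k \<subseteq> (\<lambda>x. \<pi> ^ k * x) ` V"
proof (induction k)
  case 0
  show ?case using subring_one[OF V] by (auto simp: nat_pow_def ideals_set_def)
next
  case (Suc k)
  let ?I = "max_ideal V [^]\<^bsub>ideals_set (ring_on V)\<^esub> k"
  have eq: "max_ideal V [^]\<^bsub>ideals_set (ring_on V)\<^esub> Suc k = ideal_prod (ring_on V) ?I (max_ideal V)"
    by (simp add: nat_pow_def ideals_set_def)
  have "\<pi> * 1 \<in> max_ideal V" unfolding max_ideal_V by (rule imageI) (rule subring_one[OF V])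
  then have "\<pi> ^ k \<otimes>\<^bsub>ring_on V\<^esub> (\<pi> * 1) \<in> ideal_prod (ring_on V) ?I (max_ideal V)"
    using Suc by (intro ideal_prod.prod) auto
  moreover have "x \<in> (\<lambda>x. \<pi> ^ Suc k * x) ` V" if "x \<in> ideal_prod (ring_on V) ?I (max_ideal V)" for x
    using that
  proof induction
    case (prod i j)
    then obtain a b where "a \<in> V" "i = \<pi> ^ k * a" "b \<in> V" "j = \<pi> * b"
      using Suc unfolding max_ideal_V by blast
    then have "i * j = \<pi> ^ Suc k * (a * b)" "a * b \<in> V" using subring_times[OF V] by auto
    then show ?case by auto
  next
    case (sum x y)
    then obtain a b where "a \<in> V" "x = \<pi> ^ Suc k * a" "b \<in> V" "y = \<pi> ^ Suc k * b" by blast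
    then have "x + y = \<pi> ^ Suc k * (a + b)" "a + b \<in> V" using subring_plus[OF V] by (auto simp: distrib_left)
    then show ?case by auto
  qed
  ultimately show ?case unfolding eq by (auto simp: mult.commute)
qed

text \<open>It suffices to test the generator \<open>\<pi> ^ k\<close>; this makes the stalk of the
  twisting sheaf explicit.\<close>

lemma fractional_ideal_iff:
  "(\<forall>a \<in> max_ideal V [^]\<^bsub>ideals_set (ring_on V)\<^esub> k. a * x \<in> V) \<longleftrightarrow> \<pi> ^ k * x \<in> V"
proof
  assume "\<pi> ^ k * x \<in> V"
  then have "y * (\<pi> ^ k * x) \<in> V" if "y \<in> V" for y using that subring_times[OF V] by blast
  then show "\<forall>a \<in> max_ideal V [^]\<^bsub>ideals_set (ring_on V)\<^esub> k. a * x \<in> V"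
    using max_ideal_power[of k] by (fastforce simp: algebra_simps)
qed (use max_ideal_power[of k] in blast)

definition vecs :: "nat \<Rightarrow> 'a vec set" where
  "vecs r = {a \<in> carrier_vec r. \<forall>i<r. a $ i \<in> V}"

lemma vecs_minus: "a \<in> vecs r \<Longrightarrow> b \<in> vecs r \<Longrightarrow> a - b \<in> vecs r"
  and vecs_add: "a \<in> vecs r \<Longrightarrow> b \<in> vecs r \<Longrightarrow> a + b \<in> vecs r"
  and vecs_smult: "x \<in> V \<Longrightarrow> a \<in> vecs r \<Longrightarrow> x \<cdot>\<^sub>v a \<in> vecs r"
  and vecs_zero: "0\<^sub>v r \<in> vecs r" and vecs_unit: "i < r \<Longrightarrow> unit_vec r i \<in> vecs r"
  using subring_minus[OF V] subring_plus[OF V] subring_times[OF V] subring_zero[OF V] subring_one[OF V]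
  by (auto simp: vecs_def)

end

lemma invertible_matE:
  fixes g :: "'a::field mat"
  assumes "g \<in> carrier_mat r r" "invertible_mat g"
  obtains h where "h \<in> carrier_mat r r" "h * g = 1\<^sub>m r" "g * h = 1\<^sub>m r"
proof -
  obtain h where h: "g * h = 1\<^sub>m (dim_row g)" "h * g = 1\<^sub>m (dim_row h)"
    using assms(2) unfolding invertible_mat_def inverts_mat_def by blast
  \<comment> \<open>\<open>invertible_mat\<close> leaves the dimensions of the inverse open; they
    are read off from the two products.\<close>
  have "dim_col (g * h) = r" "dim_col (h * g) = dim_row h" unfolding h using assms(1) by auto
  then have "h \<in> carrier_mat r r" using assms(1) by (intro carrier_matI) auto
  then show ?thesis using that h assms(1) by auto
qed

section \<open>The point at infinity of the base change, and stalks there\<close>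

context curve_uniformizer
begin

lemma genideal_\<pi>: "genideal (ring_on R) (max_ideal \<O>) = (\<lambda>x. \<pi> * x) ` R"
  and ideal_\<pi>: "ideal ((\<lambda>x. \<pi> * x) ` R) (ring_on R)"
proof -
  interpret R: cring "ring_on R" by (rule ring_on_cring[OF subring_R])
  have eq: "(\<lambda>x. \<pi> * x) ` R = cgenideal (ring_on R) \<pi>"
    by (auto simp: cgenideal_def image_def mult.commute)
  show id: "ideal ((\<lambda>x. \<pi> * x) ` R) (ring_on R)"
    unfolding eq by (rule R.cgenideal_ideal) (simp add: \<pi>_mem_R)
  have sub: "max_ideal \<O> \<subseteq> (\<lambda>x. \<pi> * x) ` R" unfolding max_ideal_O using O_subset_R by blast
  then have carr: "max_ideal \<O> \<subseteq> carrier (ring_on R)" using \<pi>_mem_R R_closed(4) by auto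
  have "\<pi> * 1 \<in> max_ideal \<O>" unfolding max_ideal_O by (rule imageI) (rule O_closed)
  then have "\<pi> \<in> genideal (ring_on R) (max_ideal \<O>)" using R.genideal_self[OF carr] by auto
  then have "cgenideal (ring_on R) \<pi> \<subseteq> genideal (ring_on R) (max_ideal \<O>)"
    by (rule R.cgenideal_minimal[OF R.genideal_ideal[OF carr]])
  then show "genideal (ring_on R) (max_ideal \<O>) = (\<lambda>x. \<pi> * x) ` R"
    using R.genideal_minimal[OF id sub] unfolding eq by blast
qed

lemma infL_eq: "infL D = fractions R R\<^sub>1"
  unfolding infL_def Let_def R_def[symmetric] genideal_\<pi> R\<^sub>1_eq ..

lemma infL_iff: "x \<in> infL D \<longleftrightarrow> (\<exists>y z. y \<in> R \<and> z \<in> R\<^sub>1 \<and> x = y / z)"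
  unfolding infL_eq fractions_def by blast

lemma R\<^sub>1_nonzero: "z \<in> R\<^sub>1 \<Longrightarrow> z \<noteq> 0"
  using zero_notin_R\<^sub>1 by blast

lemma R_subset_infL: "R \<subseteq> infL D"
proof
  fix x assume "x \<in> R"
  then have "x \<in> R \<and> 1 \<in> R\<^sub>1 \<and> x = x / 1" using one_mem_R\<^sub>1 by simp
  then show "x \<in> infL D" unfolding infL_iff by blast
qed

lemma subring_infL: "subring (infL D) ambient"
  unfolding subring_ambient_iff
proof (intro conjI ballI)
  fix x y assume "x \<in> infL D" "y \<in> infL D"
  then obtain a b c d where *: "a \<in> R" "b \<in> R\<^sub>1" "x = a / b" "c \<in> R" "d \<in> R\<^sub>1" "y = c / d"
    unfolding infL_iff by blast
  have R: "b \<in> R" "d \<in> R" using * R\<^sub>1_subset by auto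
  have "x * y = (a * c) / (b * d)" "x + y = (a * d + c * b) / (b * d)"
    using * R\<^sub>1_nonzero[OF *(2)] R\<^sub>1_nonzero[OF *(5)] by (simp_all add: field_simps)
  moreover have "a * c \<in> R" "a * d + c * b \<in> R" using * R by (auto intro: R_closed(4,5))
  ultimately show "x * y \<in> infL D" "x + y \<in> infL D"
    unfolding infL_iff using R\<^sub>1_mult[OF *(2,5)] by blast+
next
  fix x assume "x \<in> infL D"
  then obtain a b where "a \<in> R" "b \<in> R\<^sub>1" "x = a / b" unfolding infL_iff by blast
  then have "- a \<in> R" "b \<in> R\<^sub>1" "- x = (- a) / b" by (auto intro: R_closed)
  then show "- x \<in> infL D" unfolding infL_iff by blast
qed (use R_subset_infL R_closed(2) in blast)

lemma \<pi>_mem_infL: "\<pi> \<in> infL D"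
  using R_subset_infL \<pi>_mem_R by blast

lemma inverse_\<pi>_notin: "inverse \<pi> \<notin> infL D"
proof
  assume "inverse \<pi> \<in> infL D"
  then obtain y z where yz: "y \<in> R" "z \<in> R\<^sub>1" "inverse \<pi> = y / z" unfolding infL_iff by blast
  then have "z = \<pi> * y" using R\<^sub>1_nonzero[OF yz(2)] \<pi> by (auto simp: field_simps)
  then show False using yz unfolding R\<^sub>1_eq by blast
qed

lemma compositum_F_denominator:
  assumes "x \<in> compositum F L"
  shows "\<exists>n. \<pi> ^ n * x \<in> R"
  using assms
proof (induction rule: compositum_induct)
  case zero
  show ?case using R_closed(1) by simp
next
  case (tensor x s b)
  obtain n where n: "\<pi> ^ n * x \<in> R" using tensor by blast
  \<comment> \<open>Large enough to cancel a pole of \<open>s\<close> at infinity.\<close>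
  define m where "m = nat \<bar>v s\<bar>"
  have "\<pi> ^ m * s \<in> \<O>"
  proof (cases "s = 0")
    case False
    have "\<pi> ^ m \<in> F" "\<pi> ^ m \<noteq> 0" using \<pi> F_closed(7) by auto
    then have "v (\<pi> ^ m * s) = int m + v s" and "\<pi> ^ m * s \<in> F"
      using dv.v_mult[of "\<pi> ^ m" s] dv.v_power[of \<pi> m] \<pi> False tensor F_closed(4) by auto
    moreover have "int m = \<bar>v s\<bar>" by (simp add: m_def)
    ultimately have "0 \<le> v (\<pi> ^ m * s)" by linarith
    then show ?thesis using \<open>\<pi> ^ m * s \<in> F\<close> by (simp add: O_iff)
  qed (simp add: O_closed(1))
  then have "\<pi> ^ m * s \<in> R" using O_subset_R by blast
  then have "\<pi> ^ n * ((\<pi> ^ m * s) * b) \<in> R"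
    using tensor L_subset_R R_closed(4)[OF R_closed(7)[OF \<pi>_mem_R] R_closed(4)] by blast
  moreover have "\<pi> ^ m * (\<pi> ^ n * x) \<in> R" by (rule R_closed(4)[OF R_closed(7)[OF \<pi>_mem_R] n])
  ultimately have "\<pi> ^ m * (\<pi> ^ n * x) + \<pi> ^ n * ((\<pi> ^ m * s) * b) \<in> R" by (rule R_closed(5)[rotated])
  moreover have "\<pi> ^ m * (\<pi> ^ n * x) + \<pi> ^ n * ((\<pi> ^ m * s) * b) = \<pi> ^ (m + n) * (x + s * b)"
    by (simp add: power_add algebra_simps)
  ultimately show ?case by metis
qed

lemma compositum_F_factor:
  assumes "x \<in> compositum F L" "x \<noteq> 0"
  obtains n y where "y \<in> R\<^sub>1" "x = \<pi> powi n * y"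
proof -
  obtain m where m: "\<pi> ^ m * x \<in> R" using compositum_F_denominator[OF assms(1)] by blast
  have "\<pi> ^ m * x \<noteq> 0" using assms(2) \<pi>(2) by simp
  from R_factorize[OF m this] obtain l y where y: "y \<in> R\<^sub>1" "\<pi> ^ m * x = \<pi> ^ l * y" by blast
  have "x = \<pi> powi (int l - int m) * y"
    using y(2) \<pi>(2) by (simp add: power_int_diff field_simps)
  then show ?thesis using that y by blast
qed

text \<open>An element of the ambient field is a quotient of two sums of tensors over
  \<open>F\<close>. Each is a power of \<pi> times an element of \<open>R\<^sub>1\<close>, and
  quotients of elements of \<open>R\<^sub>1\<close> are units of \<open>infL D\<close>.\<close>

lemma infL_factor:
  assumes "x \<noteq> 0"
  shows "\<exists>n u. x = \<pi> powi n * u \<and> u \<noteq> 0 \<and> u \<in> infL D \<and> inverse u \<in> infL D"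
proof -
  have "x \<in> fractions (compositum F L) (compositum F L - {0})" by (simp add: fractions_compositum)
  then obtain a b where ab: "a \<in> compositum F L" "b \<in> compositum F L" "b \<noteq> 0" "x = a / b"
    unfolding fractions_def by blast
  then have "a \<noteq> 0" using assms by auto
  obtain m y where y: "y \<in> R\<^sub>1" "a = \<pi> powi m * y" using compositum_F_factor[OF ab(1) \<open>a \<noteq> 0\<close>] .
  obtain n z where z: "z \<in> R\<^sub>1" "b = \<pi> powi n * z" using compositum_F_factor[OF ab(2,3)] .
  have nz: "y \<noteq> 0" "z \<noteq> 0" using y z R\<^sub>1_nonzero by auto
  have "x = \<pi> powi (m - n) * (y / z)" using nz \<pi>(2) by (simp add: ab y z power_int_diff)
  moreover have "y / z \<in> infL D" "z / y \<in> infL D" unfolding infL_iff using y z R\<^sub>1_subset by blast+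
  then have "inverse (y / z) \<in> infL D" by simp
  ultimately show ?thesis using nz \<open>y / z \<in> infL D\<close> by (intro exI[of _ "m - n"] exI[of _ "y / z"]) simp
qed

lemma \<sigma>_infL: "x \<in> infL D \<Longrightarrow> \<sigma> x \<in> infL D"
  unfolding infL_iff using \<sigma>_mem_R \<sigma>_mem_R\<^sub>1 \<sigma>_divide by blast

sublocale dvr: dvr_frobenius "infL D" \<pi> \<sigma>
  by (rule dvr_frobenius.intro)
    (use subring_infL \<pi>_mem_infL \<pi> inverse_\<pi>_notin infL_factor \<sigma>_infL in auto)

lemma infL_point: "infL D \<in> Y"
proof -
  have "primeideal ((\<lambda>x. \<pi> * x) ` R) (ring_on R)"
  proof (rule primeidealI[OF ideal_\<pi> ring_on_cring[OF subring_R]])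
    show "carrier (ring_on R) \<noteq> (\<lambda>x. \<pi> * x) ` R" using one_notin_\<pi>_R R_closed(2) by auto
    fix a b assume "a \<in> carrier (ring_on R)" "b \<in> carrier (ring_on R)"
      "a \<otimes>\<^bsub>ring_on R\<^esub> b \<in> (\<lambda>x. \<pi> * x) ` R"
    then show "a \<in> (\<lambda>x. \<pi> * x) ` R \<or> b \<in> (\<lambda>x. \<pi> * x) ` R"
      using R\<^sub>1_mult[of a b] unfolding R\<^sub>1_eq by auto
  qed
  moreover have "infL D = fractions R (R - (\<lambda>x. \<pi> * x) ` R)" unfolding infL_eq R\<^sub>1_eq ..
  moreover have "\<O> \<in> curve_points k F" using Oinf_dvr by (simp add: curve_points_def)
  ultimately show ?thesis unfolding curve_L_def using R_def by blast
qed

lemma generic_point: "UNIV \<in> Y"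
proof -
  have "domain (ring_on (compositum F L))"
    using ambient.subring_is_domain[OF compositum_subring[OF subrings(2,3)]] .
  from domain.zeroprimeideal[OF this] have "primeideal {0} (ring_on (compositum F L))" by simp
  then show ?thesis unfolding curve_L_def using fractions_compositum F_curve_point by blast
qed

text \<open>A pole of \<open>x\<close> means that \<open>inverse x\<close> is \<pi> times some
  integral \<open>y\<close>; then \<open>x * y\<close> would put the inverse of \<pi> into
  \<open>infL D\<close>.\<close>

lemma infL_inter_F: "x \<in> F \<Longrightarrow> x \<in> infL D \<Longrightarrow> x \<in> \<O>"
proof (rule ccontr)
  assume x: "x \<in> F" "x \<in> infL D" "x \<notin> \<O>"
  then have x0: "x \<noteq> 0" using O_closed(1) by blast
  have "inverse x \<in> max_ideal \<O>"
    using x dv.inverse_in_V[folded Oinf, OF x(1,3)] by (simp add: max_ideal_def)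
  then obtain y where y: "y \<in> \<O>" "inverse x = \<pi> * y" unfolding max_ideal_O by blast
  have "x * y \<in> infL D" using x y O_subset_R R_subset_infL by (intro subring_times[OF subring_infL]) auto
  moreover have "x * y = inverse \<pi>" using y x0 \<pi>(2) by (simp add: field_simps)
  ultimately show False using inverse_\<pi>_notin by simp
qed

text \<open>Infinity is a closed point: a local ring inside \<open>infL D\<close> would belong to a
  specialization. The valuation ring below it lies in \<open>\<O>\<close>, hence equals
  \<open>\<O>\<close> by maximality. The prime must contain \<pi>, since otherwise 1/\<pi> would
  appear, and it contains nothing of nonzero residue, since such residues are invertible in
  \<open>L\<close>.\<close>

lemma point_subset_infL:
  assumes P: "P \<in> Y" "P \<subseteq> infL D"
  shows "P = infL D"
proof -
  from P(1) obtain S p P0 where P0: "P0 \<in> curve_points k F" and S: "S = compositum P0 L"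
    and p: "primeideal p (ring_on S)" and P_eq: "P = fractions S (S - p)"
    unfolding curve_L_def by blast
  interpret p: primeideal p "ring_on S" by (rule p)
  note p_add = ideal.axioms(1)[OF primeideal.axioms(1)[OF p]]
  note P0_sub = curve_points_subring[OF P0]
  have one: "1 \<in> S - p"
    using p.one_imp_carrier p.I_notcarr compositum_subring[OF P0_sub(1) subrings(3)] S subring_one by fastforce
  have "S \<subseteq> P"
  proof
    fix x assume "x \<in> S"
    then have "x / 1 \<in> fractions S (S - p)" using one by (intro fractionsI)
    then show "x \<in> P" by (simp add: P_eq)
  qed
  moreover have "P0 \<subseteq> S" unfolding S by (rule compositum_left[OF P0_sub(1) subrings(3)])
  ultimately have "P0 \<subseteq> \<O>" using P(2) P0_sub(2) infL_inter_F by blast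
  have "P0 = \<O>" using P0
  proof (cases rule: curve_points_cases)
    case 1
    then show ?thesis using \<open>P0 \<subseteq> \<O>\<close> Oinf_subset_F F_neq_Oinf by blast
  next
    case (2 w)
    then show ?thesis
      using discrete_valuation.V_maximal[OF 2(1) subring_O] \<open>P0 \<subseteq> \<O>\<close> Oinf_subset_F F_neq_Oinf by blast
  qed
  then have SR: "S = R" by (simp add: S R_def)
  have "(\<lambda>x. \<pi> * x) ` R \<subseteq> p"
  proof
    fix x assume "x \<in> (\<lambda>x. \<pi> * x) ` R"
    then obtain r where r: "r \<in> R" "x = \<pi> * r" by blast
    show "x \<in> p"
    proof (rule ccontr)
      assume "x \<notin> p"
      have "0 \<in> p" using additive_subgroup.zero_closed[OF p_add] by simp
      then have x0: "x \<noteq> 0" using \<open>x \<notin> p\<close> by blast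
      have "x \<in> S - p" using r \<open>x \<notin> p\<close> SR \<pi>_mem_R R_closed(4) by blast
      then have "1 / x \<in> P" unfolding P_eq using one by (intro fractionsI) auto
      then have "r * (1 / x) \<in> infL D" using r P(2) R_subset_infL by (intro subring_times[OF subring_infL]) auto
      moreover have "r * (1 / x) = inverse \<pi>" using r x0 by (simp add: field_simps)
      ultimately show False using inverse_\<pi>_notin by simp
    qed
  qed
  moreover have "p \<subseteq> (\<lambda>x. \<pi> * x) ` R"
  proof
    fix x assume x: "x \<in> p"
    then have "x \<in> R" using p.Icarr[OF x] SR by simp
    then obtain b y where by': "b \<in> L" "y \<in> R" "x = b + \<pi> * y" by (rule R_decompose)
    have "\<pi> * y \<in> p" using \<open>(\<lambda>x. \<pi> * x) ` R \<subseteq> p\<close> by' by blast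
    show "x \<in> (\<lambda>x. \<pi> * x) ` R"
    proof (cases "b = 0")
      case False
      have "- 1 \<in> R" by (intro R_closed(3) R_closed(2))
      then have "- (\<pi> * y) \<in> p" using p.I_l_closed[OF \<open>\<pi> * y \<in> p\<close>, of "- 1"] SR by simp
      then have "b \<in> p" using additive_subgroup.a_closed[OF p_add x, of "- (\<pi> * y)"] by' by simp
      then have "b * inverse b \<in> p"
        using p.I_r_closed[of b "inverse b"] inverse_closed(3)[OF by'(1)] L_subset_R SR by auto
      then have "1 \<in> p" using False by simp
      then show ?thesis using one by blast
    qed (use by' in auto)
  qed
  ultimately have "p = (\<lambda>x. \<pi> * x) ` R" by blast
  then show ?thesis unfolding P_eq SR infL_eq R\<^sub>1_eq by simp
qed

lemma openin_domain: "openin (zariski Y) {P \<in> Y. f \<in> P}"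
  unfolding zariski_def by (rule topology_generated_by_Basis) blast

text \<open>Every other point omits no less than is needed: its local ring has an element outside
  \<open>infL D\<close>, so the domains of such functions cover exactly the complement of
  infinity.\<close>

lemma openin_affine: "openin (zariski Y) (Y - {infL D})"
proof -
  have "Y - {infL D} = (\<Union>f\<in>- infL D. {P \<in> Y. f \<in> P})"
    using point_subset_infL by blast
  then show ?thesis using openin_domain by (simp add: openin_clauses(3) openin_Union)
qed

text \<open>The sheaf conditions constrain nonempty open sets only; the generic point provides one
  here.\<close>

lemma affine_nonempty: "Y - {infL D} \<noteq> {}"
  using generic_point inverse_\<pi>_notin by (metis Diff_iff UNIV_I empty_iff singletonD)

text \<open>A trivialization near infinity identifies the stalk with a free lattice: germs restrict
  into its neighbourhood, and conversely finitely many entries in \<open>infL D\<close> are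
  simultaneously defined on some neighbourhood.\<close>

lemma stalk_eq:
  assumes E: "locally_free_sheaf Y r E"
  obtains g h where "g \<in> carrier_mat r r" "h \<in> carrier_mat r r" "h * g = 1\<^sub>m r" "g * h = 1\<^sub>m r"
    "stalk Y E (infL D) = (\<lambda>a. g *\<^sub>v a) ` dvr.vecs r"
proof -
  from bspec[OF conjunct2[OF conjunct2[OF E[unfolded locally_free_sheaf_def]]] infL_point]
  obtain W g where W: "openin (zariski Y) W" "infL D \<in> W" and g: "g \<in> carrier_mat r r" "invertible_mat g"
    and EW0: "\<forall>W'. openin (zariski Y) W' \<and> W' \<noteq> {} \<and> W' \<subseteq> W \<longrightarrow>
      E W' = {g *\<^sub>v a | a. a \<in> carrier_vec r \<and> (\<forall>i<r. a $ i \<in> \<Inter>W')}"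
    by (elim exE conjE) (rule that)
  have EW: "E W' = {g *\<^sub>v a | a. a \<in> carrier_vec r \<and> (\<forall>i<r. a $ i \<in> \<Inter>W')}"
    if "openin (zariski Y) W'" "W' \<noteq> {}" "W' \<subseteq> W" for W'
    using mp[OF spec[OF EW0, of W']] that by (simp only: simp_thms)
  obtain h where h: "h \<in> carrier_mat r r" "h * g = 1\<^sub>m r" "g * h = 1\<^sub>m r" using invertible_matE[OF g] .
  have "stalk Y E (infL D) = (\<lambda>a. g *\<^sub>v a) ` dvr.vecs r"
  proof (intro equalityI subsetI)
    fix x assume "x \<in> stalk Y E (infL D)"
    then obtain W1 where W1: "openin (zariski Y) W1" "infL D \<in> W1" "x \<in> E W1" unfolding stalk_def by blast
    have int: "openin (zariski Y) (W1 \<inter> W)" "infL D \<in> W1 \<inter> W" using W W1 by auto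
    \<comment> \<open>There are no restriction maps; gluing for the cover by \<open>W1\<close> and
      \<open>W1 \<inter> W\<close> yields the inclusion of sections that replaces them.\<close>
    have "E (\<Union>{W1, W1 \<inter> W}) = (\<Inter>W'\<in>{W1, W1 \<inter> W}. E W')"
      using conjunct1[OF conjunct2[OF E[unfolded locally_free_sheaf_def]], rule_format, of "{W1, W1 \<inter> W}"] W1 int
      by (metis (no_types, lifting) empty_iff insert_iff insert_not_empty)
    moreover have "\<Union>{W1, W1 \<inter> W} = W1" by blast
    ultimately have "E W1 = E W1 \<inter> E (W1 \<inter> W)" by simp
    then have "x \<in> E (W1 \<inter> W)" using W1 by blast
    also have "E (W1 \<inter> W) = {g *\<^sub>v a | a. a \<in> carrier_vec r \<and> (\<forall>i<r. a $ i \<in> \<Inter>(W1 \<inter> W))}"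
      using int by (intro EW) auto
    finally show "x \<in> (\<lambda>a. g *\<^sub>v a) ` dvr.vecs r" using int unfolding dvr.vecs_def by blast
  next
    fix x assume "x \<in> (\<lambda>a. g *\<^sub>v a) ` dvr.vecs r"
    then obtain a :: "'a vec" where a: "a \<in> carrier_vec r" "\<And>i. i < r \<Longrightarrow> a $ i \<in> infL D" "x = g *\<^sub>v a"
      unfolding dvr.vecs_def by blast
    \<comment> \<open>The common domain of the entries of \<open>a\<close>, kept inside
      \<open>W\<close>, is open because there are only finitely many entries.\<close>
    have "openin (zariski Y) (W \<inter> (\<Inter>i\<in>I. {P \<in> Y. a $ i \<in> P}))" if "finite I" for I :: "nat set"
      using that
    proof (induction I)
      case (insert i I)
      have eq: "W \<inter> (\<Inter>j\<in>insert i I. {P \<in> Y. a $ j \<in> P}) = {P \<in> Y. a $ i \<in> P} \<inter> (W \<inter> (\<Inter>j\<in>I. {P \<in> Y. a $ j \<in> P}))" by blast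
      show ?case unfolding eq by (intro openin_Int openin_domain insert.IH)
    qed (use W in simp)
    from this[of "{..<r}"] have op: "openin (zariski Y) (W \<inter> (\<Inter>i\<in>{..<r}. {P \<in> Y. a $ i \<in> P}))" by simp
    have mem: "infL D \<in> W \<inter> (\<Inter>i\<in>{..<r}. {P \<in> Y. a $ i \<in> P})" using W a infL_point by auto
    have "E (W \<inter> (\<Inter>i\<in>{..<r}. {P \<in> Y. a $ i \<in> P})) =
        {g *\<^sub>v a' | a'. a' \<in> carrier_vec r \<and> (\<forall>i<r. a' $ i \<in> \<Inter>(W \<inter> (\<Inter>i\<in>{..<r}. {P \<in> Y. a $ i \<in> P})))}"
      using mem by (intro EW op) auto
    then have "x \<in> E (W \<inter> (\<Inter>i\<in>{..<r}. {P \<in> Y. a $ i \<in> P}))" using a by blast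
    then show "x \<in> stalk Y E (infL D)" unfolding stalk_def using op mem by blast
  qed
  then show ?thesis using that g h by blast
qed

text \<open>The scalar factors as \<open>\<pi> powi (- int n)\<close> times
  \<open>\<pi> ^ n * x\<close>, and the second, integral factor is absorbed into the vector.\<close>

lemma twisted_stalk_eq:
  assumes g: "g \<in> carrier_mat r r" and st: "stalk Y E (infL D) = (\<lambda>a. g *\<^sub>v a) ` dvr.vecs r"
  shows "twisted_stalk Y E (infL D) n = (\<lambda>a. \<pi> powi (- int n) \<cdot>\<^sub>v (g *\<^sub>v a)) ` dvr.vecs r"
proof -
  have pow: "\<pi> powi (- int n) * (\<pi> ^ n * x) = x" "\<pi> ^ n * \<pi> powi (- int n) = 1" for x
    using \<pi>(2) by (simp_all add: power_int_minus)
  have "twisted_stalk Y E (infL D) n = {x \<cdot>\<^sub>v (g *\<^sub>v a) | x a. a \<in> dvr.vecs r \<and> \<pi> ^ n * x \<in> infL D}"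
    unfolding twisted_stalk_def st dvr.fractional_ideal_iff by blast
  also have "\<dots> = (\<lambda>a. \<pi> powi (- int n) \<cdot>\<^sub>v (g *\<^sub>v a)) ` dvr.vecs r"
  proof (intro equalityI subsetI)
    fix w assume "w \<in> {x \<cdot>\<^sub>v (g *\<^sub>v a) | x a. a \<in> dvr.vecs r \<and> \<pi> ^ n * x \<in> infL D}"
    then obtain x a where w: "w = x \<cdot>\<^sub>v (g *\<^sub>v a)" "a \<in> dvr.vecs r" "\<pi> ^ n * x \<in> infL D" by blast
    have "\<pi> powi (- int n) \<cdot>\<^sub>v (g *\<^sub>v ((\<pi> ^ n * x) \<cdot>\<^sub>v a)) = (\<pi> powi (- int n) * (\<pi> ^ n * x)) \<cdot>\<^sub>v (g *\<^sub>v a)"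
      using w(2) g by (simp add: dvr.vecs_def mult_mat_vec[of g r r] smult_smult_assoc)
    then have "w = \<pi> powi (- int n) \<cdot>\<^sub>v (g *\<^sub>v ((\<pi> ^ n * x) \<cdot>\<^sub>v a))"
      unfolding pow(1) w(1) by (rule sym)
    then show "w \<in> (\<lambda>a. \<pi> powi (- int n) \<cdot>\<^sub>v (g *\<^sub>v a)) ` dvr.vecs r"
      using dvr.vecs_smult[OF w(3,2)] by blast
  next
    fix w assume "w \<in> (\<lambda>a. \<pi> powi (- int n) \<cdot>\<^sub>v (g *\<^sub>v a)) ` dvr.vecs r"
    moreover have "\<pi> ^ n * \<pi> powi (- int n) \<in> infL D" unfolding pow(2) by (rule subring_one[OF subring_infL])
    ultimately show "w \<in> {x \<cdot>\<^sub>v (g *\<^sub>v a) | x a. a \<in> dvr.vecs r \<and> \<pi> ^ n * x \<in> infL D}"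
      by blast
  qed
  finally show ?thesis .
qed

end

section \<open>Tensor products and localization\<close>

text \<open>The assumptions are the closure properties that place all relators among the chains.
  Thus the stalk lattices and the motives are instances alike.\<close>

locale tensor_product =
  fixes R S :: "'a::field set" and \<phi> :: "'a \<Rightarrow> 'a" and M :: "('a, 'm) module"
  assumes S: "subring S ambient" and \<phi>: "a \<in> R \<Longrightarrow> \<phi> a \<in> S"
    and M_add: "m \<in> carrier M \<Longrightarrow> n \<in> carrier M \<Longrightarrow> m \<oplus>\<^bsub>M\<^esub> n \<in> carrier M"
    and M_smult: "a \<in> R \<Longrightarrow> m \<in> carrier M \<Longrightarrow> a \<odot>\<^bsub>M\<^esub> m \<in> carrier M"
begin

abbreviation "FP \<equiv> free_pairs S M"
abbreviation "T \<equiv> tensor_relations R S \<phi> M"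
abbreviation "BC \<equiv> base_change R S \<phi> M"

definition relators :: "(('m \<times> 'a) \<Rightarrow>\<^sub>0 int) set" where
  "relators = {frag_of (m \<oplus>\<^bsub>M\<^esub> n, b) - frag_of (m, b) - frag_of (n, b) | m n b.
         m \<in> carrier M \<and> n \<in> carrier M \<and> b \<in> S} \<union>
      {frag_of (m, b + c) - frag_of (m, b) - frag_of (m, c) | m b c.
         m \<in> carrier M \<and> b \<in> S \<and> c \<in> S} \<union>
      {frag_of (a \<odot>\<^bsub>M\<^esub> m, b) - frag_of (m, \<phi> a * b) | a m b.
         a \<in> R \<and> m \<in> carrier M \<and> b \<in> S}"

lemma T_eq: "T = generate (add_monoid FP) relators"
  by (simp only: tensor_relations_def relators_def)

definition chains :: "(('m \<times> 'a) \<Rightarrow>\<^sub>0 int) set" where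
  "chains = {c. Poly_Mapping.keys c \<subseteq> carrier M \<times> S}"

lemma FP_simps: "carrier FP = chains" "x \<oplus>\<^bsub>FP\<^esub> y = x + y" "\<zero>\<^bsub>FP\<^esub> = 0"
  "s \<odot>\<^bsub>FP\<^esub> x = frag_extend (\<lambda>(m, b). frag_of (m, s * b)) x"
  by (simp_all add: free_pairs_def chains_def)

lemma chains_0: "0 \<in> chains" and chains_uminus: "x \<in> chains \<Longrightarrow> - x \<in> chains"
  and chains_add: "x \<in> chains \<Longrightarrow> y \<in> chains \<Longrightarrow> x + y \<in> chains"
  and chains_diff: "x \<in> chains \<Longrightarrow> y \<in> chains \<Longrightarrow> x - y \<in> chains"
  and chains_of: "m \<in> carrier M \<Longrightarrow> b \<in> S \<Longrightarrow> frag_of (m, b) \<in> chains"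
  using keys_add[of x y] keys_diff[of x y] by (auto simp: chains_def)

lemma chains_induct [consumes 1, case_names zero one diff]:
  assumes "c \<in> chains" "P 0" "\<And>m b. m \<in> carrier M \<Longrightarrow> b \<in> S \<Longrightarrow> P (frag_of (m, b))"
    "\<And>a b. a \<in> chains \<Longrightarrow> b \<in> chains \<Longrightarrow> P a \<Longrightarrow> P b \<Longrightarrow> P (a - b)"
  shows "P c"
proof -
  have "Poly_Mapping.keys c \<subseteq> carrier M \<times> S" using assms(1) by (simp add: chains_def)
  then have "c \<in> chains \<and> P c"
    by (induction rule: frag_induction)
      (auto intro: assms(2-) chains_0 chains_of chains_diff)
  then show ?thesis ..
qed

lemma abelian_group_FP: "abelian_group FP"
proof (rule abelian_groupI, unfold FP_simps)
  show "\<exists>y\<in>chains. y + x = 0" if "x \<in> chains" for x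
    using that by (intro bexI[of _ "- x"]) (auto intro: chains_uminus)
qed (auto intro: chains_0 chains_add simp: add_ac)

lemma relators_subset: "relators \<subseteq> chains"
  using M_add M_smult \<phi> unfolding relators_def
  by (auto intro!: chains_diff chains_of intro: subring_times[OF S] subring_plus[OF S])

lemma subgroup_T: "subgroup T (add_monoid FP)"
proof -
  interpret abelian_group FP by (rule abelian_group_FP)
  show ?thesis unfolding T_eq
    by (rule add.generate_is_subgroup) (use relators_subset in \<open>simp add: FP_simps\<close>)
qed

lemma T_subset: "T \<subseteq> chains" and T_0: "0 \<in> T" and T_add: "x \<in> T \<Longrightarrow> y \<in> T \<Longrightarrow> x + y \<in> T"
  using subgroup.subset[OF subgroup_T] subgroup.one_closed[OF subgroup_T]
    subgroup.m_closed[OF subgroup_T, of x y] by (simp_all add: FP_simps)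

lemma inv_FP: "x \<in> chains \<Longrightarrow> inv\<^bsub>add_monoid FP\<^esub> x = - x"
proof -
  interpret abelian_group FP by (rule abelian_group_FP)
  assume "x \<in> chains"
  then have "\<ominus>\<^bsub>FP\<^esub> x = - x" by (intro minus_equality) (auto simp: FP_simps chains_uminus)
  then show ?thesis unfolding a_inv_def .
qed

lemma T_uminus: "x \<in> T \<Longrightarrow> - x \<in> T"
  using subgroup.m_inv_closed[OF subgroup_T, of x] inv_FP[of x] T_subset by auto

lemma T_diff: "x \<in> T \<Longrightarrow> y \<in> T \<Longrightarrow> x - y \<in> T"
  using T_add[OF _ T_uminus] by fastforce

lemma T_induct [consumes 1, case_names zero relator add uminus]:
  assumes "x \<in> T" and "P 0" and "\<And>x. x \<in> relators \<Longrightarrow> P x"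
    and "\<And>x y. x \<in> chains \<Longrightarrow> y \<in> chains \<Longrightarrow> P x \<Longrightarrow> P y \<Longrightarrow> P (x + y)"
    and "\<And>x. x \<in> chains \<Longrightarrow> P x \<Longrightarrow> P (- x)"
  shows "P x"
proof -
  have "x \<in> generate (add_monoid FP) relators" using assms(1) by (simp add: T_eq)
  then have "x \<in> chains \<and> P x"
  proof induction
    case (inv h)
    then have "h \<in> chains" using relators_subset by blast
    then show ?case using inv_FP[of h] assms(3)[OF inv] assms(5)[of h] chains_uminus[of h] by simp
  qed (use relators_subset assms(2-4) in \<open>auto simp: FP_simps intro: chains_0 chains_add\<close>)
  then show ?thesis ..
qed

lemma relators_T: "relators \<subseteq> T"
  unfolding T_eq by (auto intro: generate.incl)

text \<open>Calculations in the tensor product are done on representatives in the free abelian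
  group; cosets appear only through \<open>cls\<close>.\<close>

definition cong (infix "\<sim>\<^sub>T" 50) where "x \<sim>\<^sub>T y \<longleftrightarrow> x - y \<in> T"

lemma cong_refl [simp]: "x \<sim>\<^sub>T x" by (simp add: cong_def T_0)

lemma cong_sym: "x \<sim>\<^sub>T y \<Longrightarrow> y \<sim>\<^sub>T x"
  using T_uminus[of "x - y"] by (simp add: cong_def)

lemma cong_trans [trans]: "x \<sim>\<^sub>T y \<Longrightarrow> y \<sim>\<^sub>T z \<Longrightarrow> x \<sim>\<^sub>T z"
  using T_add[of "x - y" "y - z"] by (simp add: cong_def)

lemma cong_add: "x \<sim>\<^sub>T y \<Longrightarrow> x' \<sim>\<^sub>T y' \<Longrightarrow> x + x' \<sim>\<^sub>T y + y'"
  using T_add[of "x - y" "x' - y'"] by (simp add: cong_def algebra_simps)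

lemma cong_diff: "x \<sim>\<^sub>T y \<Longrightarrow> x' \<sim>\<^sub>T y' \<Longrightarrow> x - x' \<sim>\<^sub>T y - y'"
  using T_diff[of "x - y" "x' - y'"] by (simp add: cong_def algebra_simps)

lemma cong_zeroI: "x \<in> T \<Longrightarrow> x \<sim>\<^sub>T 0" and cong_zeroI': "x \<in> T \<Longrightarrow> 0 \<sim>\<^sub>T x"
  using T_uminus by (auto simp: cong_def)

text \<open>The usual way to show that a tensor with a zero factor vanishes: it equals its own
  double.\<close>

lemma cong_double: "x \<sim>\<^sub>T x + x \<Longrightarrow> x \<in> T"
  using T_uminus[of "x - (x + x)"] by (simp add: cong_def)

lemma cong_sum: "(\<And>i. i \<in> I \<Longrightarrow> f i \<sim>\<^sub>T g i) \<Longrightarrow> sum f I \<sim>\<^sub>T sum g I"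
  by (induction I rule: infinite_finite_induct) (auto intro: cong_add)

lemma cong_add_left: "m \<in> carrier M \<Longrightarrow> n \<in> carrier M \<Longrightarrow> b \<in> S \<Longrightarrow>
    frag_of (m \<oplus>\<^bsub>M\<^esub> n, b) \<sim>\<^sub>T frag_of (m, b) + frag_of (n, b)"
  and cong_add_right: "m \<in> carrier M \<Longrightarrow> b \<in> S \<Longrightarrow> b' \<in> S \<Longrightarrow>
    frag_of (m, b + b') \<sim>\<^sub>T frag_of (m, b) + frag_of (m, b')"
  and cong_smult: "a \<in> R \<Longrightarrow> m \<in> carrier M \<Longrightarrow> b \<in> S \<Longrightarrow>
    frag_of (a \<odot>\<^bsub>M\<^esub> m, b) \<sim>\<^sub>T frag_of (m, \<phi> a * b)"
proof -
  show "frag_of (m \<oplus>\<^bsub>M\<^esub> n, b) \<sim>\<^sub>T frag_of (m, b) + frag_of (n, b)"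
    if "m \<in> carrier M" "n \<in> carrier M" "b \<in> S"
  proof -
    have "frag_of (m \<oplus>\<^bsub>M\<^esub> n, b) - frag_of (m, b) - frag_of (n, b) \<in> T"
      using that relators_T unfolding relators_def by blast
    then show ?thesis by (simp add: cong_def algebra_simps)
  qed
  show "frag_of (m, b + b') \<sim>\<^sub>T frag_of (m, b) + frag_of (m, b')" if "m \<in> carrier M" "b \<in> S" "b' \<in> S"
  proof -
    have "frag_of (m, b + b') - frag_of (m, b) - frag_of (m, b') \<in> T"
      using that relators_T unfolding relators_def by blast
    then show ?thesis by (simp add: cong_def algebra_simps)
  qed
  show "frag_of (a \<odot>\<^bsub>M\<^esub> m, b) \<sim>\<^sub>T frag_of (m, \<phi> a * b)" if "a \<in> R" "m \<in> carrier M" "b \<in> S"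
  proof -
    have "frag_of (a \<odot>\<^bsub>M\<^esub> m, b) - frag_of (m, \<phi> a * b) \<in> T"
      using that relators_T unfolding relators_def by blast
    then show ?thesis by (simp add: cong_def)
  qed
qed

lemma cong_zero_right: "m \<in> carrier M \<Longrightarrow> frag_of (m, 0) \<in> T"
  using cong_add_right[of m 0 0] subring_zero[OF S] by (intro cong_double) simp

lemma cong_uminus_right:
  assumes "m \<in> carrier M" "b \<in> S"
  shows "frag_of (m, - b) \<sim>\<^sub>T - frag_of (m, b)"
proof -
  have "frag_of (m, b + - b) - (frag_of (m, b) + frag_of (m, - b)) \<in> T"
    using cong_add_right[OF assms subring_uminus[OF S assms(2)]] by (simp add: cong_def)
  from T_diff[OF cong_zero_right[OF assms(1)] this]
  have "frag_of (m, b) + frag_of (m, - b) \<in> T" by (simp add: add.commute)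
  then show ?thesis by (simp add: cong_def add.commute)
qed

abbreviation scale :: "'a \<Rightarrow> (('m \<times> 'a) \<Rightarrow>\<^sub>0 int) \<Rightarrow> (('m \<times> 'a) \<Rightarrow>\<^sub>0 int)" where
  "scale s \<equiv> frag_extend (\<lambda>(m, b). frag_of (m, s * b))"

lemma scale_scale: "c \<in> chains \<Longrightarrow> scale s (scale t c) = scale (s * t) c"
  by (induction rule: chains_induct) (simp_all add: frag_extend_diff mult.assoc)

lemma scale_chains: "c \<in> chains \<Longrightarrow> s \<in> S \<Longrightarrow> scale s c \<in> chains"
  by (induction rule: chains_induct)
    (auto simp: frag_extend_diff intro: chains_0 chains_diff chains_of subring_times[OF S])

lemma scale_zero: "c \<in> chains \<Longrightarrow> scale 0 c \<sim>\<^sub>T 0"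
proof (induction rule: chains_induct)
  case (diff a b)
  show ?case using cong_diff[OF diff.IH] by (simp add: frag_extend_diff)
qed (auto simp: cong_def cong_zero_right T_0)

lemma relatorI:
  "m \<in> carrier M \<Longrightarrow> n \<in> carrier M \<Longrightarrow> b \<in> S \<Longrightarrow>
    frag_of (m \<oplus>\<^bsub>M\<^esub> n, b) - frag_of (m, b) - frag_of (n, b) \<in> relators"
  "m \<in> carrier M \<Longrightarrow> b \<in> S \<Longrightarrow> b' \<in> S \<Longrightarrow>
    frag_of (m, b + b') - frag_of (m, b) - frag_of (m, b') \<in> relators"
  "a \<in> R \<Longrightarrow> m \<in> carrier M \<Longrightarrow> b \<in> S \<Longrightarrow>
    frag_of (a \<odot>\<^bsub>M\<^esub> m, b) - frag_of (m, \<phi> a * b) \<in> relators"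
  unfolding relators_def by blast+

lemma relatorE:
  assumes "x \<in> relators"
  obtains m n b where "x = frag_of (m \<oplus>\<^bsub>M\<^esub> n, b) - frag_of (m, b) - frag_of (n, b)"
      "m \<in> carrier M" "n \<in> carrier M" "b \<in> S"
    | m b b' where "x = frag_of (m, b + b') - frag_of (m, b) - frag_of (m, b')"
      "m \<in> carrier M" "b \<in> S" "b' \<in> S"
    | a m b where "x = frag_of (a \<odot>\<^bsub>M\<^esub> m, b) - frag_of (m, \<phi> a * b)"
      "a \<in> R" "m \<in> carrier M" "b \<in> S"
  using assms unfolding relators_def by blast

text \<open>Scaling the second components turns a relator into a relator of the same kind, so
  scalars act on the quotient.\<close>

lemma scale_T: "x \<in> T \<Longrightarrow> s \<in> S \<Longrightarrow> scale s x \<in> T"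
proof (induction rule: T_induct)
  case (relator x)
  note S_times = subring_times[OF S \<open>s \<in> S\<close>]
  have "scale s x \<in> relators"
    using relator(1)
  proof (cases rule: relatorE)
    case (1 m n b)
    then show ?thesis using relatorI(1)[of m n "s * b"] S_times[of b] by (simp add: frag_extend_diff)
  next
    case (2 m b c)
    then show ?thesis using relatorI(2)[of m "s * b" "s * c"] S_times[of b] S_times[of c]
      by (simp add: frag_extend_diff distrib_left)
  next
    case (3 a m b)
    have "s * (\<phi> a * b) = \<phi> a * (s * b)" by (rule mult.left_commute)
    then have "scale s x = frag_of (a \<odot>\<^bsub>M\<^esub> m, s * b) - frag_of (m, \<phi> a * (s * b))"
      by (simp only: 3(1) frag_extend_diff frag_extend_of prod.case)
    then show ?thesis using 3 relatorI(3)[of a m "s * b"] S_times[of b] by simp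
  qed
  then show ?case using relators_T by blast
qed (auto simp: frag_extend_add frag_extend_minus intro: T_0 T_add T_uminus)

lemma cong_scale: "x \<sim>\<^sub>T y \<Longrightarrow> s \<in> S \<Longrightarrow> scale s x \<sim>\<^sub>T scale s y"
  using scale_T[of "x - y" s] by (simp add: cong_def frag_extend_diff)

definition cls where "cls c = T +>\<^bsub>FP\<^esub> c"

lemma cls_eq: "cls c = (\<lambda>t. t + c) ` T"
  by (auto simp: cls_def a_r_coset_def r_coset_def FP_simps)

lemma mem_cls: "x \<in> cls c \<longleftrightarrow> x \<sim>\<^sub>T c"
  unfolding cls_eq cong_def by (auto intro: image_eqI[of _ _ "x - c"])

lemma cls_eq_iff: "cls c = cls d \<longleftrightarrow> c \<sim>\<^sub>T d"
proof
  show "c \<sim>\<^sub>T d" if "cls c = cls d" using that mem_cls[of c c] mem_cls[of c d] by simp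
  show "cls c = cls d" if "c \<sim>\<^sub>T d"
    using that cong_trans cong_sym unfolding set_eq_iff mem_cls by blast
qed

lemma carrier_BC: "carrier BC = cls ` chains"
  by (auto simp: base_change_def quot_module_def A_RCOSETS_def RCOSETS_def cls_def a_r_coset_def FP_simps)

lemma BC_zero: "\<zero>\<^bsub>BC\<^esub> = cls 0"
  by (simp add: base_change_def quot_module_def cls_eq)

lemma BC_add: "cls c \<oplus>\<^bsub>BC\<^esub> cls d = cls (c + d)"
proof -
  have "cls c \<oplus>\<^bsub>BC\<^esub> cls d = {x + y | x y. x \<in> cls c \<and> y \<in> cls d}"
    by (auto simp: base_change_def quot_module_def set_add_def set_mult_def FP_simps)
  also have "\<dots> = cls (c + d)"
  proof (intro equalityI subsetI)
    fix x assume "x \<in> cls (c + d)"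
    then have "x - d \<in> cls c" by (simp add: mem_cls cong_def algebra_simps)
    moreover have "d \<in> cls d" by (simp add: mem_cls)
    moreover have "x = (x - d) + d" by simp
    ultimately show "x \<in> {x + y | x y. x \<in> cls c \<and> y \<in> cls d}" by blast
  qed (auto simp: mem_cls intro: cong_add)
  finally show ?thesis .
qed

text \<open>\<open>quot_module\<close> defines the action as a union over all representatives; all
  cosets in this union coincide.\<close>

lemma BC_smult: "s \<in> S \<Longrightarrow> s \<odot>\<^bsub>BC\<^esub> cls c = cls (scale s c)"
proof -
  assume s: "s \<in> S"
  have "s \<odot>\<^bsub>BC\<^esub> cls c = (\<Union>x\<in>cls c. cls (scale s x))"
    by (simp add: base_change_def quot_module_def FP_simps cls_def)
  also have "\<dots> = (\<Union>x\<in>cls c. cls (scale s c))"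
    by (intro SUP_cong refl) (simp add: cls_eq_iff mem_cls cong_scale s)
  also have "\<dots> = cls (scale s c)" using mem_cls[of c c] by auto
  finally show ?thesis .
qed

lemma pure_tensor_eq: "pure_tensor R S \<phi> M m b = cls (frag_of (m, b))"
  by (simp add: pure_tensor_def cls_def)

lemma abelian_group_BC: "abelian_group BC"
proof (rule abelian_groupI, unfold carrier_BC BC_zero)
  fix x assume "x \<in> cls ` chains"
  then obtain c where "c \<in> chains" "x = cls c" by blast
  then have "cls (- c) \<oplus>\<^bsub>BC\<^esub> x = cls 0" "cls (- c) \<in> cls ` chains"
    by (auto simp: BC_add intro: chains_uminus)
  then show "\<exists>y\<in>cls ` chains. y \<oplus>\<^bsub>BC\<^esub> x = cls 0" by blast
qed (auto simp: BC_add add_ac intro!: chains_0 chains_add)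

lemma finsum_BC:
  assumes "finite I" "\<And>i. i \<in> I \<Longrightarrow> c i \<in> chains"
  shows "finsum BC (\<lambda>i. cls (c i)) I = cls (sum c I)"
proof -
  interpret abelian_group BC by (rule abelian_group_BC)
  show ?thesis using assms
  proof (induction I)
    case (insert i I)
    have "cls (c j) \<in> carrier BC" if "j \<in> insert i I" for j
      using insert.prems[OF that] by (auto simp: carrier_BC)
    then show ?case using insert by (simp add: finsum_insert Pi_iff BC_add)
  qed (simp add: BC_zero)
qed

text \<open>The additive extension of \<open>g\<close> to the free abelian group with values in the
  field, where \<open>frag_extend\<close> would take values in a free group.\<close>

definition lift_sum :: "('m \<times> 'a \<Rightarrow> 'a) \<Rightarrow> (('m \<times> 'a) \<Rightarrow>\<^sub>0 int) \<Rightarrow> 'a" where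
  "lift_sum g c = (\<Sum>p\<in>Poly_Mapping.keys c. of_int (Poly_Mapping.lookup c p) * g p)"

lemma lift_sum_superset:
  "finite K \<Longrightarrow> Poly_Mapping.keys c \<subseteq> K \<Longrightarrow> lift_sum g c = (\<Sum>p\<in>K. of_int (Poly_Mapping.lookup c p) * g p)"
  unfolding lift_sum_def by (intro sum.mono_neutral_left) (auto simp: in_keys_iff)

lemma lift_sum_add: "lift_sum g (c + d) = lift_sum g c + lift_sum g d"
proof -
  define K where "K = Poly_Mapping.keys c \<union> Poly_Mapping.keys d"
  have "finite K" "Poly_Mapping.keys c \<subseteq> K" "Poly_Mapping.keys d \<subseteq> K" "Poly_Mapping.keys (c + d) \<subseteq> K"
    using keys_add[of c d] by (auto simp: K_def)
  then show ?thesis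
    by (simp add: lift_sum_superset[of K] lookup_add distrib_right sum.distrib)
qed

lemma lift_sum_uminus: "lift_sum g (- c) = - lift_sum g c"
  by (simp add: lift_sum_def sum_negf)

lemma lift_sum_diff: "lift_sum g (c - d) = lift_sum g c - lift_sum g d"
  using lift_sum_add[of g c "- d"] lift_sum_uminus[of g d] by simp

lemma lift_sum_0: "lift_sum g 0 = 0"
  by (simp add: lift_sum_def)

lemma lift_sum_of: "lift_sum g (frag_of p) = g p"
  by (simp add: lift_sum_def)

lemma lift_sum_sum: "lift_sum g (sum c I) = (\<Sum>i\<in>I. lift_sum g (c i))"
  by (induction I rule: infinite_finite_induct) (simp_all add: lift_sum_add lift_sum_0)

text \<open>The universal property for a semilinear functional \<open>u\<close>: the value
  \<open>b * u m\<close> depends on the tensor only, because every relator is sent to 0.\<close>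

lemma lift_sum_cong:
  assumes "\<And>m n. m \<in> carrier M \<Longrightarrow> n \<in> carrier M \<Longrightarrow> u (m \<oplus>\<^bsub>M\<^esub> n) = u m + u n"
    and "\<And>a m. a \<in> R \<Longrightarrow> m \<in> carrier M \<Longrightarrow> u (a \<odot>\<^bsub>M\<^esub> m) = \<phi> a * u m"
    and "x \<sim>\<^sub>T y"
  shows "lift_sum (\<lambda>(m, b). b * u m) x = lift_sum (\<lambda>(m, b). b * u m) y"
proof -
  have "lift_sum (\<lambda>(m, b). b * u m) t = 0" if "t \<in> T" for t
    using that
  proof (induction rule: T_induct)
    case (relator x)
    then show ?case
    proof (cases rule: relatorE)
      case (3 a m b)
      then show ?thesis by (simp add: lift_sum_diff lift_sum_of assms(2) mult.left_commute mult.assoc)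
    qed (simp_all add: lift_sum_diff lift_sum_of assms(1) distrib_left distrib_right)
  qed (simp_all add: lift_sum_add lift_sum_uminus lift_sum_0)
  then show ?thesis using assms(3) by (fastforce simp: cong_def lift_sum_diff)
qed

text \<open>Pure tensors generate the tensor product additively, so a set of vectors closed under
  differences that contains their images contains the whole image.\<close>

lemma additive_image_BC:
  assumes h: "\<And>x y. x \<in> carrier BC \<Longrightarrow> y \<in> carrier BC \<Longrightarrow> h (x \<oplus>\<^bsub>BC\<^esub> y) = h x + h y"
    and h_vec: "\<And>x. x \<in> carrier BC \<Longrightarrow> h x \<in> carrier_vec r"
    and Q: "Q \<subseteq> carrier_vec r" "0\<^sub>v r \<in> Q" "\<And>v w. v \<in> Q \<Longrightarrow> w \<in> Q \<Longrightarrow> v - w \<in> Q"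
    and pure: "\<And>m b. m \<in> carrier M \<Longrightarrow> b \<in> S \<Longrightarrow> h (pure_tensor R S \<phi> M m b) \<in> Q"
    and x: "x \<in> carrier BC"
  shows "(h x :: 'b::field vec) \<in> Q"
proof -
  \<comment> \<open>Additivity is given for sums; differences follow from writing \<open>c\<close>
    as \<open>(c - d) + d\<close>.\<close>
  have diff: "h (cls (c - d)) = h (cls c) - h (cls d)" if "c \<in> chains" "d \<in> chains" for c d
  proof -
    have mem: "cls c \<in> carrier BC" "cls d \<in> carrier BC" "cls (c - d) \<in> carrier BC"
      using that chains_diff by (auto simp: carrier_BC)
    have eq: "h (cls c) = h (cls (c - d)) + h (cls d)" using h[OF mem(3,2)] by (simp add: BC_add)
    show ?thesis unfolding eq using h_vec[OF mem(3)] h_vec[OF mem(2)] by (intro eq_vecI) auto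
  qed
  obtain c where c: "c \<in> chains" "x = cls c" using x by (auto simp: carrier_BC)
  have "h (cls c) \<in> Q" using c(1)
  proof (induction rule: chains_induct)
    case zero
    have "h (cls (0 - 0)) = 0\<^sub>v r" unfolding diff[OF chains_0 chains_0]
      using h_vec[of "cls 0"] chains_0 by (auto simp: carrier_BC)
    then show ?case using Q by simp
  qed (use pure diff Q in \<open>auto simp: pure_tensor_eq\<close>)
  then show ?thesis using c by simp
qed

end

text \<open>A linear \<open>f\<close> carries relators to relators, so the union over
  representatives in \<open>base_change_map\<close> collapses to one coset.\<close>

lemma base_change_map_cls:
  assumes M: "tensor_product R S \<phi> M" and N: "tensor_product R S \<phi> N"
    and f: "f \<in> module_homs R M N"
  shows "base_change_map R S \<phi> M N f (tensor_product.cls R S \<phi> M c) =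
    tensor_product.cls R S \<phi> N (frag_extend (\<lambda>(m, b). frag_of (f m, b)) c)"
proof -
  interpret M: tensor_product R S \<phi> M by (rule M)
  interpret N: tensor_product R S \<phi> N by (rule N)
  define F where "F = frag_extend (\<lambda>(m, b). frag_of (f m, b :: 'a))"
  have fM: "f m \<in> carrier N" "f (m \<oplus>\<^bsub>M\<^esub> n) = f m \<oplus>\<^bsub>N\<^esub> f n" if "m \<in> carrier M" "n \<in> carrier M" for m n
    using f that by (auto simp: module_homs_def)
  have fs: "f (a \<odot>\<^bsub>M\<^esub> m) = a \<odot>\<^bsub>N\<^esub> f m" if "m \<in> carrier M" "a \<in> R" for m a
    using f that by (auto simp: module_homs_def)
  have T: "F t \<in> N.T" if "t \<in> M.T" for t
    using that
  proof (induction rule: M.T_induct)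
    case (relator x)
    have "F x \<in> N.relators"
      using relator
    proof (cases rule: M.relatorE)
      case (1 m n b)
      then show ?thesis using fM[of m m] fM[of n n] fM[of m n] N.relatorI(1)[of "f m" "f n" b]
        by (simp add: F_def frag_extend_diff)
    next
      case (2 m b c)
      then show ?thesis using fM[of m m] N.relatorI(2)[of "f m" b c] by (simp add: F_def frag_extend_diff)
    next
      case (3 a m b)
      then show ?thesis using fM[of m m] fs[of m a] N.relatorI(3)[of a "f m" b]
        by (simp add: F_def frag_extend_diff)
    qed
    then show ?case using N.relators_T by blast
  qed (auto simp: F_def frag_extend_add frag_extend_minus intro: N.T_0 N.T_add N.T_uminus)
  have "base_change_map R S \<phi> M N f (M.cls c) = (\<Union>x\<in>M.cls c. N.cls (F x))"
    by (simp add: base_change_map_def F_def N.cls_def)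
  also have "\<dots> = (\<Union>x\<in>M.cls c. N.cls (F c))"
  proof (intro SUP_cong refl)
    fix x assume "x \<in> M.cls c"
    then have "F (x - c) \<in> N.T" using T by (simp add: M.mem_cls M.cong_def)
    then show "N.cls (F x) = N.cls (F c)" by (simp add: N.cls_eq_iff N.cong_def F_def frag_extend_diff)
  qed
  also have "\<dots> = N.cls (F c)" using M.mem_cls[of c c] by auto
  finally show ?thesis by (simp add: F_def)
qed

section \<open>A module that becomes free after inverting one element\<close>

locale localized_free_module =
  fixes R :: "'a::field set" and M :: "('a, 'm) module" and f :: 'a and r :: nat
    and e :: "nat \<Rightarrow> ('a, 'm) tensor"
  assumes R: "subring R ambient" and M: "module (ring_on R) M" and f: "f \<in> R" "f \<noteq> 0"
    and basis: "has_basis (fractions R (range (\<lambda>n. f ^ n)))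
      (base_change R (fractions R (range (\<lambda>n. f ^ n))) id M) r e"
begin

abbreviation "Rf \<equiv> fractions R (range (\<lambda>n. f ^ n))"

lemma Rf_iff: "x \<in> Rf \<longleftrightarrow> (\<exists>a n. a \<in> R \<and> x = a / f ^ n)"
  unfolding fractions_def by blast

lemma R_subset_Rf: "R \<subseteq> Rf"
proof
  fix x assume "x \<in> R"
  then have "x \<in> R \<and> x = x / f ^ 0" by simp
  then show "x \<in> Rf" unfolding Rf_iff by blast
qed

lemma subring_Rf: "subring Rf ambient"
  unfolding subring_ambient_iff
proof (intro conjI ballI)
  fix x y assume "x \<in> Rf" "y \<in> Rf"
  then obtain a m b n where x: "a \<in> R" "x = a / f ^ m" and y: "b \<in> R" "y = b / f ^ n"
    unfolding Rf_iff by blast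
  have "x * y = (a * b) / f ^ (m + n)" by (simp add: x y power_add)
  moreover have "a * b \<in> R" by (intro subring_times[OF R] x y)
  ultimately show "x * y \<in> Rf" unfolding Rf_iff by blast
  have "x + y = (a * f ^ n + b * f ^ m) / f ^ (m + n)" using f by (simp add: x y power_add field_simps)
  moreover have "a * f ^ n + b * f ^ m \<in> R"
    by (intro subring_plus[OF R] subring_times[OF R] subring_power[OF R] x y f)
  ultimately show "x + y \<in> Rf" unfolding Rf_iff by blast
next
  fix x assume "x \<in> Rf"
  then obtain a m where x: "a \<in> R" "x = a / f ^ m" unfolding Rf_iff by blast
  then have "- x = (- a) / f ^ m" "- a \<in> R" using subring_uminus[OF R] by auto
  then show "- x \<in> Rf" unfolding Rf_iff by blast
qed (use R_subset_Rf subring_one[OF R] in auto)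

sublocale M: Module.module "ring_on R" M by (rule M)

sublocale tp: tensor_product R Rf id M
  by (rule tensor_product.intro) (use R_subset_Rf subring_Rf in \<open>auto intro: M.smult_closed\<close>)

lemma one_Rf: "1 \<in> Rf"
  by (rule subring_one[OF subring_Rf])

lemma zero_M_T: "frag_of (\<zero>\<^bsub>M\<^esub>, 1) \<in> tp.T"
  using tp.cong_add_left[of "\<zero>\<^bsub>M\<^esub>" "\<zero>\<^bsub>M\<^esub>" 1] one_Rf by (intro tp.cong_double) simp

text \<open>A finite sum of tensors involves finitely many powers of \<open>f\<close> as
  denominators, so one power of \<open>f\<close> moves it into the image of
  \<open>M\<close>.\<close>

lemma clear_denominator:
  assumes "c \<in> tp.chains"
  shows "\<exists>N. \<exists>m\<in>carrier M. tp.cong (tp.scale (f ^ N) c) (frag_of (m, 1))"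
  using assms
proof (induction rule: tp.chains_induct)
  case zero
  show ?case using tp.cong_zeroI'[OF zero_M_T] by (intro exI[of _ 0] bexI[of _ "\<zero>\<^bsub>M\<^esub>"]) (simp_all only: frag_extend_0 M.zero_closed)
next
  case (one m b)
  then obtain a n where a: "a \<in> R" "b = a / f ^ n" unfolding Rf_iff by blast
  have "tp.scale (f ^ n) (frag_of (m, b)) = frag_of (m, id a * 1)" using f by (simp add: a)
  moreover have "tp.cong (frag_of (a \<odot>\<^bsub>M\<^esub> m, 1)) (frag_of (m, id a * 1))"
    using one a one_Rf by (intro tp.cong_smult) auto
  ultimately show ?case using tp.cong_sym tp.M_smult[OF a(1) one(1)] by metis
next
  case (diff c d)
  then obtain N1 m1 N2 m2 where *: "m1 \<in> carrier M" "tp.cong (tp.scale (f ^ N1) c) (frag_of (m1, 1))"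
    "m2 \<in> carrier M" "tp.cong (tp.scale (f ^ N2) d) (frag_of (m2, 1))" by blast
  have fR: "f ^ n \<in> R" "- (f ^ n) \<in> R" "f ^ n \<in> Rf" for n
    using subring_power[OF R f(1)] subring_uminus[OF R] R_subset_Rf by auto
  \<comment> \<open>Numerator over the common denominator \<open>f ^ (N1 + N2)\<close>.\<close>
  define m where "m = (f ^ N2 \<odot>\<^bsub>M\<^esub> m1) \<oplus>\<^bsub>M\<^esub> (- (f ^ N1) \<odot>\<^bsub>M\<^esub> m2)"
  have mem: "f ^ N2 \<odot>\<^bsub>M\<^esub> m1 \<in> carrier M" "- (f ^ N1) \<odot>\<^bsub>M\<^esub> m2 \<in> carrier M"
    using fR * by (auto intro: tp.M_smult)
  have "tp.scale (f ^ (N1 + N2)) (c - d) = tp.scale (f ^ N2) (tp.scale (f ^ N1) c) - tp.scale (f ^ N1) (tp.scale (f ^ N2) d)"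
    using tp.scale_scale[OF diff.hyps(1), of "f ^ N2" "f ^ N1"] tp.scale_scale[OF diff.hyps(2), of "f ^ N1" "f ^ N2"]
    by (simp only: frag_extend_diff power_add[symmetric] add.commute)
  also have "tp.cong \<dots> (tp.scale (f ^ N2) (frag_of (m1, 1)) - tp.scale (f ^ N1) (frag_of (m2, 1)))"
    using * fR by (intro tp.cong_diff tp.cong_scale) auto
  also have "\<dots> = frag_of (m1, id (f ^ N2) * 1) + (- frag_of (m2, f ^ N1))" by simp
  also have "tp.cong \<dots> (frag_of (f ^ N2 \<odot>\<^bsub>M\<^esub> m1, 1) + frag_of (- (f ^ N1) \<odot>\<^bsub>M\<^esub> m2, 1))"
  proof (intro tp.cong_add)
    show "tp.cong (frag_of (m1, id (f ^ N2) * 1)) (frag_of (f ^ N2 \<odot>\<^bsub>M\<^esub> m1, 1))"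
      using fR * one_Rf by (intro tp.cong_sym[OF tp.cong_smult]) auto
    have "tp.cong (- frag_of (m2, f ^ N1)) (frag_of (m2, id (- (f ^ N1)) * 1))"
      using tp.cong_sym[OF tp.cong_uminus_right[OF *(3) fR(3)[of N1]]] by simp
    also have "tp.cong \<dots> (frag_of (- (f ^ N1) \<odot>\<^bsub>M\<^esub> m2, 1))"
      using fR * one_Rf by (intro tp.cong_sym[OF tp.cong_smult]) auto
    finally show "tp.cong (- frag_of (m2, f ^ N1)) (frag_of (- (f ^ N1) \<odot>\<^bsub>M\<^esub> m2, 1))" .
  qed
  also have "tp.cong \<dots> (frag_of (m, 1))"
    unfolding m_def using mem one_Rf by (intro tp.cong_sym[OF tp.cong_add_left])
  finally show ?case using mem unfolding m_def by blast
qed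

lemma smult_finsum_cong:
  assumes "finite I" "\<And>i. i \<in> I \<Longrightarrow> a i \<in> R" "\<And>i. i \<in> I \<Longrightarrow> m i \<in> carrier M"
  shows "tp.cong (frag_of (finsum M (\<lambda>i. a i \<odot>\<^bsub>M\<^esub> m i) I, 1)) (\<Sum>i\<in>I. tp.scale (a i) (frag_of (m i, 1)))"
  using assms
proof (induction I)
  case empty
  show ?case unfolding M.finsum_empty sum.empty by (rule tp.cong_zeroI[OF zero_M_T])
next
  case (insert i I)
  have c: "a j \<odot>\<^bsub>M\<^esub> m j \<in> carrier M" if "j \<in> insert i I" for j using insert.prems that by (intro tp.M_smult)
  have one: "1 \<in> Rf" by (rule subring_one[OF subring_Rf])
  have fin: "finsum M (\<lambda>i. a i \<odot>\<^bsub>M\<^esub> m i) I \<in> carrier M" using c by (intro M.finsum_closed Pi_I) blast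
  have fin_eq: "finsum M (\<lambda>i. a i \<odot>\<^bsub>M\<^esub> m i) (insert i I) = (a i \<odot>\<^bsub>M\<^esub> m i) \<oplus>\<^bsub>M\<^esub> finsum M (\<lambda>i. a i \<odot>\<^bsub>M\<^esub> m i) I"
    using insert.hyps c by (intro M.finsum_insert) auto
  have cong1: "tp.cong (frag_of ((a i \<odot>\<^bsub>M\<^esub> m i) \<oplus>\<^bsub>M\<^esub> finsum M (\<lambda>i. a i \<odot>\<^bsub>M\<^esub> m i) I, 1))
     (frag_of (a i \<odot>\<^bsub>M\<^esub> m i, 1) + frag_of (finsum M (\<lambda>i. a i \<odot>\<^bsub>M\<^esub> m i) I, 1))"
    using c[of i] fin one by (intro tp.cong_add_left) auto
  have cong2: "tp.cong (frag_of (a i \<odot>\<^bsub>M\<^esub> m i, 1) + frag_of (finsum M (\<lambda>i. a i \<odot>\<^bsub>M\<^esub> m i) I, 1))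
     (frag_of (m i, id (a i) * 1) + (\<Sum>i\<in>I. tp.scale (a i) (frag_of (m i, 1))))"
    using insert.prems one by (intro tp.cong_add tp.cong_smult insert.IH) blast+
  have sum_eq: "frag_of (m i, id (a i) * 1) + (\<Sum>i\<in>I. tp.scale (a i) (frag_of (m i, 1)))
      = (\<Sum>i\<in>insert i I. tp.scale (a i) (frag_of (m i, 1)))"
    unfolding sum.insert[OF insert.hyps] by simp
  show ?case using tp.cong_trans[OF cong1 cong2] unfolding fin_eq sum_eq .
qed

text \<open>A basis of the localization is scaled into \<open>M\<close>. A relation among the
  resulting elements maps to one in the localization, hence independence. If inverting
  \<open>f\<close> adds nothing to \<open>R\<close>, they also span; this is phrased through
  arbitrary linear functionals \<open>u\<close> because that is how \<open>lift_sum_cong\<close>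
  reads equations of tensors back in \<open>M\<close>. The coordinates of an embedding will be such
  functionals.\<close>

lemma ex_generators:
  obtains m where "\<And>i. i < r \<Longrightarrow> m i \<in> carrier M"
    "\<And>a. (\<And>i. i < r \<Longrightarrow> a i \<in> R) \<Longrightarrow> finsum M (\<lambda>i. a i \<odot>\<^bsub>M\<^esub> m i) {..<r} = \<zero>\<^bsub>M\<^esub> \<Longrightarrow> \<forall>i<r. a i = 0"
    "\<And>x. Rf \<subseteq> R \<Longrightarrow> x \<in> carrier M \<Longrightarrow> \<exists>b. (\<forall>i<r. b i \<in> R) \<and>
       (\<forall>u. (\<forall>m\<in>carrier M. \<forall>n\<in>carrier M. u (m \<oplus>\<^bsub>M\<^esub> n) = u m + u n) \<and>
         (\<forall>a\<in>R. \<forall>m\<in>carrier M. u (a \<odot>\<^bsub>M\<^esub> m) = a * u m) \<longrightarrow> u x = (\<Sum>i<r. b i * u (m i)))"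
proof -
  have e: "e i \<in> tp.cls ` tp.chains" if "i < r" for i
    using basis that unfolding has_basis_def tp.carrier_BC by blast
  have "\<forall>i\<in>{..<r}. \<exists>c. c \<in> tp.chains \<and> e i = tp.cls c" using e by blast
  from bchoice[OF this] obtain c where c: "\<And>i. i < r \<Longrightarrow> c i \<in> tp.chains" "\<And>i. i < r \<Longrightarrow> e i = tp.cls (c i)" by auto
  have "\<forall>i\<in>{..<r}. \<exists>p. snd p \<in> carrier M \<and> tp.cong (tp.scale (f ^ fst p) (c i)) (frag_of (snd p, 1))"
    using clear_denominator[OF c(1)] by auto
  from bchoice[OF this] obtain p
    where p: "\<And>i. i < r \<Longrightarrow> snd (p i) \<in> carrier M"
      "\<And>i. i < r \<Longrightarrow> tp.cong (tp.scale (f ^ fst (p i)) (c i)) (frag_of (snd (p i), 1))" by auto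
  \<comment> \<open>In the localization \<open>m i\<close> is \<open>s i\<close> times the basis
    element \<open>e i\<close>.\<close>
  define m s where "m i = snd (p i)" and "s i = f ^ fst (p i)" for i
  have m: "m i \<in> carrier M" and sc: "tp.cong (tp.scale (s i) (c i)) (frag_of (m i, 1))" if "i < r" for i
    using p that by (auto simp: m_def s_def)
  have s: "s i \<in> Rf" "s i \<noteq> 0" for i
    using f R_subset_Rf subring_power[OF R f(1)] by (auto simp: s_def)
  have div_s: "x / s i \<in> Rf" if x: "x \<in> Rf" for x i
  proof -
    obtain a n where "a \<in> R" "x = a / f ^ n" using x unfolding Rf_iff by blast
    then have "x / s i = a / f ^ (n + fst (p i))" by (simp add: s_def power_add)
    then show ?thesis unfolding Rf_iff using \<open>a \<in> R\<close> by blast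
  qed
  have lincomb: "finsum tp.BC (\<lambda>i. a i \<odot>\<^bsub>tp.BC\<^esub> e i) {..<r} = tp.cls (\<Sum>i<r. tp.scale (a i) (c i))"
    if a: "\<And>i. i < r \<Longrightarrow> a i \<in> Rf" for a
  proof -
    interpret BC: abelian_group tp.BC by (rule tp.abelian_group_BC)
    have "finsum tp.BC (\<lambda>i. a i \<odot>\<^bsub>tp.BC\<^esub> e i) {..<r} = finsum tp.BC (\<lambda>i. tp.cls (tp.scale (a i) (c i))) {..<r}"
      using a c by (intro BC.finsum_cong') (auto simp: tp.BC_smult tp.carrier_BC tp.scale_chains)
    also have "\<dots> = tp.cls (\<Sum>i<r. tp.scale (a i) (c i))"
      using a c by (intro tp.finsum_BC) (auto simp: tp.scale_chains)
    finally show ?thesis .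
  qed
  define coords where "coords x a \<longleftrightarrow>
    a \<in> {..<r} \<rightarrow>\<^sub>E Rf \<and> x = finsum tp.BC (\<lambda>i. a i \<odot>\<^bsub>tp.BC\<^esub> e i) {..<r}" for x a
  have ex1: "\<exists>!a. coords x a" if "x \<in> carrier tp.BC" for x
    unfolding coords_def using bspec[OF conjunct2[OF basis[unfolded has_basis_def]] that] .
  show ?thesis
  proof
    show "m i \<in> carrier M" if "i < r" for i using m that by blast
    show "\<forall>i<r. a i = 0"
      if a: "\<And>i. i < r \<Longrightarrow> a i \<in> R" and fin: "finsum M (\<lambda>i. a i \<odot>\<^bsub>M\<^esub> m i) {..<r} = \<zero>\<^bsub>M\<^esub>" for a
    proof -
      have aRf: "a i \<in> Rf" if "i < r" for i using a that R_subset_Rf by blast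
      have asRf: "a i * s i \<in> Rf" if "i < r" for i using aRf that s by (intro subring_times[OF subring_Rf])
      \<comment> \<open>A relation with coefficients \<open>a i\<close> among the \<open>m i\<close>
        has coefficients \<open>a i * s i\<close> in the basis.\<close>
      have "tp.cong (\<Sum>i<r. tp.scale (a i * s i) (c i)) (\<Sum>i<r. tp.scale (a i) (frag_of (m i, 1)))"
      proof (intro tp.cong_sum)
        fix i assume "i \<in> {..<r}"
        then show "tp.cong (tp.scale (a i * s i) (c i)) (tp.scale (a i) (frag_of (m i, 1)))"
          using tp.cong_scale[OF sc aRf] c by (simp add: tp.scale_scale)
      qed
      also have "tp.cong \<dots> (frag_of (finsum M (\<lambda>i. a i \<odot>\<^bsub>M\<^esub> m i) {..<r}, 1))"
        using a m by (intro tp.cong_sym[OF smult_finsum_cong]) auto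
      also have "tp.cong \<dots> 0" unfolding fin by (rule tp.cong_zeroI[OF zero_M_T])
      finally have z: "tp.cong (\<Sum>i<r. tp.scale (a i * s i) (c i)) 0" .
      have z0: "tp.cong (\<Sum>i<r. tp.scale 0 (c i)) 0"
        using tp.cong_sum[of "{..<r}" "\<lambda>i. tp.scale 0 (c i)" "\<lambda>_. 0", OF tp.scale_zero[OF c(1)]]
        by (simp only: sum.neutral_const lessThan_iff)
      have repr: "tp.cls 0 = finsum tp.BC (\<lambda>i. b i \<odot>\<^bsub>tp.BC\<^esub> e i) {..<r}"
        if b: "\<And>i. i < r \<Longrightarrow> b i \<in> Rf" and bz: "tp.cong (\<Sum>i<r. tp.scale (b i) (c i)) 0" for b
        using lincomb[of b] b bz by (simp add: tp.cls_eq_iff tp.cong_sym)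
      \<comment> \<open>Uniqueness in \<open>has_basis\<close> concerns extensional functions, hence
        the restrictions; \<open>b\<close> and \<open>b0\<close> are both coordinates of the zero
        class.\<close>
      define b where "b = (\<lambda>i\<in>{..<r}. a i * s i)"
      define b0 where "b0 = (\<lambda>i\<in>{..<r}. 0 :: 'a)"
      have bPi: "b \<in> {..<r} \<rightarrow>\<^sub>E Rf" "b0 \<in> {..<r} \<rightarrow>\<^sub>E Rf"
        using asRf subring_zero[OF subring_Rf] by (auto simp: b_def b0_def)
      have "tp.cls 0 = finsum tp.BC (\<lambda>i. b i \<odot>\<^bsub>tp.BC\<^esub> e i) {..<r}"
        using asRf z by (intro repr) (simp_all add: b_def)
      then have "coords (tp.cls 0) b" unfolding coords_def using bPi by blast
      moreover have "tp.cls 0 = finsum tp.BC (\<lambda>i. b0 i \<odot>\<^bsub>tp.BC\<^esub> e i) {..<r}"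
        using subring_zero[OF subring_Rf] z0 by (intro repr) (simp_all add: b0_def)
      then have "coords (tp.cls 0) b0" unfolding coords_def using bPi by blast
      moreover have "tp.cls 0 \<in> carrier tp.BC" using tp.chains_0 unfolding tp.carrier_BC by blast
      ultimately have "b = b0" using ex1[of "tp.cls 0"] by blast
      then have "a i * s i = 0" if "i < r" for i
      proof -
        have "b i = a i * s i" "b0 i = 0" using that by (simp_all add: b_def b0_def)
        then show ?thesis using \<open>b = b0\<close> by simp
      qed
      then show ?thesis using s by auto
    qed
    show "\<exists>b. (\<forall>i<r. b i \<in> R) \<and>
       (\<forall>u. (\<forall>m\<in>carrier M. \<forall>n\<in>carrier M. u (m \<oplus>\<^bsub>M\<^esub> n) = u m + u n) \<and>
         (\<forall>a\<in>R. \<forall>m\<in>carrier M. u (a \<odot>\<^bsub>M\<^esub> m) = a * u m) \<longrightarrow> u x = (\<Sum>i<r. b i * u (m i)))"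
      if "Rf \<subseteq> R" and x: "x \<in> carrier M" for x
    proof -
      have "frag_of (x, 1) \<in> tp.chains" using x one_Rf by (rule tp.chains_of)
      then have "tp.cls (frag_of (x, 1)) \<in> carrier tp.BC" unfolding tp.carrier_BC by (rule imageI)
      from ex1_implies_ex[OF ex1[OF this]] obtain a where "coords (tp.cls (frag_of (x, 1))) a" ..
      note conj = this[unfolded coords_def]
      note xa = conjunct2[OF conj]
      have a: "a i \<in> Rf" if "i < r" for i using PiE_mem[OF conjunct1[OF conj], of i] that by simp
      \<comment> \<open>Passage from coordinates in the basis \<open>e\<close> back to the
        generators \<open>m\<close>.\<close>
      define b where "b i = a i / s i" for i
      have b: "b i \<in> Rf" if "i < r" for i using div_s[OF a[OF that]] by (simp add: b_def)
      have "tp.cong (frag_of (x, 1)) (\<Sum>i<r. tp.scale (a i) (c i))"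
        using xa lincomb[OF a] by (simp add: tp.cls_eq_iff)
      also have "tp.cong \<dots> (\<Sum>i<r. frag_of (m i, b i))"
      proof (intro tp.cong_sum)
        fix i assume i: "i \<in> {..<r}"
        then have "tp.cong (tp.scale (b i) (tp.scale (s i) (c i))) (tp.scale (b i) (frag_of (m i, 1)))"
          using sc b by (intro tp.cong_scale) auto
        moreover have "tp.scale (b i) (tp.scale (s i) (c i)) = tp.scale (a i) (c i)"
          using tp.scale_scale[OF c(1), of i "b i" "s i"] i s(2)[of i] by (simp add: b_def)
        moreover have "tp.scale (b i) (frag_of (m i, 1)) = frag_of (m i, b i)" by simp
        ultimately show "tp.cong (tp.scale (a i) (c i)) (frag_of (m i, b i))" by (simp only:)
      qed
      finally have cong: "tp.cong (frag_of (x, 1)) (\<Sum>i<r. frag_of (m i, b i))" .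
      have "u x = (\<Sum>i<r. b i * u (m i))"
        if "\<forall>m\<in>carrier M. \<forall>n\<in>carrier M. u (m \<oplus>\<^bsub>M\<^esub> n) = u m + u n"
          "\<forall>a\<in>R. \<forall>m\<in>carrier M. u (a \<odot>\<^bsub>M\<^esub> m) = a * u m" for u
        using tp.lift_sum_cong[of u, OF _ _ cong] that by (simp add: tp.lift_sum_sum tp.lift_sum_of)
      moreover have "\<forall>i<r. b i \<in> R" using b \<open>Rf \<subseteq> R\<close> by blast
      ultimately show ?thesis by blast
    qed
  qed
qed

end

section \<open>Transcendental elements of the coordinate ring\<close>

lemma ambient_nat_pow: "x [^]\<^bsub>ambient\<^esub> (n::nat) = x ^ n"
  by (induction n) (simp_all add: mult.commute)

lemma ambient_eval: "ambient.eval p x = (\<Sum>i<length p. rev p ! i * x ^ i)"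
proof (induction p)
  case (Cons a p)
  have "(\<Sum>i<length p. (rev p @ [a]) ! i * x ^ i) = (\<Sum>i<length p. rev p ! i * x ^ i)"
    by (intro sum.cong) (auto simp: nth_append)
  then show ?case using Cons by (simp add: ambient_nat_pow nth_append)
qed simp

text \<open>Meant for subrings as well as subfields. The top coefficient may vanish, so a relation
  can be padded or rescaled without normalizing its degree.\<close>

definition algebraic_over :: "'a::field set \<Rightarrow> 'a \<Rightarrow> bool" where
  "algebraic_over K x \<longleftrightarrow> (\<exists>n c. (\<forall>i<n. c i \<in> K) \<and> (\<exists>i<n. c i \<noteq> 0) \<and> (\<Sum>i<n. c i * x ^ i) = 0)"

lemma last_nonzero:
  fixes c :: "nat \<Rightarrow> 'a::zero"
  assumes "i < n" "c i \<noteq> 0"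
  obtains m where "m < n" "c m \<noteq> 0" "\<And>j. m < j \<Longrightarrow> j < n \<Longrightarrow> c j = 0"
proof -
  define I where "I = {i. i < n \<and> c i \<noteq> 0}"
  have fin: "finite I" "I \<noteq> {}" using assms by (auto simp: I_def)
  have "Max I \<in> I" using fin by (rule Max_in)
  moreover have "c j = 0" if "Max I < j" "j < n" for j
  proof (rule ccontr)
    assume "c j \<noteq> 0"
    then have "j \<le> Max I" using fin that by (intro Max_ge) (auto simp: I_def)
    then show False using that by simp
  qed
  moreover from \<open>Max I \<in> I\<close> have "Max I < n" "c (Max I) \<noteq> 0" by (auto simp: I_def)
  ultimately show ?thesis by (intro that)
qed

lemma not_transcendental_iff:
  assumes K: "subring K ambient"
  shows "\<not> ambient.transcendental K x \<longleftrightarrow> algebraic_over K x"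
proof
  assume "\<not> ambient.transcendental K x"
  then obtain p where p: "p \<in> carrier (univ_poly ambient K)" "p \<noteq> []" "ambient.eval p x = 0"
    using ambient.algebraicE[OF K, of x] by (auto simp: over_def)
  then have set: "set p \<subseteq> K" "hd p \<noteq> 0" by (auto simp: univ_poly_def polynomial_def)
  have nth: "rev p ! i \<in> set p" if "i < length p" for i using that nth_mem[of i "rev p"] by simp
  have "rev p ! (length p - 1) = hd p" using p(2) by (simp add: rev_nth hd_conv_nth)
  then have "\<exists>i<length p. rev p ! i \<noteq> 0" using set p(2) by (intro exI[of _ "length p - 1"]) auto
  then show "algebraic_over K x"
    unfolding algebraic_over_def using p(3) nth set ambient_eval[of p x]
    by (intro exI[of _ "length p"] exI[of _ "\<lambda>i. rev p ! i"]) auto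
next
  assume "algebraic_over K x"
  then obtain n c i where c: "\<forall>i<n. c i \<in> K" "i < n" "c i \<noteq> 0" "(\<Sum>i<n. c i * x ^ i) = 0"
    unfolding algebraic_over_def by blast
  obtain m where m: "m < n" "c m \<noteq> 0" and above: "\<And>j. m < j \<Longrightarrow> j < n \<Longrightarrow> c j = 0"
    using last_nonzero[of i n c, OF c(2,3)] by blast
  \<comment> \<open>List polynomials start with a nonzero leading coefficient, so the relation is
    cut at its last nonzero index and reversed.\<close>
  define p where "p = rev (map c [0..<Suc m])"
  have len: "length p = Suc m" by (simp add: p_def)
  have "ambient.eval p x = (\<Sum>i<Suc m. c i * x ^ i)"
    unfolding ambient_eval len by (intro sum.cong) (simp_all add: p_def del: upt_Suc)
  also have "\<dots> = (\<Sum>i<n. c i * x ^ i)"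
    using m above by (intro sum.mono_neutral_left) auto
  finally have "ambient.eval p x = 0" using c by simp
  moreover have "p \<noteq> []" "hd p = c m" by (simp_all add: p_def)
  moreover have "set p \<subseteq> K" using c m by (auto simp: p_def)
  ultimately show "\<not> ambient.transcendental K x"
    using m ambient.algebraicI[of p K x] by (simp add: univ_poly_def polynomial_def over_def)
qed

lemma algebraic_over_common_denominator:
  assumes "subring S ambient" "algebraic_over (fractions S (S - {0})) x"
  shows "algebraic_over S x"
proof -
  obtain n c i where c: "\<forall>i<n. c i \<in> fractions S (S - {0})" "i < n" "c i \<noteq> 0" "(\<Sum>i<n. c i * x ^ i) = 0"
    using assms(2) unfolding algebraic_over_def by blast
  have "\<forall>i\<in>{..<n}. \<exists>t. t \<in> S \<and> t \<noteq> 0 \<and> t * c i \<in> S"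
  proof
    fix i assume "i \<in> {..<n}"
    then obtain a t where "a \<in> S" "t \<in> S - {0}" "c i = a / t" using c unfolding fractions_def by blast
    then show "\<exists>t. t \<in> S \<and> t \<noteq> 0 \<and> t * c i \<in> S" by (intro exI[of _ t]) auto
  qed
  from bchoice[OF this] obtain t where t: "\<forall>i\<in>{..<n}. t i \<in> S \<and> t i \<noteq> 0 \<and> t i * c i \<in> S" by blast
  \<comment> \<open>The product of the individual denominators clears all coefficients at
    once.\<close>
  define s where "s = (\<Prod>i<n. t i)"
  have s: "s \<noteq> 0" using t by (simp add: s_def)
  have sc: "s * c j \<in> S" if "j < n" for j
  proof -
    have "s = t j * (\<Prod>i\<in>{..<n} - {j}. t i)" unfolding s_def using that by (intro prod.remove) auto
    then have "s * c j = (t j * c j) * (\<Prod>i\<in>{..<n} - {j}. t i)" by (simp add: ac_simps)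
    also have "\<dots> \<in> S"
      using t that by (intro subring_times[OF assms(1) _ subring_prod[OF assms(1)]]) auto
    finally show ?thesis .
  qed
  have "(\<Sum>i<n. (s * c i) * x ^ i) = 0" using c(4) by (simp add: mult.assoc flip: sum_distrib_left)
  moreover have "s * c i \<noteq> 0" using s c by simp
  ultimately show ?thesis unfolding algebraic_over_def using sc c(2)
    by (intro exI[of _ n] exI[of _ "\<lambda>i. s * c i"]) blast
qed

definition adjoin :: "'a::field set \<Rightarrow> 'a \<Rightarrow> 'a set" where
  "adjoin K x = {\<Sum>i<n. c i * x ^ i | (n::nat) c. \<forall>i<n. c i \<in> K}"

lemma adjoin_subset: "subring S ambient \<Longrightarrow> K \<subseteq> S \<Longrightarrow> x \<in> S \<Longrightarrow> adjoin K x \<subseteq> S"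
  unfolding adjoin_def by (auto intro!: subring_sum subring_times subring_power)

text \<open>Makes \<open>compositum_induct\<close> available for polynomial expressions in
  \<open>x\<close>.\<close>

lemma adjoin_eq_compositum:
  assumes "subring K ambient"
  shows "adjoin K x = compositum K (range (\<lambda>n. x ^ n))"
proof (intro equalityI subsetI)
  fix y assume "y \<in> adjoin K x"
  then obtain n :: nat and c where "y = (\<Sum>i<n. c i * x ^ i)" "\<forall>i<n. c i \<in> K" unfolding adjoin_def by blast
  then show "y \<in> compositum K (range (\<lambda>n. x ^ n))"
    unfolding compositum_def by (intro CollectI exI[of _ n] exI[of _ c] exI[of _ "\<lambda>i. x ^ i"]) auto
next
  fix y assume "y \<in> compositum K (range (\<lambda>n. x ^ n))"
  then show "y \<in> adjoin K x"
  proof (induction rule: compositum_induct)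
    case zero
    show ?case unfolding adjoin_def by (rule CollectI, rule exI[of _ 0]) auto
  next
    case (tensor y s b)
    then obtain n :: nat and c where c: "y = (\<Sum>i<n. c i * x ^ i)" "\<forall>i<n. c i \<in> K" unfolding adjoin_def by blast
    obtain m where m: "b = x ^ m" using tensor by blast
    \<comment> \<open>Adding the monomial \<open>s * x ^ m\<close> may exceed the old length, so
      both are padded to length \<open>n + Suc m\<close>.\<close>
    define d where "d i = (if i < n then c i else 0) + (if i = m then s else 0)" for i
    have z: "0 \<in> K" by (rule subring_zero[OF assms])
    have "(\<Sum>i<n + Suc m. d i * x ^ i)
        = (\<Sum>i<n + Suc m. (if i < n then c i * x ^ i else 0)) + (\<Sum>i<n + Suc m. (if i = m then s * x ^ i else 0))"
      unfolding sum.distrib[symmetric] by (intro sum.cong) (auto simp: d_def distrib_right)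
    also have "(\<Sum>i<n + Suc m. (if i = m then s * x ^ i else 0)) = s * x ^ m" by (subst sum.delta) auto
    also have "(\<Sum>i<n + Suc m. (if i < n then c i * x ^ i else 0)) = y"
      unfolding c by (rule sum.mono_neutral_cong_right) auto
    finally have "y + s * b = (\<Sum>i<n + Suc m. d i * x ^ i)" by (simp add: m)
    moreover have "\<forall>i<n + Suc m. d i \<in> K" using c tensor(2) z subring_plus[OF assms] by (auto simp: d_def)
    ultimately show ?case unfolding adjoin_def by blast
  qed
qed

lemma subring_adjoin:
  assumes "subring K ambient"
  shows "subring (adjoin K x) ambient" and "K \<subseteq> adjoin K x" and "x \<in> adjoin K x"
proof -
  have one: "y = y * x ^ 0" for y by simp
  have mem: "s * x ^ m \<in> adjoin K x" if "s \<in> K" for s m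
    unfolding adjoin_eq_compositum[OF assms]
    using compositum_add_tensor[OF compositum_0 that, of "x ^ m"] by simp
  show K: "K \<subseteq> adjoin K x" using mem[of _ 0] by auto
  show "x \<in> adjoin K x" using mem[OF subring_one[OF assms], of 1] by simp
  have add: "y + z \<in> adjoin K x" if "y \<in> adjoin K x" "z \<in> adjoin K x" for y z
    using that unfolding adjoin_eq_compositum[OF assms] by (rule compositum_add)
  have zero: "0 \<in> adjoin K x" using K subring_zero[OF assms] by blast
  have tens: "y * (s * x ^ m) \<in> adjoin K x" if "y \<in> adjoin K x" "s \<in> K" for y s m
    using that unfolding adjoin_eq_compositum[OF assms]
  proof (induction rule: compositum_induct)
    case zero
    then show ?case by (simp add: compositum_0)
  next
    case (tensor y t b)
    then obtain n where n: "b = x ^ n" by blast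
    have "(y + t * b) * (s * x ^ m) = y * (s * x ^ m) + (t * s) * x ^ (n + m)"
      by (simp add: n power_add algebra_simps)
    then show ?case using tensor subring_times[OF assms] by (simp add: compositum_add_tensor)
  qed
  have mult: "y * z \<in> adjoin K x" if "z \<in> adjoin K x" "y \<in> adjoin K x" for y z
  proof -
    have "z \<in> compositum K (range (\<lambda>n. x ^ n))" using that adjoin_eq_compositum[OF assms] by blast
    then show ?thesis
    proof (induction rule: compositum_induct)
      case (tensor z s b)
      then show ?case using add tens[OF that(2)] by (auto simp: distrib_left)
    qed (simp add: zero)
  qed
  have "- y \<in> adjoin K x" if "y \<in> adjoin K x" for y
    using tens[OF that subring_uminus[OF assms subring_one[OF assms]], of 0] by simp
  then show "subring (adjoin K x) ambient"
    unfolding subring_ambient_iff using add mult K subring_one[OF assms] by blast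
qed

lemma subfield_fractions:
  assumes S: "subring S ambient"
  shows "subfield (fractions S (S - {0})) ambient" and "S \<subseteq> fractions S (S - {0})"
proof -
  show sub: "S \<subseteq> fractions S (S - {0})"
  proof
    fix x assume "x \<in> S"
    then have "x / 1 \<in> fractions S (S - {0})" using subring_one[OF S] by (intro fractionsI) auto
    then show "x \<in> fractions S (S - {0})" by simp
  qed
  have iff: "x \<in> fractions S (S - {0}) \<longleftrightarrow> (\<exists>a b. a \<in> S \<and> b \<in> S \<and> b \<noteq> 0 \<and> x = a / b)" for x
    unfolding fractions_def by blast
  show "subfield (fractions S (S - {0})) ambient"
    unfolding subfield_ambient_iff subring_ambient_iff
  proof (intro conjI ballI)
    fix x y assume "x \<in> fractions S (S - {0})" "y \<in> fractions S (S - {0})"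
    then obtain a b c d where *: "a \<in> S" "b \<in> S" "b \<noteq> 0" "x = a / b" "c \<in> S" "d \<in> S" "d \<noteq> 0" "y = c / d"
      unfolding iff by blast
    have "x * y = (a * c) / (b * d)" "x + y = (a * d + c * b) / (b * d)" using * by (simp_all add: field_simps)
    moreover have "a * c \<in> S" "a * d + c * b \<in> S" "b * d \<in> S" "b * d \<noteq> 0"
      using * by (auto intro: subring_times[OF S] subring_plus[OF S])
    ultimately show "x * y \<in> fractions S (S - {0})" "x + y \<in> fractions S (S - {0})" unfolding iff by blast+
  next
    fix x assume "x \<in> fractions S (S - {0})"
    then obtain a b where *: "a \<in> S" "b \<in> S" "b \<noteq> 0" "x = a / b" unfolding iff by blast
    then have "- x = (- a) / b" "- a \<in> S" using subring_uminus[OF S] by auto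
    then show "- x \<in> fractions S (S - {0})" unfolding iff using * by blast
    show "inverse x \<in> fractions S (S - {0})"
    proof (cases "a = 0")
      case True
      then show ?thesis using * sub subring_zero[OF S] by auto
    next
      case False
      have "inverse x = b / a" using * by simp
      then show ?thesis unfolding iff using * False by blast
    qed
  qed (use sub subring_one[OF S] in blast)
qed

lemma generate_field_subset_fractions:
  assumes "subring K ambient"
  shows "generate_field ambient (insert x K) \<subseteq> fractions (adjoin K x) (adjoin K x - {0})"
proof (rule field.generate_field_min_subfield1[OF field_from_type_algebra])
  note sub = subfield_fractions[OF subring_adjoin(1)[OF assms, of x]]
  show "subfield (fractions (adjoin K x) (adjoin K x - {0})) ambient" by (rule sub)
  show "insert x K \<subseteq> fractions (adjoin K x) (adjoin K x - {0})"
    using sub(2) subring_adjoin(2,3)[OF assms, of x] by blast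
qed simp

text \<open>The exchange property: reading a polynomial relation between \<open>x\<close> and \<open>t\<close> as one for \<open>t\<close>
  over \<open>K[x]\<close>.\<close>

lemma algebraic_over_exchange:
  assumes K: "subring K ambient" and x: "\<not> algebraic_over K x" and "algebraic_over (adjoin K t) x"
  shows "algebraic_over (adjoin K x) t"
proof -
  obtain n c i0 where c: "\<forall>i<n. c i \<in> adjoin K t" "i0 < n" "c i0 \<noteq> 0" "(\<Sum>i<n. c i * x ^ i) = 0"
    using assms(3) unfolding algebraic_over_def by blast
  have "\<forall>i\<in>{..<n}. \<exists>p. (\<forall>j<fst p. snd p j \<in> K) \<and> c i = (\<Sum>j<fst p. snd p j * t ^ j)"
  proof
    fix i assume "i \<in> {..<n}"
    then have "c i \<in> adjoin K t" using c by simp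
    then obtain m :: nat and d where "c i = (\<Sum>j<m. d j * t ^ j)" "\<forall>j<m. d j \<in> K"
      unfolding adjoin_def by blast
    then show "\<exists>p. (\<forall>j<fst p. snd p j \<in> K) \<and> c i = (\<Sum>j<fst p. snd p j * t ^ j)"
      by (intro exI[of _ "(m, d)"]) simp
  qed
  from bchoice[OF this] obtain p
    where p: "\<forall>i\<in>{..<n}. (\<forall>j<fst (p i). snd (p i) j \<in> K) \<and> c i = (\<Sum>j<fst (p i). snd (p i) j * t ^ j)"
    by blast
  \<comment> \<open>A common degree bound in \<open>t\<close>, so that the double sum can be
    reordered by powers of \<open>t\<close>.\<close>
  define N where "N = (\<Sum>i<n. fst (p i))"
  define d where "d i j = (if j < fst (p i) then snd (p i) j else 0)" for i j
  have le: "fst (p i) \<le> N" if "i < n" for i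
    unfolding N_def using that by (intro member_le_sum) auto
  have dK: "d i j \<in> K" if "i < n" for i j using p that subring_zero[OF K] by (auto simp: d_def)
  have ci: "c i = (\<Sum>j<N. d i j * t ^ j)" if "i < n" for i
  proof -
    have "c i = (\<Sum>j<fst (p i). snd (p i) j * t ^ j)" using p that by blast
    also have "\<dots> = (\<Sum>j<N. d i j * t ^ j)"
      using le[OF that] by (intro sum.mono_neutral_cong_left) (auto simp: d_def)
    finally show ?thesis .
  qed
  define e where "e j = (\<Sum>i<n. d i j * x ^ i)" for j
  have "(\<Sum>j<N. e j * t ^ j) = (\<Sum>j<N. \<Sum>i<n. d i j * t ^ j * x ^ i)"
    unfolding e_def sum_distrib_right by (intro sum.cong refl) (simp add: ac_simps)
  also have "\<dots> = (\<Sum>i<n. \<Sum>j<N. d i j * t ^ j * x ^ i)" by (rule sum.swap)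
  also have "\<dots> = (\<Sum>i<n. c i * x ^ i)" by (intro sum.cong) (simp_all add: ci sum_distrib_right)
  finally have "(\<Sum>j<N. e j * t ^ j) = 0" using c by simp
  moreover have "e j \<in> adjoin K x" for j unfolding e_def adjoin_def
    by (intro CollectI exI[of _ n] exI[of _ "\<lambda>i. d i j"] conjI refl) (use dK in blast)
  \<comment> \<open>If all new coefficients vanished, transcendence of \<open>x\<close> would kill
    every \<open>d i j\<close>, and with them \<open>c i0\<close>.\<close>
  moreover have "\<exists>j<N. e j \<noteq> 0"
  proof (rule ccontr)
    assume "\<not> (\<exists>j<N. e j \<noteq> 0)"
    then have e0: "(\<Sum>i<n. d i j * x ^ i) = 0" if "j < N" for j using that by (simp add: e_def)
    have "d i j = 0" if "i < n" "j < N" for i j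
    proof (rule ccontr)
      assume "d i j \<noteq> 0"
      then have "algebraic_over K x"
        unfolding algebraic_over_def using dK e0[OF that(2)] that(1)
        by (intro exI[of _ n] exI[of _ "\<lambda>i. d i j"]) auto
      then show False using x by blast
    qed
    then have "c i0 = 0" using ci[OF c(2)] c(2) by simp
    then show False using c by simp
  qed
  ultimately show ?thesis unfolding algebraic_over_def by blast
qed

section \<open>Denominators of functions in the coordinate ring\<close>

context curve
begin

text \<open>The field is finite over the rational function field in some \<open>t\<close>. Exchange
  makes \<open>t\<close> algebraic over the fractions of \<open>adjoin k x\<close>, and a tower of
  finite extensions reaches \<open>y\<close>.\<close>

lemma algebraic_over_adjoin:
  assumes x: "x \<in> F" "\<not> algebraic_over k x" and y: "y \<in> F"
  shows "algebraic_over (adjoin k x) y"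
proof -
  obtain t where t: "t \<in> F" "ambient.finite_dimension (generate_field ambient (insert t k)) F"
    using setting unfolding curve_setting_def by blast
  define k1 where "k1 = generate_field ambient (insert t k)"
  define k2 where "k2 = fractions (adjoin k x) (adjoin k x - {0})"
  have k1: "subfield k1 ambient" unfolding k1_def
    by (rule field.generate_field_is_subfield[OF field_from_type_algebra]) simp
  note S2 = subring_adjoin[OF subrings(1), of x]
  have k2: "subfield k2 ambient" "adjoin k x \<subseteq> k2" unfolding k2_def by (rule subfield_fractions[OF S2(1)])+
  have alg1: "algebraic_over k1 z" if "z \<in> F" for z
    using ambient.finite_dimension_imp_algebraic[OF k1 subrings(2) t(2)[folded k1_def] that]
      not_transcendental_iff[OF subfieldE(1)[OF k1], of z] by (simp add: over_def)
  have mono: "algebraic_over K' z" if "K \<subseteq> K'" "algebraic_over K z" for K K' z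
    using that unfolding algebraic_over_def by blast
  have "algebraic_over (fractions (adjoin k t) (adjoin k t - {0})) x"
    using mono[OF generate_field_subset_fractions[OF subrings(1)] alg1[OF x(1), unfolded k1_def]] .
  then have "algebraic_over (adjoin k t) x"
    by (rule algebraic_over_common_denominator[OF subring_adjoin(1)[OF subrings(1)]])
  then have "algebraic_over (adjoin k x) t" by (rule algebraic_over_exchange[OF subrings(1) x(2)])
  then have tk2: "\<not> ambient.transcendental k2 t"
    using mono[OF k2(2)] not_transcendental_iff k2(1) subfield_ambient_iff by blast
  \<comment> \<open>This field is finite over \<open>k2\<close> and contains \<open>k1\<close>, over
    which \<open>y\<close> is algebraic.\<close>
  define k3 where "k3 = ambient.simple_extension k2 t"
  have k3: "subfield k3 ambient" unfolding k3_def
    using ambient.simple_extension_is_subfield[OF k2(1), of t] tk2 by (simp add: over_def)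
  have fin3: "ambient.finite_dimension k2 k3" unfolding k3_def
    using ambient.finite_dimension_simple_extension[OF k2(1), of t] tk2 by (simp add: over_def)
  have "k2 \<subseteq> k3" unfolding k3_def by (rule ambient.simple_extension_incl) auto
  moreover have "t \<in> k3" unfolding k3_def
    using ambient.simple_extension_mem[of k2 t] k2(1) by (simp add: subfield_ambient_iff)
  ultimately have "insert t k \<subseteq> k3" using S2(2) k2(2) by blast
  then have "k1 \<subseteq> k3" unfolding k1_def
    by (intro field.generate_field_min_subfield1[OF field_from_type_algebra _ k3]) auto
  then have yk3: "\<not> ambient.transcendental k3 y"
    using mono[OF _ alg1[OF y]] not_transcendental_iff k3 subfield_ambient_iff by blast
  have "ambient.finite_dimension k3 (ambient.simple_extension k3 y)"
    using ambient.finite_dimension_simple_extension[OF k3, of y] yk3 by (simp add: over_def)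
  then have "ambient.finite_dimension k2 (ambient.simple_extension k3 y)"
    by (rule ambient.telescopic_base_dim(1)[OF k2(1) k3 fin3])
  moreover have "subring (ambient.simple_extension k3 y) ambient"
    using ambient.simple_extension_is_subring[of k3 y] k3 by (simp add: subfield_ambient_iff)
  moreover have "y \<in> ambient.simple_extension k3 y"
    using ambient.simple_extension_mem[of k3 y] k3 by (simp add: subfield_ambient_iff)
  ultimately have "\<not> ambient.transcendental k2 y"
    using ambient.finite_dimension_imp_algebraic[OF k2(1)] by (simp add: over_def)
  then have "algebraic_over k2 y" using not_transcendental_iff k2(1) subfield_ambient_iff by blast
  then show ?thesis unfolding k2_def by (rule algebraic_over_common_denominator[OF S2(1)])
qed

text \<open>Valuation rings are integrally closed: if \<open>z\<close> were outside
  \<open>P\<close>, its inverse would be inside, and dividing the equation by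
  \<open>z ^ (n - 1)\<close> would express \<open>z\<close> through elements of
  \<open>P\<close>.\<close>

lemma integral_mem_A:
  assumes z: "z \<in> F" and c: "\<And>i. i < n \<Longrightarrow> c i \<in> A" and eq: "z ^ n = (\<Sum>i<n. c i * z ^ i)"
  shows "z \<in> A"
  unfolding coord_ring_def
proof
  fix P assume P: "P \<in> curve_points k F - {Oinf D}"
  then have "P \<in> curve_points k F" by blast
  then show "z \<in> P"
  proof (cases rule: curve_points_cases)
    case 1
    then show ?thesis using z by simp
  next
    case (2 w)
    interpret w: discrete_valuation F w by (rule 2)
    show ?thesis
    proof (rule ccontr)
      assume nz: "z \<notin> P"
      then have inv: "inverse z \<in> P" using w.inverse_in_V[OF z] 2 by simp
      have sP: "subring P ambient" using w.subring_V 2 by simp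
      have z0: "z \<noteq> 0" using nz subring_zero[OF sP] by blast
      have "n \<noteq> 0" using eq by (cases n) auto
      have "z = z ^ n * inverse z ^ (n - 1)"
      proof -
        have "z ^ n = z * z ^ (n - 1)" using \<open>n \<noteq> 0\<close> by (cases n) auto
        then show ?thesis using z0 by (simp add: field_simps)
      qed
      also have "\<dots> = (\<Sum>i<n. c i * inverse z ^ (n - 1 - i))"
        unfolding eq sum_distrib_right
      proof (intro sum.cong refl)
        fix i assume "i \<in> {..<n}"
        then have "n - 1 = (n - 1 - i) + i" by simp
        then have "inverse z ^ (n - 1) = inverse z ^ (n - 1 - i) * inverse z ^ i" by (metis power_add)
        then show "c i * z ^ i * inverse z ^ (n - 1) = c i * inverse z ^ (n - 1 - i)"
          using z0 by (simp add: power_inverse field_simps)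
      qed
      also have "\<dots> \<in> P"
        using c P inv unfolding coord_ring_def by (intro subring_sum[OF sP] subring_times[OF sP] subring_power[OF sP]) auto
      finally show False using nz by blast
    qed
  qed
qed

text \<open>If all of \<open>A\<close> is algebraic over \<open>k\<close>, then \<open>A = k\<close>
  because \<open>k\<close> is algebraically closed in \<open>F\<close>. Otherwise every function
  satisfies a polynomial relation over \<open>A\<close>, and its leading coefficient is a
  denominator.\<close>

lemma coord_ring_cases:
  obtains "A = k" | "\<And>y. y \<in> F \<Longrightarrow> \<exists>s\<in>A. s \<noteq> 0 \<and> s * y \<in> A"
proof (cases "\<forall>x\<in>A. algebraic_over k x")
  case True
  have "x \<in> k" if "x \<in> A" for x
    using setting True that A_subset_F not_transcendental_iff[OF subrings(1), of x]
    unfolding curve_setting_def by blast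
  then have "A = k" using k_subset_A by blast
  then show ?thesis by (rule that(1))
next
  case False
  then obtain x where x: "x \<in> A" "\<not> algebraic_over k x" by blast
  have sub: "adjoin k x \<subseteq> A" by (rule adjoin_subset[OF subring_A k_subset_A x(1)])
  have "\<exists>s\<in>A. s \<noteq> 0 \<and> s * y \<in> A" if y: "y \<in> F" for y
  proof -
    have "algebraic_over (adjoin k x) y"
      using x A_subset_F by (intro algebraic_over_adjoin y) auto
    then obtain n c i0 where c: "\<forall>i<n. c i \<in> adjoin k x" "i0 < n" "c i0 \<noteq> 0" "(\<Sum>i<n. c i * y ^ i) = 0"
      unfolding algebraic_over_def by blast
    obtain m where m: "m < n" "c m \<noteq> 0" and above: "\<And>j. m < j \<Longrightarrow> j < n \<Longrightarrow> c j = 0"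
      using last_nonzero[of i0 n c, OF c(2,3)] by blast
    have cA: "c i \<in> A" if "i < n" for i using c sub that by blast
    have "(\<Sum>i<Suc m. c i * y ^ i) = (\<Sum>i<n. c i * y ^ i)"
      using m above by (intro sum.mono_neutral_left) auto
    then have rel: "c m * y ^ m = - (\<Sum>i<m. c i * y ^ i)" using c by (simp add: eq_neg_iff_add_eq_0 add.commute)
    \<comment> \<open>Multiplying the relation by \<open>c m ^ (m - 1)\<close> makes it monic in
      \<open>z\<close>, so \<open>z\<close> is integral over \<open>A\<close>.\<close>
    define z where "z = c m * y"
    have zF: "z \<in> F" unfolding z_def using cA[OF m(1)] A_subset_F y F_closed(4) by blast
    have "m \<noteq> 0" using rel m(2) by (cases m) auto
    have "z ^ m = c m ^ (m - 1) * (c m * y ^ m)"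
      using \<open>m \<noteq> 0\<close> by (cases m) (simp_all add: z_def power_mult_distrib)
    also have "\<dots> = (\<Sum>i<m. (- c i * c m ^ (m - 1 - i)) * z ^ i)"
      unfolding rel mult_minus_right sum_distrib_left sum_negf[symmetric]
    proof (intro sum.cong refl)
      fix i assume "i \<in> {..<m}"
      then have "m - 1 = (m - 1 - i) + i" by simp
      then have eq: "c m ^ (m - 1) = c m ^ (m - 1 - i) * c m ^ i" by (metis power_add)
      have alg: "- ((p * q) * (u * w)) = - u * p * (q * w)" for p q u w :: 'a by (simp add: ac_simps)
      show "- (c m ^ (m - 1) * (c i * y ^ i)) = - c i * c m ^ (m - 1 - i) * z ^ i"
        unfolding z_def power_mult_distrib eq by (rule alg)
    qed
    finally have z_eq: "z ^ m = (\<Sum>i<m. (- c i * c m ^ (m - 1 - i)) * z ^ i)" .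
    have coeffs: "- c i * c m ^ (m - 1 - i) \<in> A" if "i < m" for i
      by (intro subring_times[OF subring_A] subring_uminus[OF subring_A] subring_power[OF subring_A] cA m)
        (use that m in simp)
    have "z \<in> A" by (rule integral_mem_A[OF zF coeffs z_eq])
    then show ?thesis using cA m z_def by blast
  qed
  then show ?thesis by (rule that(2))
qed

text \<open>Denominators of the single tensors multiply up. For a quotient \<open>a / b\<close> one
  takes the denominator of \<open>a\<close> times the cleared form of \<open>b\<close>.\<close>

lemma fractions_A\<^sub>L:
  assumes "\<And>y. y \<in> F \<Longrightarrow> \<exists>s\<in>A. s \<noteq> 0 \<and> s * y \<in> A"
  shows "\<exists>s\<in>A\<^sub>L. s \<noteq> 0 \<and> s * x \<in> A\<^sub>L"
proof -
  have A_sub: "A \<subseteq> A\<^sub>L" unfolding coord_ring_L_def by (rule compositum_left[OF subring_A subrings(3)])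
  note AL_times = subring_times[OF subring_A\<^sub>L]
  have comp: "\<exists>s\<in>A\<^sub>L. s \<noteq> 0 \<and> s * y \<in> A\<^sub>L" if "y \<in> compositum F L" for y
    using that
  proof (induction rule: compositum_induct)
    case zero
    show ?case using subring_one[OF subring_A\<^sub>L] subring_zero[OF subring_A\<^sub>L] by (intro bexI[of _ 1]) auto
  next
    case (tensor y f b)
    obtain s where s: "s \<in> A\<^sub>L" "s \<noteq> 0" "s * y \<in> A\<^sub>L" using tensor by blast
    obtain t where t: "t \<in> A" "t \<noteq> 0" "t * f \<in> A" using assms tensor by blast
    have bL: "b \<in> A\<^sub>L" using L_subset_A\<^sub>L tensor by blast
    have tA: "t \<in> A\<^sub>L" "t * f \<in> A\<^sub>L" using t A_sub by auto
    have "(s * t) * (y + f * b) = t * (s * y) + (s * (t * f)) * b" by (simp add: algebra_simps)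
    also have "\<dots> \<in> A\<^sub>L"
      by (rule subring_plus[OF subring_A\<^sub>L AL_times[OF tA(1) s(3)] AL_times[OF AL_times[OF s(1) tA(2)] bL]])
    finally have "(s * t) * (y + f * b) \<in> A\<^sub>L" .
    moreover have "s * t \<in> A\<^sub>L" "s * t \<noteq> 0" using s t tA AL_times by auto
    ultimately show ?case by blast
  qed
  have "x \<in> fractions (compositum F L) (compositum F L - {0})" by (simp add: fractions_compositum)
  then obtain a b where ab: "a \<in> compositum F L" "b \<in> compositum F L" "b \<noteq> 0" "x = a / b"
    unfolding fractions_def by blast
  obtain s t where s: "s \<in> A\<^sub>L" "s \<noteq> 0" "s * a \<in> A\<^sub>L" and t: "t \<in> A\<^sub>L" "t \<noteq> 0" "t * b \<in> A\<^sub>L"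
    using comp[OF ab(1)] comp[OF ab(2)] by blast
  have "(s * (t * b)) * x = t * (s * a)" using ab by simp
  then have "(s * (t * b)) * x \<in> A\<^sub>L" using AL_times[OF t(1) s(3)] by (simp only:)
  moreover have "s * (t * b) \<in> A\<^sub>L" "s * (t * b) \<noteq> 0" using AL_times[OF s(1) t(3)] s t ab by auto
  ultimately show ?thesis by blast
qed

end

section \<open>Morphisms of pure Anderson motives\<close>

lemma mat_mult_unit_vec:
  "(A :: 'a::field mat) \<in> carrier_mat m n \<Longrightarrow> j < n \<Longrightarrow> A *\<^sub>v unit_vec n j = col A j"
  by (rule eq_vecI) auto

definition col_mat :: "nat \<Rightarrow> nat \<Rightarrow> (nat \<Rightarrow> 'a vec) \<Rightarrow> 'a mat" where
  "col_mat m n u = mat m n (\<lambda>(i, j). u j $ i)"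

lemma col_mat_carrier [simp]: "col_mat m n u \<in> carrier_mat m n"
  by (simp add: col_mat_def)

lemma col_col_mat: "j < n \<Longrightarrow> u j \<in> carrier_vec m \<Longrightarrow> col (col_mat m n u) j = u j"
  by (rule eq_vecI) (auto simp: col_mat_def)

lemma col_mat_mult_vec:
  assumes "c \<in> carrier_vec n" "i < m"
  shows "(col_mat m n u *\<^sub>v c) $ i = (\<Sum>j<n. c $ j * u j $ i :: 'a::field)"
  using assms by (simp add: col_mat_def scalar_prod_def atLeast0LessThan mult.commute)

lemma mat_eq_colsI:
  assumes "A \<in> carrier_mat m n" "B \<in> carrier_mat m n" "\<And>j. j < n \<Longrightarrow> col A j = col B j"
  shows "A = B"
  using assms by (intro mat_col_eqI) auto

lemma smult_mat_cancel:
  fixes q :: "'a::field"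
  assumes "q \<noteq> 0" "q \<cdot>\<^sub>m B = q \<cdot>\<^sub>m C"
  shows "B = C"
proof (rule eq_matI)
  show dims: "dim_row B = dim_row C" "dim_col B = dim_col C"
    using arg_cong[OF assms(2), of dim_row] arg_cong[OF assms(2), of dim_col] by simp_all
  show "B $$ (i, j) = C $$ (i, j)" if "i < dim_row C" "j < dim_col C" for i j
    using arg_cong[OF assms(2), of "\<lambda>Z. Z $$ (i, j)"] that dims assms(1) by simp
qed

lemma invertible_det:
  fixes B :: "'a::field mat"
  assumes "B \<in> carrier_mat n n" "det B \<noteq> 0"
  obtains C where "C \<in> carrier_mat n n" "C * B = 1\<^sub>m n" "B * C = 1\<^sub>m n"
  using det_non_zero_imp_unit[OF assms, of undefined] unfolding Units_def ring_mat_def by auto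

lemma submod_vec_simps:
  "carrier (submod_vec r V) = V" "x \<oplus>\<^bsub>submod_vec r V\<^esub> y = x + y" "a \<odot>\<^bsub>submod_vec r V\<^esub> x = a \<cdot>\<^sub>v x"
  by (simp_all add: submod_vec_def module_vec_def)

section \<open>From purity to lattices, and matrices of morphisms\<close>

context curve_uniformizer
begin

lemma map_vec_\<sigma>: "Z \<in> carrier_mat m n \<Longrightarrow> w \<in> carrier_vec n \<Longrightarrow>
    map_vec (\<sigma> ^^ l) (Z *\<^sub>v w) = map_mat (\<sigma> ^^ l) Z *\<^sub>v map_vec (\<sigma> ^^ l) w"
  by (rule semiring_hom.mult_mat_vec_hom)
    (use dvr.field_hom_funpow[of l] in \<open>simp_all add: field_hom_def idom_hom_def comm_ring_hom_def ring_hom_def\<close>)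

lemma map_vec_vecs: "a \<in> dvr.vecs r \<Longrightarrow> map_vec (\<sigma> ^^ l) a \<in> dvr.vecs r"
  by (auto simp: dvr.vecs_def dvr.funpow_V)

text \<open>Evaluated on unit vectors, \<open>into\<close> supplies the columns of an integral
  \<open>U\<close> and \<open>onto\<close> those of an integral \<open>C\<close>. Substituting one
  identity into the other and cancelling gives \<open>U * C = 1\<^sub>m r\<close>; for square
  matrices the other order follows.\<close>

lemma pure_lattice_of_stalks:
  assumes g: "g \<in> carrier_mat r r" "h \<in> carrier_mat r r" "h * g = 1\<^sub>m r" "g * h = 1\<^sub>m r"
    and \<Phi>: "\<Phi> \<in> carrier_mat r r"
    and P: "P = frob_power r \<sigma> \<Phi> l * map_mat (\<sigma> ^^ l) g"
    and into: "\<And>a. a \<in> dvr.vecs r \<Longrightarrow>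
      P *\<^sub>v map_vec (\<sigma> ^^ l) a \<in> (\<lambda>a. \<pi> powi (- int \<kappa>) \<cdot>\<^sub>v (g *\<^sub>v a)) ` dvr.vecs r"
    and onto: "\<And>a. a \<in> dvr.vecs r \<Longrightarrow> \<pi> powi (- int \<kappa>) \<cdot>\<^sub>v (g *\<^sub>v a) \<in> (\<lambda>c. P *\<^sub>v c) ` dvr.vecs r"
  shows "dvr.pure_lattice r \<Phi> \<kappa> l g h"
proof -
  have Pc: "P \<in> carrier_mat r r" unfolding P
    by (rule mult_carrier_mat[OF dvr.frob_power_carrier[OF \<Phi>]]) (use g in simp)
  \<comment> \<open>Frobenius fixes 0 and 1, so applying the semilinear map to unit vectors yields
    the columns of \<open>P\<close>.\<close>
  have \<sigma>_unit: "map_vec (\<sigma> ^^ l) (unit_vec r j) = unit_vec r j" for j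
  proof -
    interpret s: field_hom "\<sigma> ^^ l" by (rule dvr.field_hom_funpow)
    show ?thesis by (rule eq_vecI) (auto simp: unit_vec_def)
  qed
  have "\<forall>j\<in>{..<r}. \<exists>u. u \<in> dvr.vecs r \<and> col P j = \<pi> powi (- int \<kappa>) \<cdot>\<^sub>v (g *\<^sub>v u)"
    using into[OF dvr.vecs_unit] by (auto simp: \<sigma>_unit mat_mult_unit_vec[OF Pc])
  from bchoice[OF this] obtain u
    where u: "\<And>j. j < r \<Longrightarrow> u j \<in> dvr.vecs r" "\<And>j. j < r \<Longrightarrow> col P j = \<pi> powi (- int \<kappa>) \<cdot>\<^sub>v (g *\<^sub>v u j)" by auto
  have "\<forall>j\<in>{..<r}. \<exists>c. c \<in> dvr.vecs r \<and> \<pi> powi (- int \<kappa>) \<cdot>\<^sub>v col g j = P *\<^sub>v c"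
    using onto[OF dvr.vecs_unit] by (auto simp: mat_mult_unit_vec[OF g(1)])
  from bchoice[OF this] obtain c
    where c: "\<And>j. j < r \<Longrightarrow> c j \<in> dvr.vecs r" "\<And>j. j < r \<Longrightarrow> \<pi> powi (- int \<kappa>) \<cdot>\<^sub>v col g j = P *\<^sub>v c j" by auto
  define U C where "U = col_mat r r u" and "C = col_mat r r c"
  have UC: "U \<in> carrier_mat r r" "C \<in> carrier_mat r r" by (simp_all add: U_def C_def)
  have carr: "u j \<in> carrier_vec r" "c j \<in> carrier_vec r" if "j < r" for j
    using u(1)[OF that] c(1)[OF that] by (auto simp: dvr.vecs_def)
  have ord: "dvr.ord_ge 0 U" "dvr.ord_ge 0 C"
    using u(1) c(1) by (auto simp: dvr.ord_ge_def U_def C_def col_mat_def dvr.vecs_def)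
  have PU: "P = \<pi> powi (- int \<kappa>) \<cdot>\<^sub>m (g * U)"
  proof (rule mat_eq_colsI[OF Pc])
    fix j assume j: "j < r"
    have "col U j = u j" unfolding U_def by (rule col_col_mat[of j r u r, OF j carr(1)[OF j]])
    moreover have "col (\<pi> powi (- int \<kappa>) \<cdot>\<^sub>m (g * U)) j = \<pi> powi (- int \<kappa>) \<cdot>\<^sub>v col (g * U) j"
      using UC j by (intro col_smult) simp
    ultimately show "col P j = col (\<pi> powi (- int \<kappa>) \<cdot>\<^sub>m (g * U)) j"
      by (simp only: u(2)[OF j] col_mult2[OF g(1) UC(1) j])
  qed (use g UC in simp)
  have PC: "\<pi> powi (- int \<kappa>) \<cdot>\<^sub>m g = P * C"
  proof (rule mat_eq_colsI[of _ r r])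
    fix j assume j: "j < r"
    have "col C j = c j" unfolding C_def by (rule col_col_mat[of j r c r, OF j carr(2)[OF j]])
    moreover have "col (\<pi> powi (- int \<kappa>) \<cdot>\<^sub>m g) j = \<pi> powi (- int \<kappa>) \<cdot>\<^sub>v col g j"
      using g j by (intro col_smult) simp
    ultimately show "col (\<pi> powi (- int \<kappa>) \<cdot>\<^sub>m g) j = col (P * C) j"
      by (simp only: c(2)[OF j] col_mult2[OF Pc UC(2) j])
  qed (use Pc g UC in auto)
  have "\<pi> powi (- int \<kappa>) \<cdot>\<^sub>m g = \<pi> powi (- int \<kappa>) \<cdot>\<^sub>m (g * (U * C))"
    unfolding PC PU using g UC by (simp add: mult_smult_assoc_mat[of _ r r _ r] assoc_mult_mat[of _ r r _ r _ r])
  then have "g = g * (U * C)" by (rule smult_mat_cancel[rotated]) (use \<pi>(2) in simp)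
  then have "h * g = h * (g * (U * C))" by (rule arg_cong)
  also have "\<dots> = h * g * (U * C)"
    using UC by (intro assoc_mult_mat[OF g(2) g(1), symmetric] mult_carrier_mat)
  finally have "U * C = 1\<^sub>m r" unfolding g(3) using UC by simp
  moreover from this have "C * U = 1\<^sub>m r" using mat_mult_left_right_inverse[OF UC] by simp
  ultimately show ?thesis unfolding dvr.pure_lattice_def
    using g \<Phi> UC ord PU[unfolded P] by (intro conjI exI[of _ U] exI[of _ C])
qed

text \<open>The stalk isomorphism is known explicitly on pure tensors only. That suffices: on
  tensors with 1 it shows that the lattice is mapped into the twist, and additivity together with
  surjectivity shows that the twist is filled.\<close>

lemma pure_with_lattice:
  assumes "pure_with D r M \<tau> \<kappa> l"
  obtains \<iota> \<Phi> g h where "0 < \<kappa>" "0 < l" "dvr.pure_lattice r \<Phi> \<kappa> l g h"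
    "\<iota> \<in> module_homs A\<^sub>L M (submod_vec r (carrier_vec r))" "inj_on \<iota> (carrier M)"
    "\<forall>m\<in>carrier M. \<forall>b\<in>A\<^sub>L.
      \<iota> (\<tau> (sigma_tensor D M m b)) = b \<cdot>\<^sub>v (\<Phi> *\<^sub>v map_vec \<sigma> (\<iota> m))"
proof -
  from assms have pos: "0 < \<kappa>" "0 < l" by (simp_all add: pure_with_def)
  from assms obtain E \<iota> \<Phi> h0 where E: "locally_free_sheaf Y r E"
    and \<iota>: "\<iota> \<in> module_homs A\<^sub>L M (submod_vec r (E (Y - {infL D})))" "bij_betw \<iota> (carrier M) (E (Y - {infL D}))"
    and \<Phi>: "\<Phi> \<in> carrier_mat r r"
    and tau: "\<forall>m\<in>carrier M. \<forall>b\<in>A\<^sub>L. \<iota> (\<tau> (sigma_tensor D M m b)) = b \<cdot>\<^sub>v (\<Phi> *\<^sub>v map_vec \<sigma> (\<iota> m))"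
    and h0: "h0 \<in> module_homs (infL D) (base_change (infL D) (infL D) (\<sigma> ^^ l) (submod_vec r (stalk Y E (infL D))))
        (submod_vec r (twisted_stalk Y E (infL D) \<kappa>))"
      "bij_betw h0 (carrier (base_change (infL D) (infL D) (\<sigma> ^^ l) (submod_vec r (stalk Y E (infL D)))))
        (twisted_stalk Y E (infL D) \<kappa>)"
      "\<forall>v\<in>stalk Y E (infL D). \<forall>b\<in>infL D.
        h0 (pure_tensor (infL D) (infL D) (\<sigma> ^^ l) (submod_vec r (stalk Y E (infL D))) v b) =
          b \<cdot>\<^sub>v (frob_power r \<sigma> \<Phi> l *\<^sub>v map_vec (\<sigma> ^^ l) v)"
    unfolding pure_with_def Let_def by (elim conjE exE) (rule that; assumption)
  define \<sigma>l where "\<sigma>l = \<sigma> ^^ l"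
  obtain g h where g: "g \<in> carrier_mat r r" "h \<in> carrier_mat r r" "h * g = 1\<^sub>m r" "g * h = 1\<^sub>m r"
    and st: "stalk Y E (infL D) = (\<lambda>a. g *\<^sub>v a) ` dvr.vecs r" using stalk_eq[OF E] by blast
  define N where "N = submod_vec r (stalk Y E (infL D))"
  note tw = twisted_stalk_eq[OF g(1) st, of \<kappa>]
  note h0 = h0[folded \<sigma>l_def, folded N_def, unfolded tw]
  define P where "P = frob_power r \<sigma> \<Phi> l * map_mat \<sigma>l g"
  have Fc: "frob_power r \<sigma> \<Phi> l \<in> carrier_mat r r" by (rule dvr.frob_power_carrier[OF \<Phi>])
  have Pc: "P \<in> carrier_mat r r" unfolding P_def using g Fc by simp
  have vc: "a \<in> carrier_vec r" if "a \<in> dvr.vecs r" for a using that by (simp add: dvr.vecs_def)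
  have N_carrier: "carrier N = (\<lambda>a. g *\<^sub>v a) ` dvr.vecs r" by (simp add: N_def submod_vec_simps st)
  interpret tp: tensor_product "infL D" "infL D" \<sigma>l N
  proof (rule tensor_product.intro)
    fix m n assume "m \<in> carrier N" "n \<in> carrier N"
    then obtain a b where "a \<in> dvr.vecs r" "m = g *\<^sub>v a" "b \<in> dvr.vecs r" "n = g *\<^sub>v b" unfolding N_carrier by blast
    then have "m \<oplus>\<^bsub>N\<^esub> n = g *\<^sub>v (a + b)" "a + b \<in> dvr.vecs r"
      using g(1) vc dvr.vecs_add by (auto simp: N_def submod_vec_simps mult_add_distrib_mat_vec[of g r r])
    then show "m \<oplus>\<^bsub>N\<^esub> n \<in> carrier N" unfolding N_carrier by blast
  next
    fix x m assume "x \<in> infL D" "m \<in> carrier N"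
    then obtain a where "a \<in> dvr.vecs r" "m = g *\<^sub>v a" unfolding N_carrier by blast
    then have "x \<odot>\<^bsub>N\<^esub> m = g *\<^sub>v (x \<cdot>\<^sub>v a)" "x \<cdot>\<^sub>v a \<in> dvr.vecs r"
      using g(1) vc dvr.vecs_smult \<open>x \<in> infL D\<close> by (auto simp: N_def submod_vec_simps mult_mat_vec[of g r r])
    then show "x \<odot>\<^bsub>N\<^esub> m \<in> carrier N" unfolding N_carrier by blast
  qed (use subring_infL dvr.funpow_V in \<open>auto simp: \<sigma>l_def\<close>)
  have pure: "h0 (pure_tensor (infL D) (infL D) \<sigma>l N (g *\<^sub>v a) b) = b \<cdot>\<^sub>v (P *\<^sub>v map_vec \<sigma>l a)"
    if "a \<in> dvr.vecs r" "b \<in> infL D" for a b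
  proof -
    have "h0 (pure_tensor (infL D) (infL D) \<sigma>l N (g *\<^sub>v a) b) =
        b \<cdot>\<^sub>v (frob_power r \<sigma> \<Phi> l *\<^sub>v map_vec \<sigma>l (g *\<^sub>v a))"
      using h0(3) that st by blast
    also have "map_vec \<sigma>l (g *\<^sub>v a) = map_mat \<sigma>l g *\<^sub>v map_vec \<sigma>l a"
      unfolding \<sigma>l_def by (rule map_vec_\<sigma>[OF g(1) vc[OF that(1)]])
    also have "frob_power r \<sigma> \<Phi> l *\<^sub>v (map_mat \<sigma>l g *\<^sub>v map_vec \<sigma>l a) = P *\<^sub>v map_vec \<sigma>l a"
      unfolding P_def using Fc g(1) vc[OF that(1)] by (intro assoc_mult_mat_vec[symmetric]) auto
    finally show ?thesis .
  qed
  have h0_vec: "h0 x \<in> carrier_vec r" if "x \<in> carrier tp.BC" for x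
  proof -
    have "h0 x \<in> (\<lambda>a. \<pi> powi (- int \<kappa>) \<cdot>\<^sub>v (g *\<^sub>v a)) ` dvr.vecs r" using h0(2) that bij_betwE by blast
    then show ?thesis using g(1) vc by auto
  qed
  have "dvr.pure_lattice r \<Phi> \<kappa> l g h"
  proof (rule pure_lattice_of_stalks[OF g \<Phi> P_def[unfolded \<sigma>l_def]])
    fix a assume a: "a \<in> dvr.vecs r"
    have "frag_of (g *\<^sub>v a, 1) \<in> tp.chains"
      using a subring_one[OF subring_infL] unfolding N_carrier by (intro tp.chains_of) (auto simp: N_carrier)
    then have "pure_tensor (infL D) (infL D) \<sigma>l N (g *\<^sub>v a) 1 \<in> carrier tp.BC"
      unfolding tp.pure_tensor_eq tp.carrier_BC by blast
    then have "h0 (pure_tensor (infL D) (infL D) \<sigma>l N (g *\<^sub>v a) 1) \<in> (\<lambda>a. \<pi> powi (- int \<kappa>) \<cdot>\<^sub>v (g *\<^sub>v a)) ` dvr.vecs r"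
      using h0(2) bij_betwE by blast
    then show "P *\<^sub>v map_vec (\<sigma> ^^ l) a \<in> (\<lambda>a. \<pi> powi (- int \<kappa>) \<cdot>\<^sub>v (g *\<^sub>v a)) ` dvr.vecs r"
      using pure[OF a subring_one[OF subring_infL]] by (simp add: \<sigma>l_def)
    \<comment> \<open>The span of the columns of \<open>P\<close> over \<open>infL D\<close>. It
      contains the image of every pure tensor, as the scalar \<open>b\<close> moves inside the
      vector, and therefore the whole twisted stalk.\<close>
    define Q where "Q = (\<lambda>c. P *\<^sub>v c) ` dvr.vecs r"
    have "h0 x \<in> Q" if x: "x \<in> carrier tp.BC" for x
    proof (rule tp.additive_image_BC[OF _ h0_vec _ _ _ _ x])
      show "h0 (x \<oplus>\<^bsub>tp.BC\<^esub> y) = h0 x + h0 y" if "x \<in> carrier tp.BC" "y \<in> carrier tp.BC" for x y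
        using h0(1) that by (simp add: module_homs_def submod_vec_simps)
      show "Q \<subseteq> carrier_vec r" using Pc vc by (auto simp: Q_def)
      have "P *\<^sub>v 0\<^sub>v r = 0\<^sub>v r" using Pc by (intro eq_vecI) auto
      then show "0\<^sub>v r \<in> Q" unfolding Q_def using dvr.vecs_zero by (metis imageI)
      show "v - w \<in> Q" if vw: "v \<in> Q" "w \<in> Q" for v w
      proof -
        obtain a b where "a \<in> dvr.vecs r" "v = P *\<^sub>v a" "b \<in> dvr.vecs r" "w = P *\<^sub>v b" using vw unfolding Q_def by blast
        then have "v - w = P *\<^sub>v (a - b)" "a - b \<in> dvr.vecs r"
          using Pc vc dvr.vecs_minus by (auto simp: mult_minus_distrib_mat_vec[of P r r])
        then show ?thesis unfolding Q_def by blast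
      qed
      fix m b assume "m \<in> carrier N" "b \<in> infL D"
      then obtain a where a: "a \<in> dvr.vecs r" "m = g *\<^sub>v a" unfolding N_carrier by blast
      have \<sigma>a: "map_vec \<sigma>l a \<in> dvr.vecs r" using map_vec_vecs[OF a(1)] by (simp add: \<sigma>l_def)
      have "h0 (pure_tensor (infL D) (infL D) \<sigma>l N m b) = P *\<^sub>v (b \<cdot>\<^sub>v map_vec \<sigma>l a)"
        using pure[OF a(1) \<open>b \<in> infL D\<close>] mult_mat_vec[OF Pc vc[OF \<sigma>a]] a(2) by simp
      then show "h0 (pure_tensor (infL D) (infL D) \<sigma>l N m b) \<in> Q"
        unfolding Q_def using dvr.vecs_smult[OF \<open>b \<in> infL D\<close> \<sigma>a] by blast
    qed
    then have "h0 ` carrier tp.BC \<subseteq> Q" by blast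
    then show "\<pi> powi (- int \<kappa>) \<cdot>\<^sub>v (g *\<^sub>v a) \<in> (\<lambda>c. P *\<^sub>v c) ` dvr.vecs r"
      using h0(2) a unfolding bij_betw_def Q_def by blast
  qed
  moreover have sub: "E (Y - {infL D}) \<subseteq> carrier_vec r"
    using conjunct1[OF E[unfolded locally_free_sheaf_def]] openin_affine affine_nonempty by blast
  have "\<iota> \<in> module_homs A\<^sub>L M (submod_vec r (carrier_vec r))"
    using \<iota>(1) sub unfolding module_homs_def submod_vec_simps by blast
  moreover have "inj_on \<iota> (carrier M)" using \<iota>(2) by (rule bij_betw_imp_inj_on)
  ultimately show ?thesis using that[OF pos] tau by blast
qed

lemma linear_finsum:
  assumes M: "module (ring_on A\<^sub>L) M"
    and u: "\<And>m n. m \<in> carrier M \<Longrightarrow> n \<in> carrier M \<Longrightarrow> u (m \<oplus>\<^bsub>M\<^esub> n) = (u m + u n :: 'a)"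
      "\<And>a m. a \<in> A\<^sub>L \<Longrightarrow> m \<in> carrier M \<Longrightarrow> u (a \<odot>\<^bsub>M\<^esub> m) = a * u m"
    and "finite I" "\<And>i. i \<in> I \<Longrightarrow> a i \<in> A\<^sub>L" "\<And>i. i \<in> I \<Longrightarrow> m i \<in> carrier M"
  shows "u (finsum M (\<lambda>i. a i \<odot>\<^bsub>M\<^esub> m i) I) = (\<Sum>i\<in>I. a i * u (m i))"
proof -
  interpret M: Module.module "ring_on A\<^sub>L" M by (rule M)
  have "u \<zero>\<^bsub>M\<^esub> = u \<zero>\<^bsub>M\<^esub> + u \<zero>\<^bsub>M\<^esub>" using u(1)[of "\<zero>\<^bsub>M\<^esub>" "\<zero>\<^bsub>M\<^esub>"] by simp
  then have u0: "u \<zero>\<^bsub>M\<^esub> = 0" by (metis add_cancel_right_right)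
  show ?thesis using assms(4-6)
  proof (induction I)
    case (insert i I)
    have c: "a j \<odot>\<^bsub>M\<^esub> m j \<in> carrier M" if "j \<in> insert i I" for j
      using insert.prems(1)[OF that] insert.prems(2)[OF that] M.smult_closed by simp
    have "finsum M (\<lambda>i. a i \<odot>\<^bsub>M\<^esub> m i) (insert i I) = (a i \<odot>\<^bsub>M\<^esub> m i) \<oplus>\<^bsub>M\<^esub> finsum M (\<lambda>i. a i \<odot>\<^bsub>M\<^esub> m i) I"
      using insert.hyps c by (intro M.finsum_insert) auto
    moreover have "finsum M (\<lambda>i. a i \<odot>\<^bsub>M\<^esub> m i) I \<in> carrier M" using c by (intro M.finsum_closed Pi_I) blast
    ultimately show ?case using u c[of i] insert by simp
  qed (simp add: u0)
qed

lemma vec_hom_components: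
  fixes \<iota> :: "'m \<Rightarrow> 'a vec"
  assumes "\<iota> \<in> module_homs A\<^sub>L M (submod_vec r (carrier_vec r))" "i < r"
  shows "m \<in> carrier M \<Longrightarrow> n \<in> carrier M \<Longrightarrow> \<iota> (m \<oplus>\<^bsub>M\<^esub> n) $ i = \<iota> m $ i + \<iota> n $ i"
    and "a \<in> A\<^sub>L \<Longrightarrow> m \<in> carrier M \<Longrightarrow> \<iota> (a \<odot>\<^bsub>M\<^esub> m) $ i = a * \<iota> m $ i"
proof -
  have c: "\<iota> x \<in> carrier_vec r" if "x \<in> carrier M" for x
    using assms(1) that by (auto simp: module_homs_def submod_vec_simps)
  show "\<iota> (m \<oplus>\<^bsub>M\<^esub> n) $ i = \<iota> m $ i + \<iota> n $ i" if "m \<in> carrier M" "n \<in> carrier M"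
    using assms that carrier_vecD[OF c[OF that(2)]] by (simp add: module_homs_def submod_vec_simps)
  show "\<iota> (a \<odot>\<^bsub>M\<^esub> m) $ i = a * \<iota> m $ i" if "a \<in> A\<^sub>L" "m \<in> carrier M"
    using assms that carrier_vecD[OF c[OF that(2)]] by (simp add: module_homs_def submod_vec_simps)
qed

lemma vec_hom_finsum:
  fixes \<iota> :: "'m \<Rightarrow> 'a vec"
  assumes M: "module (ring_on A\<^sub>L) M" and \<iota>: "\<iota> \<in> module_homs A\<^sub>L M (submod_vec r (carrier_vec r))"
    and a: "\<And>i. i < n \<Longrightarrow> a i \<in> A\<^sub>L" and m: "\<And>i. i < n \<Longrightarrow> m i \<in> carrier M"
  shows "\<iota> (finsum M (\<lambda>i. a i \<odot>\<^bsub>M\<^esub> m i) {..<n}) = col_mat r n (\<lambda>i. \<iota> (m i)) *\<^sub>v vec n a"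
proof (rule eq_vecI)
  interpret M: Module.module "ring_on A\<^sub>L" M by (rule M)
  have fin: "finsum M (\<lambda>i. a i \<odot>\<^bsub>M\<^esub> m i) {..<n} \<in> carrier M"
    using a m M.smult_closed by (intro M.finsum_closed Pi_I) auto
  then show "dim_vec (\<iota> (finsum M (\<lambda>i. a i \<odot>\<^bsub>M\<^esub> m i) {..<n})) = dim_vec (col_mat r n (\<lambda>i. \<iota> (m i)) *\<^sub>v vec n a)"
  proof -
    have "\<iota> (finsum M (\<lambda>i. a i \<odot>\<^bsub>M\<^esub> m i) {..<n}) \<in> carrier_vec r"
      using \<iota> fin unfolding module_homs_def submod_vec_simps by blast
    then show ?thesis by (simp add: col_mat_def)
  qed
  fix j assume "j < dim_vec (col_mat r n (\<lambda>i. \<iota> (m i)) *\<^sub>v vec n a)"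
  then have j: "j < r" by (simp add: col_mat_def)
  have "\<iota> (finsum M (\<lambda>i. a i \<odot>\<^bsub>M\<^esub> m i) {..<n}) $ j = (\<Sum>i\<in>{..<n}. a i * \<iota> (m i) $ j)"
    using a m by (intro linear_finsum[OF M, of "\<lambda>x. \<iota> x $ j"] vec_hom_components[OF \<iota> j]) auto
  also have "\<dots> = (col_mat r n (\<lambda>i. \<iota> (m i)) *\<^sub>v vec n a) $ j"
    using j by (simp add: col_mat_mult_vec)
  finally show "\<iota> (finsum M (\<lambda>i. a i \<odot>\<^bsub>M\<^esub> m i) {..<n}) $ j = (col_mat r n (\<lambda>i. \<iota> (m i)) *\<^sub>v vec n a) $ j" .
qed

lemma ex_common_denominator:
  fixes n :: nat
  assumes "\<And>x. \<exists>s\<in>A\<^sub>L. s \<noteq> 0 \<and> s * x \<in> A\<^sub>L"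
  shows "\<exists>s\<in>A\<^sub>L. s \<noteq> 0 \<and> (\<forall>i<n. s * x i \<in> A\<^sub>L)"
proof (induction n)
  case 0
  show ?case using subring_one[OF subring_A\<^sub>L] by (intro bexI[of _ 1]) auto
next
  case (Suc n)
  obtain s where s: "s \<in> A\<^sub>L" "s \<noteq> 0" "\<And>i. i < n \<Longrightarrow> s * x i \<in> A\<^sub>L" using Suc by blast
  obtain t where t: "t \<in> A\<^sub>L" "t \<noteq> 0" "t * x n \<in> A\<^sub>L" using assms by blast
  note AL_times = subring_times[OF subring_A\<^sub>L]
  have "(s * t) * x i \<in> A\<^sub>L" if "i < Suc n" for i
  proof (cases "i = n")
    case True
    have "(s * t) * x i = s * (t * x n)" using True by simp
    then show ?thesis using AL_times[OF s(1) t(3)] by (simp only:)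
  next
    case False
    then have "s * x i \<in> A\<^sub>L" using that s by simp
    moreover have "(s * t) * x i = t * (s * x i)" by simp
    ultimately show ?thesis using AL_times[OF t(1)] by (simp only:)
  qed
  then show ?case using AL_times[OF s(1) t(1)] s t by (intro bexI[of _ "s * t"]) auto
qed

lemma tensor_product_A\<^sub>L:
  assumes "module (ring_on A\<^sub>L) M"
  shows "tensor_product A\<^sub>L A\<^sub>L \<sigma> M"
proof -
  interpret M: Module.module "ring_on A\<^sub>L" M by (rule assms)
  show ?thesis
    by (rule tensor_product.intro) (use subring_A\<^sub>L \<sigma>_mem_A\<^sub>L M.smult_closed in auto)
qed

lemma sigma_tensor_mem:
  assumes "module (ring_on A\<^sub>L) M" "m \<in> carrier M" "b \<in> A\<^sub>L"
  shows "sigma_tensor D M m b \<in> carrier (sigma_star D M)"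
proof -
  interpret tp: tensor_product A\<^sub>L A\<^sub>L \<sigma> M by (rule tensor_product_A\<^sub>L[OF assms(1)])
  show ?thesis unfolding tp.pure_tensor_eq tp.carrier_BC by (intro imageI tp.chains_of assms)
qed

lemma sigma_star_map_tensor:
  assumes "module (ring_on A\<^sub>L) M" "module (ring_on A\<^sub>L) M'" "f \<in> module_homs A\<^sub>L M M'"
  shows "sigma_star_map D M M' f (sigma_tensor D M m b) = sigma_tensor D M' (f m) b"
proof -
  interpret tp: tensor_product A\<^sub>L A\<^sub>L \<sigma> M by (rule tensor_product_A\<^sub>L[OF assms(1)])
  interpret tp': tensor_product A\<^sub>L A\<^sub>L \<sigma> M' by (rule tensor_product_A\<^sub>L[OF assms(2)])
  show ?thesis unfolding tp.pure_tensor_eq tp'.pure_tensor_eq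
    using base_change_map_cls[OF tensor_product_A\<^sub>L[OF assms(1)] tensor_product_A\<^sub>L[OF assms(2)] assms(3)]
    by simp
qed

text \<open>The empty set generates the zero ideal, so the covering family has a member; one of them
  is enough to find generic coordinates.\<close>

lemma locally_free_generators:
  assumes "locally_free A\<^sub>L r M"
  obtains f e where "localized_free_module A\<^sub>L M f r e"
proof -
  from assms obtain T where M: "module (ring_on A\<^sub>L) M" and T: "T \<subseteq> A\<^sub>L - {0}" "genideal (ring_on A\<^sub>L) T = A\<^sub>L"
    and basis: "\<forall>f\<in>T. \<exists>e. has_basis (fractions A\<^sub>L (range (\<lambda>n. f ^ n)))
      (base_change A\<^sub>L (fractions A\<^sub>L (range (\<lambda>n. f ^ n))) id M) r e"
    unfolding locally_free_def Let_def by blast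
  interpret A: cring "ring_on A\<^sub>L" by (rule ring_on_cring[OF subring_A\<^sub>L])
  have "T \<noteq> {}"
  proof
    assume "T = {}"
    then have "genideal (ring_on A\<^sub>L) T \<subseteq> {0}" using A.genideal_minimal[OF A.zeroideal] by simp
    then show False using T(2) subring_one[OF subring_A\<^sub>L] by auto
  qed
  then obtain f where f: "f \<in> T" by blast
  then obtain e where "has_basis (fractions A\<^sub>L (range (\<lambda>n. f ^ n)))
      (base_change A\<^sub>L (fractions A\<^sub>L (range (\<lambda>n. f ^ n))) id M) r e" using basis by blast
  then have "localized_free_module A\<^sub>L M f r e"
    using f T(1) M subring_A\<^sub>L by (intro localized_free_module.intro) auto
  then show ?thesis by (rule that)
qed

lemma module_homs_zero:
  assumes "module (ring_on A\<^sub>L) M" "module (ring_on A\<^sub>L) M'" "f \<in> module_homs A\<^sub>L M M'"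
  shows "f \<zero>\<^bsub>M\<^esub> = \<zero>\<^bsub>M'\<^esub>"
proof -
  interpret M: Module.module "ring_on A\<^sub>L" M by (rule assms)
  interpret M': Module.module "ring_on A\<^sub>L" M' by (rule assms)
  have f: "f \<zero>\<^bsub>M\<^esub> \<in> carrier M'" "f (\<zero>\<^bsub>M\<^esub> \<oplus>\<^bsub>M\<^esub> \<zero>\<^bsub>M\<^esub>) = f \<zero>\<^bsub>M\<^esub> \<oplus>\<^bsub>M'\<^esub> f \<zero>\<^bsub>M\<^esub>"
    using assms(3) M.zero_closed unfolding module_homs_def by blast+
  then have "f \<zero>\<^bsub>M\<^esub> \<oplus>\<^bsub>M'\<^esub> f \<zero>\<^bsub>M\<^esub> = f \<zero>\<^bsub>M\<^esub>" by simp
  then show ?thesis using f(1) M'.add.l_cancel_one by blast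
qed

lemma vec_hom_eq_zero:
  fixes \<iota> :: "'m \<Rightarrow> 'a vec"
  assumes M: "module (ring_on A\<^sub>L) M" and \<iota>: "\<iota> \<in> module_homs A\<^sub>L M (submod_vec r (carrier_vec r))"
    "inj_on \<iota> (carrier M)" and x: "x \<in> carrier M" "\<iota> x = 0\<^sub>v r"
  shows "x = \<zero>\<^bsub>M\<^esub>"
proof -
  interpret M: Module.module "ring_on A\<^sub>L" M by (rule M)
  have "\<iota> \<zero>\<^bsub>M\<^esub> \<in> carrier_vec r"
    using \<iota>(1) M.zero_closed unfolding module_homs_def submod_vec_simps by blast
  moreover have "\<iota> \<zero>\<^bsub>M\<^esub> $ i = 0" if "i < r" for i
    using vec_hom_components(1)[OF \<iota>(1) that M.zero_closed M.zero_closed] M.l_zero[OF M.zero_closed]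
    by (metis add_cancel_right_right)
  ultimately have "\<iota> \<zero>\<^bsub>M\<^esub> = 0\<^sub>v r" by (intro eq_vecI) auto
  then have "\<iota> x = \<iota> \<zero>\<^bsub>M\<^esub>" using x by simp
  then show ?thesis by (rule inj_onD[OF \<iota>(2) _ x(1) M.zero_closed])
qed

text \<open>The embeddings turn \<tau> and \<open>\<tau>'\<close> into matrices. It remains to turn
  \<open>f\<close> into one, for which the images of the generators of \<open>M\<close> must form an
  invertible matrix \<open>B\<close>; when \<open>A\<close> has only constants, \<open>M\<close>
  itself is shown to vanish.\<close>

lemma hom_eq_zero:
  assumes M: "locally_free A\<^sub>L r M" and M': "locally_free A\<^sub>L r' M'"
    and \<tau>: "\<tau> \<in> module_homs A\<^sub>L (sigma_star D M) M"
    and p: "pure_with D r M \<tau> \<kappa> l" and p': "pure_with D r' M' \<tau>' \<kappa>' l'"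
    and f: "f \<in> motive_Hom D M \<tau> M' \<tau>'" and ne: "\<kappa> * l' \<noteq> \<kappa>' * l" and x: "x \<in> carrier M"
  shows "f x = \<zero>\<^bsub>M'\<^esub>"
proof -
  have mod: "module (ring_on A\<^sub>L) M" and mod': "module (ring_on A\<^sub>L) M'"
    using M M' by (simp_all add: locally_free_def)
  interpret M: Module.module "ring_on A\<^sub>L" M by (rule mod)
  obtain \<iota> \<Phi> g h where pos: "0 < \<kappa>" "0 < l" and pl: "dvr.pure_lattice r \<Phi> \<kappa> l g h"
    and \<iota>: "\<iota> \<in> module_homs A\<^sub>L M (submod_vec r (carrier_vec r))" "inj_on \<iota> (carrier M)"
    and tau: "\<forall>m\<in>carrier M. \<forall>b\<in>A\<^sub>L.
      \<iota> (\<tau> (sigma_tensor D M m b)) = b \<cdot>\<^sub>v (\<Phi> *\<^sub>v map_vec \<sigma> (\<iota> m))"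
    by (rule pure_with_lattice[OF p]) (rule that; assumption)
  obtain \<iota>' \<Phi>' g' h' where "0 < \<kappa>'" "0 < l'" and pl': "dvr.pure_lattice r' \<Phi>' \<kappa>' l' g' h'"
    and \<iota>': "\<iota>' \<in> module_homs A\<^sub>L M' (submod_vec r' (carrier_vec r'))" "inj_on \<iota>' (carrier M')"
    and tau': "\<forall>m\<in>carrier M'. \<forall>b\<in>A\<^sub>L.
      \<iota>' (\<tau>' (sigma_tensor D M' m b)) = b \<cdot>\<^sub>v (\<Phi>' *\<^sub>v map_vec \<sigma> (\<iota>' m))"
    by (rule pure_with_lattice[OF p']) (rule that; assumption)
  have \<Phi>: "\<Phi> \<in> carrier_mat r r" "\<Phi>' \<in> carrier_mat r' r'"
    using pl pl' by (auto simp: dvr.pure_lattice_def)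
  have fh: "f \<in> module_homs A\<^sub>L M M'"
    and f\<tau>: "\<And>t. t \<in> carrier (sigma_star D M) \<Longrightarrow> f (\<tau> t) = \<tau>' (sigma_star_map D M M' f t)"
    using f by (auto simp: motive_Hom_def)
  have fM: "f m \<in> carrier M'" if "m \<in> carrier M" for m using fh that by (auto simp: module_homs_def)
  have \<iota>c: "\<iota> m \<in> carrier_vec r" if "m \<in> carrier M" for m
    using \<iota>(1) that by (auto simp: module_homs_def submod_vec_simps)
  have \<iota>'c: "\<iota>' m \<in> carrier_vec r'" if "m \<in> carrier M'" for m
    using \<iota>'(1) that by (auto simp: module_homs_def submod_vec_simps)
  have one: "1 \<in> A\<^sub>L" by (rule subring_one[OF subring_A\<^sub>L])
  have \<tau>M: "\<tau> (sigma_tensor D M m 1) \<in> carrier M" if "m \<in> carrier M" for m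
    using \<tau> sigma_tensor_mem[OF mod that one] unfolding module_homs_def by blast
  have \<iota>\<tau>: "\<iota> (\<tau> (sigma_tensor D M m 1)) = \<Phi> *\<^sub>v map_vec \<sigma> (\<iota> m)" if "m \<in> carrier M" for m
    using tau that one by simp
  have \<iota>f\<tau>: "\<iota>' (f (\<tau> (sigma_tensor D M m 1))) = \<Phi>' *\<^sub>v map_vec \<sigma> (\<iota>' (f m))" if "m \<in> carrier M" for m
    using bspec[OF bspec[OF tau' fM[OF that]] one] f\<tau>[OF sigma_tensor_mem[OF mod that one]]
      sigma_star_map_tensor[OF mod mod' fh] by simp
  have comp: "(\<lambda>m. \<iota>' (f m)) \<in> module_homs A\<^sub>L M (submod_vec r' (carrier_vec r'))"
    using fh \<iota>'(1) unfolding module_homs_def by (auto simp: Pi_iff)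
  have map_\<sigma>: "map_vec \<sigma> (B *\<^sub>v w) = map_mat \<sigma> B *\<^sub>v map_vec \<sigma> w"
    if "B \<in> carrier_mat i j" "w \<in> carrier_vec j" for B w i j
    using map_vec_\<sigma>[OF that, of 1] by simp
  obtain a0 e where "localized_free_module A\<^sub>L M a0 r e" using locally_free_generators[OF M] .
  then interpret lf: localized_free_module A\<^sub>L M a0 r e .
  obtain m where m: "\<And>i. i < r \<Longrightarrow> m i \<in> carrier M"
    and indep: "\<And>a. (\<And>i. i < r \<Longrightarrow> a i \<in> A\<^sub>L) \<Longrightarrow> finsum M (\<lambda>i. a i \<odot>\<^bsub>M\<^esub> m i) {..<r} = \<zero>\<^bsub>M\<^esub> \<Longrightarrow> \<forall>i<r. a i = 0"
    and span: "\<And>x. lf.Rf \<subseteq> A\<^sub>L \<Longrightarrow> x \<in> carrier M \<Longrightarrow> \<exists>b. (\<forall>i<r. b i \<in> A\<^sub>L) \<and>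
       (\<forall>u. (\<forall>m\<in>carrier M. \<forall>n\<in>carrier M. u (m \<oplus>\<^bsub>M\<^esub> n) = u m + u n) \<and>
         (\<forall>a\<in>A\<^sub>L. \<forall>m\<in>carrier M. u (a \<odot>\<^bsub>M\<^esub> m) = a * u m) \<longrightarrow> u x = (\<Sum>i<r. b i * u (m i)))"
    using lf.ex_generators by blast
  define B where "B = col_mat r r (\<lambda>i. \<iota> (m i))"
  have B: "B \<in> carrier_mat r r" by (simp add: B_def)
  have colB: "col B j = \<iota> (m j)" if "j < r" for j
    unfolding B_def using that \<iota>c[OF m[OF that]] by (rule col_col_mat)
  show ?thesis
  proof (cases rule: coord_ring_cases)
    case 1
    have "A\<^sub>L = L"
    proof
      show "A\<^sub>L \<subseteq> L" unfolding coord_ring_L_def 1 by (rule compositum_subset[OF subrings(3)]) (use k_subset in auto)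
    qed (rule L_subset_A\<^sub>L)
    \<comment> \<open>Over the field \<open>L\<close> inverting \<open>a0\<close> adds nothing, so
      the chosen elements span \<open>M\<close>.\<close>
    then have "lf.Rf \<subseteq> A\<^sub>L"
      using subfield_divide[OF subfields(3)] lf.f L_closed(7) unfolding fractions_def by auto
    have coords: "\<exists>b. (\<forall>i<r. b i \<in> A\<^sub>L) \<and> \<iota> y = B *\<^sub>v vec r b" if y: "y \<in> carrier M" for y
    proof -
      obtain b where b: "\<forall>i<r. b i \<in> A\<^sub>L"
        and lin: "\<And>u. (\<forall>m\<in>carrier M. \<forall>n\<in>carrier M. u (m \<oplus>\<^bsub>M\<^esub> n) = u m + u n) \<Longrightarrow>
         (\<forall>a\<in>A\<^sub>L. \<forall>m\<in>carrier M. u (a \<odot>\<^bsub>M\<^esub> m) = a * u m) \<Longrightarrow> u y = (\<Sum>i<r. b i * u (m i))"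
        using span[OF \<open>lf.Rf \<subseteq> A\<^sub>L\<close> y] by blast
      have "\<iota> y = B *\<^sub>v vec r b"
      proof (rule eq_vecI)
        show "dim_vec (\<iota> y) = dim_vec (B *\<^sub>v vec r b)" using \<iota>c[OF y] B by simp
        fix j assume "j < dim_vec (B *\<^sub>v vec r b)"
        then have j: "j < r" using B by simp
        have "\<iota> y $ j = (\<Sum>i<r. b i * \<iota> (m i) $ j)"
          using vec_hom_components[OF \<iota>(1) j] by (intro lin[of "\<lambda>y. \<iota> y $ j"]) auto
        then show "\<iota> y $ j = (B *\<^sub>v vec r b) $ j" unfolding B_def using j by (simp add: col_mat_mult_vec)
      qed
      then show ?thesis using b by blast
    qed
    have "\<forall>j\<in>{..<r}. \<exists>b. (\<forall>i<r. b i \<in> A\<^sub>L) \<and> \<iota> (\<tau> (sigma_tensor D M (m j) 1)) = B *\<^sub>v vec r b"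
      using coords \<tau>M m by blast
    \<comment> \<open>The coordinates of \<tau> on the generators, which express that their span is
      \<tau>-stable.\<close>
    from bchoice[OF this] obtain c where c: "\<And>i j. i < r \<Longrightarrow> j < r \<Longrightarrow> c j i \<in> A\<^sub>L"
      and \<tau>c: "\<And>j. j < r \<Longrightarrow> \<iota> (\<tau> (sigma_tensor D M (m j) 1)) = B *\<^sub>v vec r (c j)" by auto
    define C where "C = col_mat r r (\<lambda>j. vec r (c j))"
    have C: "C \<in> carrier_mat r r" by (simp add: C_def)
    have "\<Phi> * map_mat \<sigma> B = B * C"
    proof (rule mat_eq_colsI[of _ r r])
      fix j assume j: "j < r"
      have "col (\<Phi> * map_mat \<sigma> B) j = \<Phi> *\<^sub>v map_vec \<sigma> (\<iota> (m j))"
        using \<Phi> B j by (simp add: col_mult2[of _ r r _ r] colB)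
      also have "\<dots> = B *\<^sub>v vec r (c j)" using \<iota>\<tau>[OF m[OF j]] \<tau>c[OF j] by simp
      also have "\<dots> = col (B * C) j" using B C j by (simp add: col_mult2[of _ r r _ r] C_def col_col_mat)
      finally show "col (\<Phi> * map_mat \<sigma> B) j = col (B * C) j" .
    qed (use \<Phi> B C in auto)
    \<comment> \<open>Constants from \<open>L\<close> are integral at infinity.\<close>
    moreover have "C $$ (i, j) \<in> infL D" if "i < r" "j < r" for i j
      using c[OF that] that \<open>A\<^sub>L = L\<close> L_subset_R R_subset_infL by (auto simp: C_def col_mat_def)
    ultimately have "B = 0\<^sub>m r r"
      by (intro dvr.pure_lattice_no_finite_submodule[OF pl pos(1) B C])
    then have "\<iota> x = 0\<^sub>v r" using coords[OF x] by auto
    then have "x = \<zero>\<^bsub>M\<^esub>" by (rule vec_hom_eq_zero[OF mod \<iota> x])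
    then show ?thesis using module_homs_zero[OF mod mod' fh] by simp
  next
    case 2
    note denom = ex_common_denominator[OF fractions_A\<^sub>L[OF 2]]
    \<comment> \<open>A kernel vector over the function field, cleared of denominators, would give a
      relation among the independent elements \<open>m i\<close>.\<close>
    have "det B \<noteq> 0"
    proof
      assume "det B = 0"
      then obtain w :: "'a vec" where w: "w \<in> carrier_vec r" "w \<noteq> 0\<^sub>v r" "B *\<^sub>v w = 0\<^sub>v r"
        using det_0_iff_vec_prod_zero_field[OF B] by blast
      obtain s where s: "s \<in> A\<^sub>L" "s \<noteq> 0" "\<And>i. i < r \<Longrightarrow> s * w $ i \<in> A\<^sub>L" using denom[of r "\<lambda>i. w $ i"] by blast
      have sw: "vec r (\<lambda>i. s * w $ i) = s \<cdot>\<^sub>v w" using w by (intro eq_vecI) auto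
      have fin: "finsum M (\<lambda>i. (s * w $ i) \<odot>\<^bsub>M\<^esub> m i) {..<r} \<in> carrier M"
        using s m M.smult_closed by (intro M.finsum_closed Pi_I) auto
      have "\<iota> (finsum M (\<lambda>i. (s * w $ i) \<odot>\<^bsub>M\<^esub> m i) {..<r}) = B *\<^sub>v (s \<cdot>\<^sub>v w)"
        using vec_hom_finsum[OF mod \<iota>(1), of r "\<lambda>i. s * w $ i" m] s m unfolding B_def sw by blast
      also have "\<dots> = 0\<^sub>v r" using mult_mat_vec[OF B w(1)] w(3) by auto
      finally have "finsum M (\<lambda>i. (s * w $ i) \<odot>\<^bsub>M\<^esub> m i) {..<r} = \<zero>\<^bsub>M\<^esub>"
        by (rule vec_hom_eq_zero[OF mod \<iota> fin])
      then have "\<forall>i<r. s * w $ i = 0" using indep[of "\<lambda>i. s * w $ i"] s by blast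
      then have "w = 0\<^sub>v r" using s w by (intro eq_vecI) auto
      then show False using w by blast
    qed
    then obtain Bi where Bi: "Bi \<in> carrier_mat r r" "Bi * B = 1\<^sub>m r" "B * Bi = 1\<^sub>m r"
      using invertible_det[OF B] by blast
    define B' where "B' = col_mat r' r (\<lambda>i. \<iota>' (f (m i)))"
    have B': "B' \<in> carrier_mat r' r" by (simp add: B'_def)
    \<comment> \<open>The unique candidate: it must send the image of each generator to the image of
      its value under \<open>f\<close>.\<close>
    define G where "G = B' * Bi"
    have G: "G \<in> carrier_mat r' r" unfolding G_def using B' Bi by simp
    have G_eq: "\<iota>' (f y) = G *\<^sub>v \<iota> y" if y: "y \<in> carrier M" for y
    proof -
      define w where "w = Bi *\<^sub>v \<iota> y"
      have w: "w \<in> carrier_vec r" unfolding w_def using Bi \<iota>c[OF y] by simp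
      have Bw: "B *\<^sub>v w = \<iota> y"
        unfolding w_def using B Bi \<iota>c[OF y] by (simp add: assoc_mult_mat_vec[symmetric, of B r r Bi r])
      obtain s where s: "s \<in> A\<^sub>L" "s \<noteq> 0" "\<And>i. i < r \<Longrightarrow> s * w $ i \<in> A\<^sub>L" using denom[of r "\<lambda>i. w $ i"] by blast
      have sw: "vec r (\<lambda>i. s * w $ i) = s \<cdot>\<^sub>v w" using w by (intro eq_vecI) auto
      define z where "z = finsum M (\<lambda>i. (s * w $ i) \<odot>\<^bsub>M\<^esub> m i) {..<r}"
      have z: "z \<in> carrier M" unfolding z_def using s m M.smult_closed by (intro M.finsum_closed Pi_I) auto
      have "\<iota> z = B *\<^sub>v (s \<cdot>\<^sub>v w)" unfolding z_def
        using vec_hom_finsum[OF mod \<iota>(1), of r "\<lambda>i. s * w $ i" m] s m unfolding B_def sw by blast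
      also have "\<dots> = s \<cdot>\<^sub>v \<iota> y" using mult_mat_vec[OF B w] Bw by simp
      also have "\<dots> = \<iota> (s \<odot>\<^bsub>M\<^esub> y)" using \<iota>(1) s y by (simp add: module_homs_def submod_vec_simps)
      finally have "z = s \<odot>\<^bsub>M\<^esub> y" using \<iota>(2) z s y M.smult_closed by (auto dest: inj_onD)
      have "s \<cdot>\<^sub>v \<iota>' (f y) = \<iota>' (f (s \<odot>\<^bsub>M\<^esub> y))" using comp s y by (simp add: module_homs_def submod_vec_simps)
      also have "\<dots> = B' *\<^sub>v (s \<cdot>\<^sub>v w)" unfolding \<open>z = s \<odot>\<^bsub>M\<^esub> y\<close>[symmetric] z_def
        using vec_hom_finsum[OF mod comp, of r "\<lambda>i. s * w $ i" m] s m unfolding B'_def sw by blast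
      also have "\<dots> = s \<cdot>\<^sub>v (B' *\<^sub>v w)" by (rule mult_mat_vec[OF B' w])
      finally have "inverse s \<cdot>\<^sub>v (s \<cdot>\<^sub>v \<iota>' (f y)) = inverse s \<cdot>\<^sub>v (s \<cdot>\<^sub>v (B' *\<^sub>v w))" by simp
      then have "\<iota>' (f y) = B' *\<^sub>v w" using s(2) by (simp add: smult_smult_assoc)
      also have "\<dots> = G *\<^sub>v \<iota> y"
        unfolding G_def w_def using B' Bi \<iota>c[OF y] by (intro assoc_mult_mat_vec[symmetric]) auto
      finally show ?thesis .
    qed
    \<comment> \<open>Commutation with \<tau> is checked on generators, that is on the columns of
      the Frobenius twist of \<open>B\<close>, which is invertible and then cancelled.\<close>
    have "\<Phi>' * map_mat \<sigma> G * map_mat \<sigma> B = G * \<Phi> * map_mat \<sigma> B"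
    proof (rule mat_eq_colsI[of _ r' r])
      fix j assume j: "j < r"
      note mj = m[OF j]
      have c: "map_vec \<sigma> (\<iota> (m j)) \<in> carrier_vec r" using \<iota>c[OF mj] by simp
      have "col (\<Phi>' * map_mat \<sigma> G * map_mat \<sigma> B) j = \<Phi>' * map_mat \<sigma> G *\<^sub>v map_vec \<sigma> (\<iota> (m j))"
        using \<Phi> G B j by (subst col_mult2[of _ r' r _ r]) (auto simp: colB)
      also have "\<dots> = \<Phi>' *\<^sub>v (map_mat \<sigma> G *\<^sub>v map_vec \<sigma> (\<iota> (m j)))"
        using \<Phi> G c by (intro assoc_mult_mat_vec) auto
      also have "\<dots> = \<Phi>' *\<^sub>v map_vec \<sigma> (\<iota>' (f (m j)))"
        unfolding G_eq[OF mj] map_\<sigma>[OF G \<iota>c[OF mj]] ..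
      also have "\<dots> = G *\<^sub>v (\<Phi> *\<^sub>v map_vec \<sigma> (\<iota> (m j)))"
        unfolding \<iota>f\<tau>[OF mj, symmetric] G_eq[OF \<tau>M[OF mj]] \<iota>\<tau>[OF mj] ..
      also have "\<dots> = G * \<Phi> *\<^sub>v map_vec \<sigma> (\<iota> (m j))"
        using \<Phi> G c by (intro assoc_mult_mat_vec[symmetric]) auto
      also have "\<dots> = col (G * \<Phi> * map_mat \<sigma> B) j"
        using \<Phi> G B j by (subst col_mult2[of _ r' r _ r]) (auto simp: colB)
      finally show "col (\<Phi>' * map_mat \<sigma> G * map_mat \<sigma> B) j = col (G * \<Phi> * map_mat \<sigma> B) j" .
    qed (use \<Phi> G B in auto)
    then have "\<Phi>' * map_mat \<sigma> G * map_mat \<sigma> B * map_mat \<sigma> Bi = G * \<Phi> * map_mat \<sigma> B * map_mat \<sigma> Bi"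
      by simp
    moreover have "map_mat \<sigma> B * map_mat \<sigma> Bi = 1\<^sub>m r"
      using dvr.map_funpow_mult[OF B Bi(1), of 1] dvr.map_funpow_one[of 1 r] Bi(3) by simp
    then have "Z * map_mat \<sigma> B * map_mat \<sigma> Bi = Z" if "Z \<in> carrier_mat r' r" for Z
      using that B Bi by (subst assoc_mult_mat[of _ r' r _ r _ r]) auto
    ultimately have "\<Phi>' * map_mat \<sigma> G = G * \<Phi>" using \<Phi> G by (metis map_carrier_mat mult_carrier_mat)
    then have "G = 0\<^sub>m r' r" by (rule dvr.pure_lattice_hom_zero[OF pl pl' G _ ne])
    then have "\<iota>' (f x) = 0\<^sub>v r'" using G_eq[OF x] \<iota>c[OF x] by auto
    then show ?thesis by (rule vec_hom_eq_zero[OF mod' \<iota>' fM[OF x]])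
  qed
qed

text \<open>The point is compatibility with \<tau>: every tensor is sent to the class of 0, which
  \<open>\<tau>'\<close> maps to 0 by additivity.\<close>

lemma zero_hom:
  assumes M: "module (ring_on A\<^sub>L) M" and M': "module (ring_on A\<^sub>L) M'"
    and \<tau>: "\<tau> \<in> module_homs A\<^sub>L (sigma_star D M) M" and \<tau>': "\<tau>' \<in> module_homs A\<^sub>L (sigma_star D M') M'"
  shows "(\<lambda>x\<in>carrier M. \<zero>\<^bsub>M'\<^esub>) \<in> motive_Hom D M \<tau> M' \<tau>'"
proof -
  interpret M: Module.module "ring_on A\<^sub>L" M by (rule M)
  interpret M': Module.module "ring_on A\<^sub>L" M' by (rule M')
  interpret tp: tensor_product A\<^sub>L A\<^sub>L \<sigma> M by (rule tensor_product_A\<^sub>L[OF M])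
  interpret tp': tensor_product A\<^sub>L A\<^sub>L \<sigma> M' by (rule tensor_product_A\<^sub>L[OF M'])
  define f where "f = (\<lambda>x\<in>carrier M. \<zero>\<^bsub>M'\<^esub>)"
  have fh: "f \<in> module_homs A\<^sub>L M M'"
    unfolding module_homs_def f_def using M'.smult_r_null M.smult_closed by auto
  have zero: "tp'.cong (frag_of (\<zero>\<^bsub>M'\<^esub>, b)) 0" if "b \<in> A\<^sub>L" for b
    using tp'.cong_add_left[of "\<zero>\<^bsub>M'\<^esub>" "\<zero>\<^bsub>M'\<^esub>" b] that by (intro tp'.cong_zeroI tp'.cong_double) simp
  have F: "tp'.cong (frag_extend (\<lambda>(m, b). frag_of (f m, b)) c) 0" if "c \<in> tp.chains" for c
    using that
  proof (induction rule: tp.chains_induct)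
    case (diff a b)
    show ?case using tp'.cong_diff[OF diff.IH] by (simp add: frag_extend_diff)
  qed (use zero in \<open>simp_all add: f_def\<close>)
  have "f (\<tau> t) = \<tau>' (sigma_star_map D M M' f t)" if t: "t \<in> carrier (sigma_star D M)" for t
  proof -
    obtain c where c: "c \<in> tp.chains" "t = tp.cls c" using t unfolding tp.carrier_BC by blast
    have "sigma_star_map D M M' f t = tp'.cls 0"
      unfolding c(2) base_change_map_cls[OF tensor_product_A\<^sub>L[OF M] tensor_product_A\<^sub>L[OF M'] fh]
      using F[OF c(1)] by (simp add: tp'.cls_eq_iff)
    moreover have mem: "tp'.cls 0 \<in> carrier (sigma_star D M')" unfolding tp'.carrier_BC using tp'.chains_0 by blast
    then have z: "\<tau>' (tp'.cls 0) \<in> carrier M'" using \<tau>' unfolding module_homs_def by blast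
    have "\<tau>' (tp'.cls 0 \<oplus>\<^bsub>sigma_star D M'\<^esub> tp'.cls 0) = \<tau>' (tp'.cls 0) \<oplus>\<^bsub>M'\<^esub> \<tau>' (tp'.cls 0)"
      using \<tau>' mem unfolding module_homs_def by blast
    then have "\<tau>' (tp'.cls 0) \<oplus>\<^bsub>M'\<^esub> \<tau>' (tp'.cls 0) = \<tau>' (tp'.cls 0)" by (simp add: tp'.BC_add)
    then have "\<tau>' (tp'.cls 0) = \<zero>\<^bsub>M'\<^esub>" using z M'.add.l_cancel_one by blast
    moreover have "\<tau> t \<in> carrier M" using \<tau> t unfolding module_homs_def by blast
    ultimately show ?thesis by (simp add: f_def)
  qed
  then show ?thesis using fh unfolding motive_Hom_def f_def by blast
qed

end

text \<open>The reference fraction \<open>k1 / l1\<close> need not come from the same motive; this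
  allows the weight of \<open>M\<close> to be computed from a pair of \<open>M'\<close>.\<close>

lemma weight_eq:
  assumes "pure_with D r M \<tau> k0 l0"
    and "\<And>k l. pure_with D r M \<tau> k l \<Longrightarrow> k * l1 = k1 * l" "0 < l1"
  shows "weight D r M \<tau> = of_nat k1 / of_nat l1"
proof -
  have eq: "of_nat k / of_nat l = (of_nat k1 / of_nat l1 :: rat)" if "pure_with D r M \<tau> k l" for k l
  proof -
    have "0 < l" using that by (simp add: pure_with_def)
    have "of_nat k * of_nat l1 = (of_nat k1 * of_nat l :: rat)"
      using assms(2)[OF that] by (metis of_nat_mult)
    then show ?thesis using \<open>0 < l\<close> assms(3) by (simp add: frac_eq_eq)
  qed
  show ?thesis unfolding weight_def
    by (rule the_equality) (use eq assms(1) in \<open>metis, metis\<close>)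
qed

theorem corollary1p23:
  fixes D :: "'a::field curve_data"
    and c :: "'a \<Rightarrow> 'a"
    and r d r' d' :: nat
    and M :: "('a, 'm) module" and \<tau> :: "('a, 'm) tensor \<Rightarrow> 'm"
    and M' :: "('a, 'n) module" and \<tau>' :: "('a, 'n) tensor \<Rightarrow> 'n"
  assumes "curve_setting D"
    and "characteristic D c"
    and "pure_anderson_motive D c r d M \<tau>"
    and "pure_anderson_motive D c r' d' M' \<tau>'"
    and "weight D r M \<tau> \<noteq> weight D r' M' \<tau>'"
  shows "motive_Hom D M \<tau> M' \<tau>' = {\<lambda>x\<in>carrier M. \<zero>\<^bsub>M'\<^esub>}"
proof -
  interpret curve D by (rule curve.intro) (rule assms(1))
  obtain v where v: "valuation_on F v" "Oinf D = valuation_ring F v"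
    using Oinf_dvr discrete_valuation_rings_iff by blast
  obtain \<pi> where \<pi>: "\<pi> \<in> F - {0}" "v \<pi> = 1" using v(1) unfolding valuation_on_def by (metis UNIV_I imageE)
  interpret curve_uniformizer D v \<pi>
    by (intro curve_uniformizer.intro curve_uniformizer_axioms.intro) (use v \<pi> in \<open>auto intro: curve_axioms\<close>)
  from assms(3,4) have lf: "locally_free A\<^sub>L r M" "locally_free A\<^sub>L r' M'"
    and \<tau>: "\<tau> \<in> module_homs A\<^sub>L (sigma_star D M) M" "\<tau>' \<in> module_homs A\<^sub>L (sigma_star D M') M'"
    and "\<exists>k l. pure_with D r M \<tau> k l" "\<exists>k l. pure_with D r' M' \<tau>' k l"
    unfolding pure_anderson_motive_def by blast+
  then obtain k0 l0 k1 l1 where p: "pure_with D r M \<tau> k0 l0" and p': "pure_with D r' M' \<tau>' k1 l1" by blast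
  have mods: "module (ring_on A\<^sub>L) M" "module (ring_on A\<^sub>L) M'" using lf by (simp_all add: locally_free_def)
  have "f = (\<lambda>x\<in>carrier M. \<zero>\<^bsub>M'\<^esub>)" if f: "f \<in> motive_Hom D M \<tau> M' \<tau>'" for f
  proof -
    have ext: "f \<in> extensional (carrier M)" using f by (simp add: motive_Hom_def)
    have "f x = \<zero>\<^bsub>M'\<^esub>" if x: "x \<in> carrier M" for x
    proof (rule ccontr)
      assume nz: "f x \<noteq> \<zero>\<^bsub>M'\<^esub>"
      \<comment> \<open>The nonzero value of \<open>f\<close> relates every pair of \<open>M\<close>
        to every pair of \<open>M'\<close>, which also makes both definite descriptions
        meaningful.\<close>
      have eq: "k * l' = k' * l" if "pure_with D r M \<tau> k l" "pure_with D r' M' \<tau>' k' l'" for k l k' l'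
        using hom_eq_zero[OF lf \<tau>(1) that f _ x] nz by blast
      have pos: "0 < l1" using p' by (simp add: pure_with_def)
      have "0 < l0" using p by (simp add: pure_with_def)
      have "weight D r M \<tau> = of_nat k1 / of_nat l1"
        by (rule weight_eq[OF p eq[OF _ p'] pos])
      moreover have "weight D r' M' \<tau>' = of_nat k0 / of_nat l0"
        by (rule weight_eq[OF p' _ \<open>0 < l0\<close>]) (use eq[OF p] in simp)
      moreover have "weight D r M \<tau> = of_nat k0 / of_nat l0"
      proof (rule weight_eq[OF p _ \<open>0 < l0\<close>])
        fix k l assume kl: "pure_with D r M \<tau> k l"
        \<comment> \<open>Two pairs of \<open>M\<close> are compared through the pair of
          \<open>M'\<close>, whose positive \<open>l1\<close> is then cancelled.\<close>
        have "(k * l0) * l1 = (k0 * l) * l1" using eq[OF kl p'] eq[OF p p'] by (metis mult.assoc mult.commute)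
        then show "k * l0 = k0 * l" using pos by simp
      qed
      ultimately show False using assms(5) by simp
    qed
    then show ?thesis using ext by (auto simp: extensional_def restrict_def)
  qed
  then show ?thesis using zero_hom[OF mods \<tau>] by blast
qed

end
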